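(* Let $0\le\theta<\pi/2$, $A,B\in\mathcal S_\theta$ with $0<mI\le\Re A,\ \Re B\le MI$ ($0<m\le M$), $\Phi:\mathbb M_n\to\mathbb M_n$ a positive unital linear map, $v\in[0,1]$, and $\sigma$ an operator mean with $!_v\le\sigma\le\nabla_v$. Then for every $p>0$, $$\big(\Re\Phi(A\nabla_vB)\big)^p\le\alpha^p\big(\Re\Phi(A\sigma B)\big)^p,$$ where $\alpha=\max\{K,4^{1-\frac2p}K\}$ and $K=\frac{(M+m)^2}{4mM}$.
   Context: $\Re X=\frac{X+X^*}{2}$; for Hermitian $X,Y$, $X\le Y$ means $Y-X$ is positive semidefinite. $\mathcal S_\theta$ ($0\le\theta<\pi/2$) is the set of $A\in\mathbb M_n$ whose numerical range lies in $\{z:\Re z>0,\ |\Im z|\le(\Re z)\tan\theta\}$. An operator mean $\sigma$ has an operator monotone representing function $f:(0,\infty)\to(0,\infty)$, $f(1)=1$, and $A\sigma B=A^{1/2}f(A^{-1/2}BA^{-1/2})A^{1/2}$ (also used for accretive $A,B$, i.e. $\Re A,\Re B>0$, via principal square roots and holomorphic functional calculus). Weighted arithmetic mean: $A\nabla_vB=vA+(1-v)B$ (representing function $v+(1-v)t$); weighted harmonic mean: $A!_vB=(vA^{-1}+(1-v)B^{-1})^{-1}$. For means with representing functions $g_1,g_2$, $\tau_1\le\tau_2$ means $g_1\le g_2$ on $(0,\infty)$. $\Phi$ positive: maps positive semidefinite to positive semidefinite; unital: $\Phi(I)=I$. *)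

theory Defs
  imports "HOL-Analysis.Analysis" "HOL-Computational_Algebra.Polynomial"
    "Jordan_Normal_Form.Char_Poly" "Jordan_Normal_Form.Schur_Decomposition"
begin

definition mat_poly :: "complex poly \<Rightarrow> complex mat \<Rightarrow> complex mat" where
  "mat_poly p X = foldr (\<lambda>c Y. c \<cdot>\<^sub>m 1\<^sub>m (dim_row X) + X * Y) (coeffs p)
                        (0\<^sub>m (dim_row X) (dim_row X))"

text \<open>Holomorphic functional calculus for a square matrix X and a function F holomorphic
  near the spectrum of X: F(X) = p(X) for any polynomial p that agrees with F together with
  its derivatives up to order (algebraic multiplicity - 1) at every eigenvalue of X
  (Hermite interpolation; this coincides with the Riesz-Dunford integral definition).\<close>
definition holo_calc :: "(complex \<Rightarrow> complex) \<Rightarrow> complex mat \<Rightarrow> complex mat" where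
  "holo_calc F X = (SOME Y. \<exists>p. Y = mat_poly p X \<and>
      (\<forall>z. \<forall>j < Polynomial.order z (char_poly X). (deriv ^^ j) F z = poly ((pderiv ^^ j) p) z))"

text \<open>Functional calculus of a real function on a Hermitian matrix (spectral calculus):
  f(X) = p(X) for any polynomial p interpolating f at the (real) eigenvalues of X.\<close>
definition herm_calc :: "(real \<Rightarrow> real) \<Rightarrow> complex mat \<Rightarrow> complex mat" where
  "herm_calc f X = (SOME Y. \<exists>p. Y = mat_poly p X \<and>
      (\<forall>z. poly (char_poly X) z = 0 \<longrightarrow> poly p z = complex_of_real (f (Re z))))"

definition hermitian_mat :: "complex mat \<Rightarrow> bool" where
  "hermitian_mat X \<longleftrightarrow> square_mat X \<and> mat_adjoint X = X"

definition re_mat :: "complex mat \<Rightarrow> complex mat" where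
  "re_mat X = (1/2 :: complex) \<cdot>\<^sub>m (X + mat_adjoint X)"

definition qform :: "complex mat \<Rightarrow> complex vec \<Rightarrow> complex" where
  "qform X x = (X *\<^sub>v x) \<bullet>c x"

definition psd_mat :: "complex mat \<Rightarrow> bool" where
  "psd_mat X \<longleftrightarrow> hermitian_mat X \<and>
     (\<forall>x \<in> carrier_vec (dim_row X). 0 \<le> Re (qform X x))"

definition pd_mat :: "complex mat \<Rightarrow> bool" where
  "pd_mat X \<longleftrightarrow> hermitian_mat X \<and>
     (\<forall>x \<in> carrier_vec (dim_row X). x \<noteq> 0\<^sub>v (dim_row X) \<longrightarrow> 0 < Re (qform X x))"

definition loewner_le :: "complex mat \<Rightarrow> complex mat \<Rightarrow> bool" where
  "loewner_le X Y \<longleftrightarrow> dim_row X = dim_row Y \<and> dim_col X = dim_col Y \<and>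
     hermitian_mat X \<and> hermitian_mat Y \<and> psd_mat (Y - X)"

definition num_range :: "complex mat \<Rightarrow> complex set" where
  "num_range A = {qform A x | x. x \<in> carrier_vec (dim_row A) \<and> x \<bullet>c x = 1}"

definition sector_class :: "nat \<Rightarrow> real \<Rightarrow> complex mat set" where
  "sector_class n \<theta> = {A \<in> carrier_mat n n.
      num_range A \<subseteq> {z. 0 < Re z \<and> \<bar>Im z\<bar> \<le> Re z * tan \<theta>}}"

definition positive_unital_linear :: "nat \<Rightarrow> (complex mat \<Rightarrow> complex mat) \<Rightarrow> bool" where
  "positive_unital_linear n \<Phi> \<longleftrightarrow>
     (\<forall>X \<in> carrier_mat n n. \<Phi> X \<in> carrier_mat n n) \<and>
     (\<forall>X \<in> carrier_mat n n. \<forall>Y \<in> carrier_mat n n. \<Phi> (X + Y) = \<Phi> X + \<Phi> Y) \<and>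
     (\<forall>c. \<forall>X \<in> carrier_mat n n. \<Phi> (c \<cdot>\<^sub>m X) = c \<cdot>\<^sub>m \<Phi> X) \<and>
     (\<forall>X \<in> carrier_mat n n. psd_mat X \<longrightarrow> psd_mat (\<Phi> X)) \<and>
     \<Phi> (1\<^sub>m n) = 1\<^sub>m n"

definition operator_monotone :: "(real \<Rightarrow> real) \<Rightarrow> bool" where
  "operator_monotone f \<longleftrightarrow> (\<forall>k X Y. X \<in> carrier_mat k k \<longrightarrow> Y \<in> carrier_mat k k \<longrightarrow>
      pd_mat X \<longrightarrow> pd_mat Y \<longrightarrow> loewner_le X Y \<longrightarrow>
      loewner_le (herm_calc f X) (herm_calc f Y))"

definition representing_function :: "(real \<Rightarrow> real) \<Rightarrow> bool" where
  "representing_function f \<longleftrightarrow> operator_monotone f \<and> (\<forall>t>0. 0 < f t) \<and> f 1 = 1"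

definition slit_plane :: "complex set" where
  "slit_plane = - (complex_of_real ` {..0})"

text \<open>A sigma B = A^(1/2) F(A^(-1/2) B A^(-1/2)) A^(1/2) for accretive A, B, where F is the
  holomorphic extension of the representing function to the slit plane, and the square roots
  are principal (csqrt), all via the holomorphic functional calculus.\<close>
definition mean_acc :: "(complex \<Rightarrow> complex) \<Rightarrow> complex mat \<Rightarrow> complex mat \<Rightarrow> complex mat" where
  "mean_acc F A B =
     (let S = holo_calc csqrt A; Si = holo_calc (\<lambda>z. inverse (csqrt z)) A
      in S * holo_calc F (Si * B * Si) * S)"

definition arith_mean :: "real \<Rightarrow> complex mat \<Rightarrow> complex mat \<Rightarrow> complex mat" where
  "arith_mean v A B = complex_of_real v \<cdot>\<^sub>m A + complex_of_real (1 - v) \<cdot>\<^sub>m B"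

end

theory Submission
  imports Defs "HOL-Complex_Analysis.Complex_Analysis" "HOL-Real_Asymp.Real_Asymp"
begin

text \<open>
  Write \<open>N = M + m\<close>, \<open>c = m M\<close>, \<open>h\<^sub>x z = z / (x z + 1 - x)\<close> for the representing function of \<open>!\<^sub>x\<close>, and let
  \<open>D\<close>, \<open>Z\<close> be the real parts of the arithmetic mean and of \<open>A \<sigma> B\<close>.

  Loewner's theorem is needed only in the form that \<open>F\<close> is a locally uniform limit of convex combinations
  \<open>g\<^sub>k\<close> of the \<open>h\<^sub>x\<close>. A linear functional \<open>\<Sum> c\<^sub>i \<phi> (t\<^sub>i)\<close> that is non-negative on all \<open>h\<^sub>x\<close> corresponds to a
  polynomial \<open>a\<^sup>2 + s b\<^sup>2\<close>, and both squares are handled by one inequality \<open>f(A') \<le> f(B')\<close> in which the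
  eigenvalues of \<open>A'\<close> and \<open>B'\<close> are interlacing and \<open>B' - A'\<close> has rank one; hence the functional is
  non-negative on \<open>f\<close>. By separation, \<open>f\<close> is approximated by convex combinations on finite sets, and Montel's
  theorem passes to the slit plane. Since \<open>f\<close> touches \<open>v + (1 - v) t\<close> at \<open>1\<close>, the mean of \<open>x\<close> in \<open>g\<^sub>k\<close> tends to \<open>v\<close>.

  For \<open>h\<^sub>x\<close> one gets \<open>Re \<langle>(A !\<^sub>x B) y, y\<rangle> \<ge> 2 Re \<langle>s, y\<rangle> - \<langle>W\<^sub>x s, s\<rangle>\<close> for every \<open>s\<close>, with a matrix \<open>W\<^sub>x\<close> that is affine
  in \<open>x\<close>, so the bound passes to the limit: \<open>Z \<ge> W\<inverse>\<close> with \<open>W = (N - D) / c\<close>. Choi's inequality then gives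
  \<open>X + c Y\<inverse> \<le> N\<close> for \<open>X = \<Phi> D\<close>, \<open>Y = \<Phi> Z\<close>. For \<open>r \<ge> 1\<close> this implies \<open>X\<^sup>r + c\<^sup>r Y\<^sup>-\<^sup>r \<le> N\<^sup>r\<close>, and
  \<open>\<parallel>P Q\<parallel> \<le> \<parallel>P + Q\<parallel>\<^sup>2 / 4\<close> for positive \<open>P, Q\<close> settles \<open>p = 2 r \<ge> 2\<close>; smaller \<open>p\<close> follow from \<open>p = 2\<close> by
  the Loewner-Heinz inequality.
\<close>

section \<open>Real polynomials that are non-negative on a half-line\<close>

text \<open>The matrix \<open>A^(-1/2) B A^(-1/2)\<close> need not be normal, so a pointwise
  inequality between functions on the positive axis says nothing about the real part of
  \<open>holo_calc\<close>. What does carry over is linearity: \<open>holo_calc F C\<close> depends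
  linearly on finitely many derivatives of \<open>F\<close> at the eigenvalues of \<open>C\<close>.
  A bound proved for every \<open>hmean x\<close> and affine in \<open>x\<close> therefore survives
  averaging and limits, and only the mean of the parameter is left in it. This is why
  \<open>f\<close> is approximated by mixtures on the slit plane, with all derivatives, and not
  merely on the real axis. Powers above one are not operator monotone, so \<open>X \<le> K Y\<close>
  would not give \<open>X^2 \<le> K^2 Y^2\<close>. The inequality
  \<open>X + c Y^(-1) \<le> N\<close> is strong enough: it bounds the norm of
  \<open>X Y^(-1)\<close> by \<open>N^2 / (4 c) = K\<close>, which is the same as
  \<open>X^2 \<le> K^2 Y^2\<close>. Inverses enter as the supremum over \<open>s\<close> of
  \<open>2 Re <s, y> - <P s, s>\<close>; inequalities between inverses thus become linear in the
  matrices and can be averaged and mapped by \<open>\<Phi>\<close>.\<close>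

lemma sos_halfline_mult:
  fixes a b c d x :: "'a::comm_ring_1"
  shows "(a*a + x*(b*b)) * (c*c + x*(d*d)) = (a*c + x*(b*d))*(a*c + x*(b*d)) + x*((a*d - b*c)*(a*d - b*c))"
  by (simp add: algebra_simps)

text \<open>Division by the square keeps the sign away from \<open>z\<close>; at \<open>z\<close>
  itself the sign follows by continuity.\<close>

lemma poly_nonneg_quotient:
  fixes q :: "real poly"
  assumes "\<And>x. x > 0 \<Longrightarrow> poly p x \<ge> 0" and p: "p = [:-z,1:] * ([:-z,1:] * q)" and x: "x > 0"
  shows "poly q x \<ge> 0"
proof (rule tendsto_lowerbound)
  have "poly q y \<ge> 0" if "y > 0" "y \<noteq> z" for y
  proof -
    have "poly p y = (y - z)\<^sup>2 * poly q y" by (simp add: p power2_eq_square algebra_simps)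
    then show ?thesis using assms(1)[OF that(1)] that(2) by (simp add: zero_le_mult_iff)
  qed
  moreover have "\<forall>\<^sub>F y in at x. y > 0" by (rule order_tendstoD(1)[OF tendsto_ident_at x])
  moreover have "\<forall>\<^sub>F y in at x. y \<noteq> z"
  proof (cases "x = z")
    case False then show ?thesis by (rule tendsto_imp_eventually_ne[OF tendsto_ident_at])
  qed (simp add: eventually_at_filter)
  ultimately show "\<forall>\<^sub>F y in at x. 0 \<le> poly q y" by (auto elim: eventually_elim2)
  show "(poly q \<longlongrightarrow> poly q x) (at x)" using isCont_def[of x "poly q"] by simp
qed simp

text \<open>Induction on the degree by splitting off factors. A root \<open>z \<le> 0\<close> gives
  the factor \<open>x - z = (-z) + x * 1\<close>; a positive root is at least double, so a square
  splits off; a non-real root brings its conjugate along.\<close>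

lemma poly_nonneg_halfline_sos:
  fixes p :: "real poly"
  assumes "\<And>x. x > 0 \<Longrightarrow> poly p x \<ge> 0"
  shows "\<exists>a b. p = a*a + [:0,1:]*(b*b)"
  using assms
proof (induction "degree p" arbitrary: p rule: less_induct)
  case less
  let ?X = "[:0,1:] :: real poly"
  show ?case
  proof (cases "degree p = 0")
    case True
    then obtain c where c: "p = [:c:]" by (metis degree_eq_zeroE)
    with less.prems[of 1] have "c \<ge> 0" by simp
    then have "p = [:sqrt c:] * [:sqrt c:] + ?X * (0*0)" by (simp add: c)
    then show ?thesis by blast
  next
    case False
    then have p0: "p \<noteq> 0" by auto
    \<comment> \<open>Closure under products, by \<open>sos_halfline_mult\<close>:
      \<open>a*a + x*(b*b)\<close> is the norm of \<open>a + b * sqrt (-x)\<close>, and norms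
      multiply.\<close>
    have factor: ?thesis
      if "p = q * r" "degree q > 0" "q = c*c + ?X*(d*d)" "\<And>x. x > 0 \<Longrightarrow> poly r x \<ge> 0" for q r c d
    proof -
      have "r \<noteq> 0" "q \<noteq> 0" using that(1) p0 by auto
      then have "degree r < degree p" using that(1,2) by (simp add: degree_mult_eq)
      from less.hyps[OF this] that(4) obtain a b where "r = a*a + ?X*(b*b)" by blast
      then show ?thesis unfolding that(1) that(3) using sos_halfline_mult by blast
    qed
    let ?P = "map_poly complex_of_real p"
    have "degree ?P = degree p" by simp
    then have "\<not> constant (poly ?P)" using False by (simp add: constant_degree)
    from Fundamental_Theorem_Algebra.fundamental_theorem_of_algebra[OF this] obtain z where z: "poly ?P z = 0" ..
    show ?thesis
    proof (cases "Im z = 0")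
      case True
      then have zr: "z = of_real (Re z)" by (simp add: complex_eq_iff)
      have root: "poly p (Re z) = 0"
        using z zr of_real_hom.poly_map_poly[of p "Re z"] by (metis of_real_eq_0_iff)
      then obtain r where r: "p = [:-Re z, 1:] * r" using poly_eq_0_iff_dvd dvd_def by metis
      show ?thesis
      proof (cases "Re z \<le> 0")
        case True
        have "poly r x \<ge> 0" if "x > 0" for x
        proof -
          have "poly p x = (x - Re z) * poly r x" by (simp add: r algebra_simps)
          with less.prems[OF that] that True show ?thesis by (simp add: zero_le_mult_iff)
        qed
        note nn = this
        have s: "[:-Re z, 1:] = [:sqrt (-Re z):] * [:sqrt (-Re z):] + ?X * ([:1:] * [:1:])"
          using True by simp
        show ?thesis by (rule factor[OF r _ s nn]) simp_all
      next
        case False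
        \<comment> \<open>A positive root is an interior minimum of a polynomial that is
          non-negative nearby, so the derivative vanishes there and the root is double.\<close>
        have "poly (pderiv p) (Re z) = 0"
        proof (rule DERIV_local_min[OF poly_DERIV, of "Re z"])
          show "\<forall>y. \<bar>Re z - y\<bar> < Re z \<longrightarrow> poly p (Re z) \<le> poly p y"
            using root less.prems by (auto simp: abs_less_iff)
        qed (use False in simp)
        then have "poly r (Re z) = 0" by (simp only: r pderiv_mult) (simp add: pderiv_pCons)
        then obtain q where q: "r = [:-Re z, 1:] * q" using poly_eq_0_iff_dvd dvd_def by metis
        have nn: "poly q x \<ge> 0" if "x > 0" for x
          using poly_nonneg_quotient[OF less.prems] r q that by blast
        have pq: "p = ([:-Re z, 1:] * [:-Re z, 1:]) * q" unfolding r q by (simp only: mult.assoc)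
        have s: "[:-Re z, 1:] * [:-Re z, 1:] = [:-Re z, 1:] * [:-Re z, 1:] + ?X * (0 * 0)" by simp
        show ?thesis by (rule factor[OF pq _ s nn]) (simp_all add: degree_mult_eq)
      qed
    next
      case False
      define Q where "Q = [:(cmod z)\<^sup>2, -2 * Re z, 1:]"
      have Qz: "poly (map_poly complex_of_real Q) z = 0"
        unfolding Q_def cmod_power2 by (simp add: complex_eq_iff power2_eq_square algebra_simps)
      \<comment> \<open>The remainder is real of degree at most one; vanishing at the non-real
        \<open>z\<close> forces it to be zero, so \<open>Q\<close> divides \<open>p\<close>.\<close>
      define R where "R = p mod Q"
      have Q0: "Q \<noteq> 0" "degree Q = 2" by (auto simp: Q_def)
      have "degree R < 2 \<or> R = 0" using degree_mod_less[OF Q0(1), of p] Q0(2) by (auto simp: R_def)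
      then have "degree R \<le> 1" by auto
      define c d where "c = coeff R 0" and "d = coeff R 1"
      have R: "R = [:c, d:]"
      proof (rule poly_eqI)
        fix i :: nat
        consider "i = 0" | "i = 1" | "i > 1" by linarith
        then show "coeff R i = coeff [:c, d:] i"
        proof cases
          case 3
          then have "coeff R i = 0" using \<open>degree R \<le> 1\<close> by (intro coeff_eq_0) simp
          moreover obtain k where "i = Suc (Suc k)" using 3 by (cases i) (auto simp: gr0_conv_Suc)
          ultimately show ?thesis by simp
        qed (auto simp: c_def d_def)
      qed
      have "p = Q * (p div Q) + R" by (simp add: R_def)
      have hm: "map_poly complex_of_real (a * b) = map_poly of_real a * map_poly of_real b" for a b
        by (rule poly_eqI) (simp add: coeff_map_poly coeff_mult)
      have "?P = map_poly complex_of_real Q * map_poly complex_of_real (p div Q) + map_poly complex_of_real R"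
        using \<open>p = Q * (p div Q) + R\<close> by (metis of_real_hom.map_poly_hom_add hm)
      then have "poly (map_poly complex_of_real R) z = 0" using z Qz by simp
      then have "c = 0 \<and> d = 0" using False
        by (auto simp: R of_real_hom.map_poly_pCons_hom complex_eq_iff)
      then have pq: "p = Q * (p div Q)" using R \<open>p = Q * (p div Q) + R\<close> by simp
      have Qpos: "poly Q x > 0" for x
      proof -
        have "poly Q x = (x - Re z)\<^sup>2 + (Im z)\<^sup>2"
          unfolding Q_def cmod_power2 by (simp add: power2_eq_square algebra_simps)
        then show ?thesis using False by (simp add: add_nonneg_pos)
      qed
      have nn: "poly (p div Q) x \<ge> 0" if "x > 0" for x
      proof -
          have "poly p x = poly Q x * poly (p div Q) x" using pq by (metis poly_mult)
          with less.prems[OF that] Qpos[of x] show ?thesis by (simp add: zero_le_mult_iff)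
        qed
      have s: "2 * cmod z - 2 * Re z \<ge> 0" using complex_Re_le_cmod[of z] by simp
      \<comment> \<open>\<open>x^2 - 2 (Re z) x + |z|^2 = (x - |z|)^2 + 2 (|z| - Re z) x\<close>.\<close>
      have Qs: "Q = [:- cmod z, 1:] * [:- cmod z, 1:] + ?X * ([:sqrt (2 * cmod z - 2 * Re z):] * [:sqrt (2 * cmod z - 2 * Re z):])"
        using s by (simp add: Q_def power2_eq_square)
      show ?thesis by (rule factor[OF pq _ Qs nn]) (use Q0 in auto)
    qed
  qed
qed

text \<open>The two squares cannot cancel, since their degrees have different parity.\<close>
lemma degree_sos_halfline:
  fixes a b :: "real poly"
  assumes "degree (a*a + [:0,1:]*(b*b)) < 2 * n" and "n > 0"
  shows "degree a < n" and "degree b < n"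
proof -
  have d1: "degree (a*a) = 2 * degree a" by (cases "a = 0") (auto simp: degree_mult_eq)
  have d2: "b = 0 \<or> degree ([:0,1:]*(b*b)) = 2 * degree b + 1"
    by (cases "b = 0") (auto simp: degree_mult_eq simp del: mult_pCons_left)
  have "degree a < n \<and> degree b < n"
  proof (cases "b = 0")
    case True with assms d1 show ?thesis by simp
  next
    case False
    with d2 have d2: "degree ([:0,1:]*(b*b)) = 2 * degree b + 1" by blast
    show ?thesis
    proof (cases "degree (a*a) < degree ([:0,1:]*(b*b))")
      case True
      then have "degree (a*a + [:0,1:]*(b*b)) = 2 * degree b + 1"
        using degree_add_eq_right d2 by metis
      with assms True d1 d2 show ?thesis by linarith
    next
      case F: False
      then have "degree ([:0,1:]*(b*b)) < degree (a*a)" using d1 d2 by presburger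
      then have "degree (a*a + [:0,1:]*(b*b)) = 2 * degree a"
        using degree_add_eq_left d1 by metis
      with assms F d1 d2 show ?thesis by linarith
    qed
  qed
  then show "degree a < n" and "degree b < n" by auto
qed

section \<open>Complex matrices, Cayley-Hamilton and the spectral theorem\<close>

unbundle no vec_syntax
no_notation fps_nth (infixl "$" 75)

lemma mat_adjoint_carrier [simp]: "X \<in> carrier_mat n m \<Longrightarrow> mat_adjoint X \<in> carrier_mat m n"
  unfolding mat_adjoint_def by auto

lemma mat_adjoint_dim [simp]: "dim_row (mat_adjoint X) = dim_col X" "dim_col (mat_adjoint X) = dim_row X"
  unfolding mat_adjoint_def by auto

lemma mat_adjoint_index [simp]:
  "i < dim_col X \<Longrightarrow> j < dim_row X \<Longrightarrow> mat_adjoint X $$ (i, j) = cnj (X $$ (j, i))"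
  unfolding mat_adjoint_def by (simp add: mat_of_rows_index conjugate_complex_def)

lemma mat_adjoint_mult:
  fixes X Y :: "complex mat"
  assumes "X \<in> carrier_mat n m" "Y \<in> carrier_mat m k"
  shows "mat_adjoint (X * Y) = mat_adjoint Y * mat_adjoint X"
proof (rule eq_matI)
  fix i j assume "i < dim_row (mat_adjoint Y * mat_adjoint X)" "j < dim_col (mat_adjoint Y * mat_adjoint X)"
  then have ij: "i < k" "j < n" using assms by auto
  have "(mat_adjoint Y * mat_adjoint X) $$ (i, j) = (\<Sum>l<m. mat_adjoint Y $$ (i, l) * mat_adjoint X $$ (l, j))"
    using assms ij by (simp add: scalar_prod_def atLeast0LessThan)
  also have "\<dots> = (\<Sum>l<m. cnj (X $$ (j, l) * Y $$ (l, i)))"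
    using assms ij by (intro sum.cong) auto
  also have "\<dots> = mat_adjoint (X * Y) $$ (i, j)"
    using assms ij by (simp add: scalar_prod_def atLeast0LessThan)
  finally show "mat_adjoint (X * Y) $$ (i, j) = (mat_adjoint Y * mat_adjoint X) $$ (i, j)" ..
qed (use assms in auto)

lemma mat_adjoint_adjoint [simp]: "mat_adjoint (mat_adjoint X) = (X :: complex mat)"
  by (rule eq_matI) auto

lemma mat_adjoint_add:
  "X \<in> carrier_mat n m \<Longrightarrow> Y \<in> carrier_mat n m \<Longrightarrow> mat_adjoint (X + Y) = mat_adjoint X + mat_adjoint (Y :: complex mat)"
  by (rule eq_matI) auto

lemma mat_adjoint_smult:
  "mat_adjoint (c \<cdot>\<^sub>m X) = cnj c \<cdot>\<^sub>m mat_adjoint (X :: complex mat)"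
  by (rule eq_matI) auto

lemma mat_adjoint_one [simp]: "mat_adjoint (1\<^sub>m n) = (1\<^sub>m n :: complex mat)"
  by (rule eq_matI) auto

definition ip :: "complex vec \<Rightarrow> complex vec \<Rightarrow> complex" where
  "ip x y = (\<Sum>i<dim_vec y. x $ i * cnj (y $ i))"

lemma ip_eq_cscalar_prod: "x \<bullet>c y = ip x y"
  unfolding ip_def scalar_prod_def by (auto simp: atLeast0LessThan conjugate_complex_def intro!: sum.cong)

lemma qform_eq_ip: "qform X x = ip (X *\<^sub>v x) x"
  unfolding qform_def ip_eq_cscalar_prod ..

abbreviation rform :: "complex mat \<Rightarrow> complex vec \<Rightarrow> real" where
  "rform X x \<equiv> Re (ip (X *\<^sub>v x) x)"

lemma ip_sym: "dim_vec x = dim_vec y \<Longrightarrow> ip y x = cnj (ip x y)"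
  unfolding ip_def by (auto simp: intro!: sum.cong)

lemma ip_add_left: "x \<in> carrier_vec n \<Longrightarrow> y \<in> carrier_vec n \<Longrightarrow> z \<in> carrier_vec n \<Longrightarrow> ip (x + y) z = ip x z + ip y z"
  unfolding ip_def by (auto simp: algebra_simps sum.distrib)
lemma ip_add_right: "x \<in> carrier_vec n \<Longrightarrow> y \<in> carrier_vec n \<Longrightarrow> z \<in> carrier_vec n \<Longrightarrow> ip z (x + y) = ip z x + ip z y"
  unfolding ip_def by (auto simp: algebra_simps sum.distrib)
lemma ip_smult_left: "x \<in> carrier_vec n \<Longrightarrow> y \<in> carrier_vec n \<Longrightarrow> ip (c \<cdot>\<^sub>v x) y = c * ip x y"
  unfolding ip_def by (auto simp: algebra_simps sum_distrib_left)
lemma ip_smult_right: "x \<in> carrier_vec n \<Longrightarrow> y \<in> carrier_vec n \<Longrightarrow> ip x (c \<cdot>\<^sub>v y) = cnj c * ip x y"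
  unfolding ip_def by (auto simp: algebra_simps sum_distrib_left)
lemma ip_minus_left: "x \<in> carrier_vec n \<Longrightarrow> y \<in> carrier_vec n \<Longrightarrow> z \<in> carrier_vec n \<Longrightarrow> ip (x - y) z = ip x z - ip y z"
  unfolding ip_def by (auto simp: algebra_simps sum_subtractf)
lemma ip_minus_right: "x \<in> carrier_vec n \<Longrightarrow> y \<in> carrier_vec n \<Longrightarrow> z \<in> carrier_vec n \<Longrightarrow> ip z (x - y) = ip z x - ip z y"
  unfolding ip_def by (auto simp: algebra_simps sum_subtractf)

lemma ip_self: "ip x x = of_real (\<Sum>i<dim_vec x. (cmod (x $ i))\<^sup>2)"
  unfolding ip_def by (simp add: complex_norm_square[symmetric] del: of_real_power of_real_sum)
     (simp add: of_real_sum)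

lemma ip_self_ge0 [simp]: "Re (ip x x) \<ge> 0" "Im (ip x x) = 0"
  unfolding ip_self by (auto intro: sum_nonneg)

lemma ip_self_eq_0_iff: "x \<in> carrier_vec n \<Longrightarrow> Re (ip x x) = 0 \<longleftrightarrow> x = 0\<^sub>v n"
  unfolding ip_self by (subst Re_complex_of_real, subst sum_nonneg_eq_0_iff) (auto intro!: eq_vecI)

lemma ip_self_pos: "x \<in> carrier_vec n \<Longrightarrow> x \<noteq> 0\<^sub>v n \<Longrightarrow> Re (ip x x) > 0"
  using ip_self_eq_0_iff ip_self_ge0(1)[of x] by (metis less_eq_real_def)

lemma ip_adjoint:
  assumes "X \<in> carrier_mat n m" "x \<in> carrier_vec m" "y \<in> carrier_vec n"
  shows "ip (X *\<^sub>v x) y = ip x (mat_adjoint X *\<^sub>v y)"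
proof -
  have "ip (X *\<^sub>v x) y = (\<Sum>i<n. \<Sum>j<m. X $$ (i, j) * x $ j * cnj (y $ i))"
    using assms by (auto simp: ip_def scalar_prod_def sum_distrib_right atLeast0LessThan intro!: sum.cong)
  also have "\<dots> = (\<Sum>j<m. \<Sum>i<n. X $$ (i, j) * x $ j * cnj (y $ i))" by (rule sum.swap)
  also have "\<dots> = ip x (mat_adjoint X *\<^sub>v y)"
    using assms by (auto simp: ip_def scalar_prod_def sum_distrib_left atLeast0LessThan intro!: sum.cong)
  finally show ?thesis .
qed

lemma eq_mat_mult_vecI:
  assumes "A \<in> carrier_mat n m" "B \<in> carrier_mat n m"
    and "\<And>v :: complex vec. v \<in> carrier_vec m \<Longrightarrow> A *\<^sub>v v = B *\<^sub>v v"
  shows "A = B"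
proof (rule eq_matI)
  fix i j assume ij: "i < dim_row B" "j < dim_col B"
  have *: "C $$ (i, j) = (C *\<^sub>v unit_vec m j) $ i" if "C \<in> carrier_mat n m" for C :: "complex mat"
    using that ij assms scalar_prod_right_unit[of j m "row C i"] by simp
  show "A $$ (i, j) = B $$ (i, j)"
    unfolding *[OF assms(1)] *[OF assms(2)] by (simp add: assms(3))
qed (use assms in auto)

text \<open>With one fixed dimension the side conditions of the matrix laws become carrier facts
  that simplification can discharge. Products are associated to the right, down to the
  vector.\<close>

locale sq_mat = fixes n :: nat
begin

lemma sq_carrier [simp]:
  "A \<in> carrier_mat n n \<Longrightarrow> B \<in> carrier_mat n n \<Longrightarrow> A * B \<in> carrier_mat n n"
  "A \<in> carrier_mat n n \<Longrightarrow> B \<in> carrier_mat n n \<Longrightarrow> A - B \<in> carrier_mat n n"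
  "A \<in> carrier_mat n n \<Longrightarrow> x \<in> carrier_vec n \<Longrightarrow> A *\<^sub>v x \<in> carrier_vec n"
  by auto

lemma sq_assoc [simp]:
  fixes A B C :: "complex mat"
  assumes "A \<in> carrier_mat n n" "B \<in> carrier_mat n n"
  shows "C \<in> carrier_mat n n \<Longrightarrow> A * B * C = A * (B * C)"
    and "x \<in> carrier_vec n \<Longrightarrow> A * B *\<^sub>v x = A *\<^sub>v (B *\<^sub>v x)"
  using assms by auto

lemma sq_smult [simp]:
  fixes A B :: "complex mat"
  assumes "A \<in> carrier_mat n n"
  shows "B \<in> carrier_mat n n \<Longrightarrow> (c \<cdot>\<^sub>m A) * B = c \<cdot>\<^sub>m (A * B)"
    and "B \<in> carrier_mat n n \<Longrightarrow> A * (c \<cdot>\<^sub>m B) = c \<cdot>\<^sub>m (A * B)"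
    and "x \<in> carrier_vec n \<Longrightarrow> (c \<cdot>\<^sub>m A) *\<^sub>v x = c \<cdot>\<^sub>v (A *\<^sub>v x)"
    and "x \<in> carrier_vec n \<Longrightarrow> A *\<^sub>v (c \<cdot>\<^sub>v x) = c \<cdot>\<^sub>v (A *\<^sub>v x)"
  using assms by (auto simp: mult_smult_distrib mult_smult_assoc_mat mult_mat_vec
    scalar_prod_def sum_distrib_left mult.assoc intro!: eq_vecI)

lemma sq_distrib:
  fixes A B C :: "complex mat"
  assumes "A \<in> carrier_mat n n"
  shows "B \<in> carrier_mat n n \<Longrightarrow> C \<in> carrier_mat n n \<Longrightarrow> (A + B) * C = A * C + B * C"
    and "B \<in> carrier_mat n n \<Longrightarrow> C \<in> carrier_mat n n \<Longrightarrow> A * (B + C) = A * B + A * C"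
    and "B \<in> carrier_mat n n \<Longrightarrow> C \<in> carrier_mat n n \<Longrightarrow> (A - B) * C = A * C - B * C"
    and "B \<in> carrier_mat n n \<Longrightarrow> C \<in> carrier_mat n n \<Longrightarrow> A * (B - C) = A * B - A * C"
    and "B \<in> carrier_mat n n \<Longrightarrow> x \<in> carrier_vec n \<Longrightarrow> (A + B) *\<^sub>v x = A *\<^sub>v x + B *\<^sub>v x"
    and "B \<in> carrier_mat n n \<Longrightarrow> x \<in> carrier_vec n \<Longrightarrow> (A - B) *\<^sub>v x = A *\<^sub>v x - B *\<^sub>v x"
    and "x \<in> carrier_vec n \<Longrightarrow> y \<in> carrier_vec n \<Longrightarrow> A *\<^sub>v (x + y) = A *\<^sub>v x + A *\<^sub>v y"
    and "x \<in> carrier_vec n \<Longrightarrow> y \<in> carrier_vec n \<Longrightarrow> A *\<^sub>v (x - y) = A *\<^sub>v x - A *\<^sub>v y"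
  using assms by (auto simp: add_mult_distrib_mat mult_add_distrib_mat minus_mult_distrib_mat
    mult_minus_distrib_mat add_mult_distrib_mat_vec minus_mult_distrib_mat_vec mult_add_distrib_mat_vec
    mult_minus_distrib_mat_vec)

lemma sq_adjoint [simp]:
  assumes "A \<in> carrier_mat n n"
  shows "B \<in> carrier_mat n n \<Longrightarrow> mat_adjoint (A * B) = mat_adjoint B * mat_adjoint (A :: complex mat)"
  using assms by (rule mat_adjoint_mult)

lemmas ip_sq = ip_add_left[of _ n] ip_add_right[of _ n] ip_smult_left[of _ n] ip_smult_right[of _ n]
  ip_minus_left[of _ n] ip_minus_right[of _ n]

end

section \<open>Polynomials of a matrix and the Cayley-Hamilton theorem\<close>

lemma mat_poly_0: "mat_poly 0 X = 0\<^sub>m (dim_row X) (dim_row X)"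
  unfolding mat_poly_def by simp

lemma mat_poly_pCons:
  assumes "X \<in> carrier_mat n n"
  shows "mat_poly (pCons a p) X = a \<cdot>\<^sub>m 1\<^sub>m n + X * mat_poly p X"
proof (cases "a = 0 \<and> p = 0")
  case True
  then show ?thesis using assms by (auto simp: mat_poly_0 intro!: eq_matI)
next
  case False
  then have "coeffs (pCons a p) = a # coeffs p" by (auto simp: cCons_def)
  then show ?thesis unfolding mat_poly_def using assms by simp
qed

lemma mat_poly_dim [simp]: "dim_row (mat_poly p X) = dim_row X" "dim_col (mat_poly p X) = dim_row X"
proof -
  have "dim_row (foldr (\<lambda>c Y. c \<cdot>\<^sub>m 1\<^sub>m (dim_row X) + X * Y) cs (0\<^sub>m (dim_row X) (dim_row X))) = dim_row X \<and>
    dim_col (foldr (\<lambda>c Y. c \<cdot>\<^sub>m 1\<^sub>m (dim_row X) + X * Y) cs (0\<^sub>m (dim_row X) (dim_row X))) = dim_row X" for cs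
    by (induction cs) auto
  then show "dim_row (mat_poly p X) = dim_row X" "dim_col (mat_poly p X) = dim_row X"
    unfolding mat_poly_def by auto
qed

lemma mat_poly_carrier [simp]: "X \<in> carrier_mat n n \<Longrightarrow> mat_poly p X \<in> carrier_mat n n"
  by (induction p) (auto simp: mat_poly_0 mat_poly_pCons)

lemma mat_poly_add:
  assumes X: "X \<in> carrier_mat n n"
  shows "mat_poly (p + q) X = mat_poly p X + mat_poly q X"
proof (induction p q rule: poly_induct2)
  case 0
  then show ?case using X by (simp add: mat_poly_0)
next
  case (pCons a p b q)
  let ?P = "mat_poly p X" and ?Q = "mat_poly q X"
  interpret sq_mat n .
  have c: "?P \<in> carrier_mat n n" "?Q \<in> carrier_mat n n" using X by auto
  have "mat_poly (pCons a p + pCons b q) X = (a + b) \<cdot>\<^sub>m 1\<^sub>m n + X * (?P + ?Q)"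
    using X by (simp add: mat_poly_pCons pCons)
  also have "X * (?P + ?Q) = X * ?P + X * ?Q" using X c by (simp add: sq_distrib)
  also have "(a + b) \<cdot>\<^sub>m 1\<^sub>m n + (X * ?P + X * ?Q) = (a \<cdot>\<^sub>m 1\<^sub>m n + X * ?P) + (b \<cdot>\<^sub>m 1\<^sub>m n + X * ?Q)"
    using X c by (intro eq_matI) (auto simp: algebra_simps)
  finally show ?case using X by (simp add: mat_poly_pCons)
qed

lemma mat_poly_smult:
  assumes X: "X \<in> carrier_mat n n"
  shows "mat_poly (Polynomial.smult c p) X = c \<cdot>\<^sub>m mat_poly p X"
proof (induction p)
  case 0
  then show ?case using X by (auto simp: mat_poly_0 intro!: eq_matI)
next
  case (pCons a p)
  let ?P = "mat_poly p X"
  interpret sq_mat n .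
  have c: "?P \<in> carrier_mat n n" using X by auto
  have "mat_poly (Polynomial.smult c (pCons a p)) X = (c * a) \<cdot>\<^sub>m 1\<^sub>m n + X * (c \<cdot>\<^sub>m ?P)"
    using X by (simp add: mat_poly_pCons pCons)
  also have "X * (c \<cdot>\<^sub>m ?P) = c \<cdot>\<^sub>m (X * ?P)" using X c by simp
  also have "(c * a) \<cdot>\<^sub>m 1\<^sub>m n + c \<cdot>\<^sub>m (X * ?P) = c \<cdot>\<^sub>m (a \<cdot>\<^sub>m 1\<^sub>m n + X * ?P)"
    using X c by (intro eq_matI) (auto simp: algebra_simps)
  finally show ?case using X by (simp add: mat_poly_pCons)
qed

lemma mat_poly_mult:
  assumes X: "X \<in> carrier_mat n n"
  shows "mat_poly (p * q) X = mat_poly p X * mat_poly q X"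
proof (induction p)
  case 0
  then show ?case using X by (simp add: mat_poly_0 left_mult_zero_mat[of _ n n])
next
  case (pCons a p)
  let ?P = "mat_poly p X" and ?Q = "mat_poly q X"
  interpret sq_mat n .
  have c: "?P \<in> carrier_mat n n" "?Q \<in> carrier_mat n n" using X by auto
  have "mat_poly (pCons a p * q) X = a \<cdot>\<^sub>m ?Q + (0 \<cdot>\<^sub>m 1\<^sub>m n + X * (?P * ?Q))"
    using X by (simp add: mat_poly_add mat_poly_smult mat_poly_pCons pCons)
  also have "0 \<cdot>\<^sub>m 1\<^sub>m n + X * (?P * ?Q) = (X * ?P) * ?Q"
    using X c by (simp, intro eq_matI) auto
  also have "a \<cdot>\<^sub>m ?Q + (X * ?P) * ?Q = (a \<cdot>\<^sub>m 1\<^sub>m n) * ?Q + (X * ?P) * ?Q"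
    using c left_mult_one_mat[OF c(2)] by simp
  also have "\<dots> = (a \<cdot>\<^sub>m 1\<^sub>m n + X * ?P) * ?Q"
    using X c by (intro add_mult_distrib_mat[symmetric, of _ n n _ _ n]) auto
  finally show ?case using X by (simp add: mat_poly_pCons)
qed

lemma mat_poly_1: "X \<in> carrier_mat n n \<Longrightarrow> mat_poly [:a:] X = a \<cdot>\<^sub>m 1\<^sub>m n"
  by (auto simp: mat_poly_pCons mat_poly_0 intro!: eq_matI)

lemma mat_poly_X: "X \<in> carrier_mat n n \<Longrightarrow> mat_poly [:0, 1:] X = X"
  by (subst mat_poly_pCons, simp, subst mat_poly_1) (auto intro!: eq_matI)

lemma mat_poly_linear: "X \<in> carrier_mat n n \<Longrightarrow> mat_poly [:a, b:] X = a \<cdot>\<^sub>m 1\<^sub>m n + b \<cdot>\<^sub>m X"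
  by (subst mat_poly_pCons, simp, subst mat_poly_1) (auto simp: mult_smult_distrib)

lemma mat_poly_similar:
  assumes X: "X \<in> carrier_mat n n" "P \<in> carrier_mat n n" "Q \<in> carrier_mat n n"
    and inv: "P * Q = 1\<^sub>m n" "Q * P = 1\<^sub>m n"
  shows "mat_poly p (P * X * Q) = P * mat_poly p X * Q"
proof (induction p)
  case 0
  then show ?case using X by (simp add: mat_poly_0)
next
  case (pCons a p)
  let ?R = "mat_poly p X"
  interpret sq_mat n .
  have c: "?R \<in> carrier_mat n n" using X by auto
  have QP: "Q * (P * Z) = Z" if "Z \<in> carrier_mat n n" for Z
    using X inv that by (metis sq_assoc(1) left_mult_one_mat)
  have 1: "P * X * Q * (P * ?R * Q) = P * (X * ?R) * Q"
    using X c by (simp add: QP)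
  have 2: "a \<cdot>\<^sub>m 1\<^sub>m n = P * (a \<cdot>\<^sub>m 1\<^sub>m n) * Q"
    using X inv by simp
  have "mat_poly (pCons a p) (P * X * Q) = a \<cdot>\<^sub>m 1\<^sub>m n + P * X * Q * mat_poly p (P * X * Q)"
    by (rule mat_poly_pCons) (use X in simp)
  also have "\<dots> = P * (a \<cdot>\<^sub>m 1\<^sub>m n) * Q + P * (X * ?R) * Q"
    unfolding pCons 1 2[symmetric] ..
  also have "\<dots> = P * (a \<cdot>\<^sub>m 1\<^sub>m n + X * ?R) * Q"
    using X c by (simp add: sq_distrib del: sq_smult)
  finally show ?case unfolding mat_poly_pCons[OF X(1)] .
qed

text \<open>The factor \<open>T - T $$ (k, k)\<close> maps vectors supported on the first
  \<open>k + 1\<close> coordinates to vectors supported on the first \<open>k\<close>; each factor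
  shortens the support by one until nothing is left.\<close>

lemma mat_poly_upper_triangular_kills:
  assumes T: "T \<in> carrier_mat n n" "upper_triangular T" and "k \<le> n"
    and "v \<in> carrier_vec n" "\<And>i. k \<le> i \<Longrightarrow> i < n \<Longrightarrow> v $ i = 0"
  shows "mat_poly (\<Prod>i<k. [:- T $$ (i, i), 1:]) T *\<^sub>v v = 0\<^sub>v n"
  using assms(3-)
proof (induction k arbitrary: v)
  case 0
  then have "v = 0\<^sub>v n" by (intro eq_vecI) auto
  then show ?case using T by (simp add: one_pCons mat_poly_1) (intro eq_vecI, auto)
next
  case (Suc k)
  let ?L = "[:- T $$ (k, k), 1:]" and ?P = "\<Prod>i<k. [:- T $$ (i, i), 1:]"
  have v: "v \<in> carrier_vec n" and k: "k < n" using Suc.prems by auto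
  define w where "w = mat_poly ?L T *\<^sub>v v"
  have w: "w \<in> carrier_vec n" unfolding w_def using T v by (auto intro!: mult_mat_vec_carrier)
  have "w $ i = 0" if i: "k \<le> i" "i < n" for i
  proof -
    have "w $ i = - T $$ (k, k) * v $ i + (\<Sum>j<n. T $$ (i, j) * v $ j)"
    proof -
      interpret sq_mat n .
      have "w = - T $$ (k, k) \<cdot>\<^sub>v v + T *\<^sub>v v"
        unfolding w_def using T v by (simp add: mat_poly_linear[of _ n] sq_distrib)
      then show ?thesis using T v i by (simp add: scalar_prod_def atLeast0LessThan)
    qed
    moreover have "(\<Sum>j<n. T $$ (i, j) * v $ j) = T $$ (k, k) * v $ i"
    proof -
      have "T $$ (i, j) * v $ j = (if j = i then T $$ (k, k) * v $ i else 0)" if "j < n" for j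
      proof (cases "j = i")
        case True then show ?thesis using Suc.prems(3)[of i] i by (cases "i = k") auto
      next
        case False
        then consider "j < i" | "j > i" by linarith
        then show ?thesis
        proof cases
          case 1 then show ?thesis using T i by (auto simp: upper_triangular_def)
        next
          case 2 then show ?thesis using Suc.prems(3)[of j] i that by auto
        qed
      qed
      then have "(\<Sum>j<n. T $$ (i, j) * v $ j) = (\<Sum>j<n. if j = i then T $$ (k, k) * v $ i else 0)"
        by (intro sum.cong) auto
      then show ?thesis using i by simp
    qed
    ultimately show ?thesis by simp
  qed
  then have "mat_poly ?P T *\<^sub>v w = 0\<^sub>v n" using Suc.IH w k by simp
  moreover have "mat_poly (\<Prod>i<Suc k. [:- T $$ (i, i), 1:]) T *\<^sub>v v = mat_poly ?P T *\<^sub>v w"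
    unfolding w_def using T v by (simp add: mat_poly_mult assoc_mult_mat_vec[of _ n n _ n] del: mult_pCons_right)
  ultimately show ?case by simp
qed

text \<open>A Schur decomposition reduces the claim to an upper triangular matrix, whose diagonal
  lists the roots of the characteristic polynomial.\<close>

theorem Cayley_Hamilton:
  assumes X: "X \<in> carrier_mat n n"
  shows "mat_poly (char_poly X) X = 0\<^sub>m n n"
proof -
  from char_poly_factorized[OF X] obtain es where es: "char_poly X = (\<Prod>a\<leftarrow>es. [:- a, 1:])" by blast
  obtain T P Q where sd: "schur_decomposition X es = (T, P, Q)" by (cases "schur_decomposition X es") auto
  from schur_decomposition[OF X es sd]
  have sim: "similar_mat_wit X T P Q" and ut: "upper_triangular T" by auto
  note s = similar_mat_witD2[OF X sim]
  have "char_poly X = char_poly T" using sim by (intro char_poly_similar) (auto simp: similar_mat_def)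
  also have "\<dots> = (\<Prod>i<n. [:- T $$ (i, i), 1:])"
    unfolding char_poly_upper_triangular[OF s(5) ut] diag_mat_def using s(5)
    by (simp add: prod.list_conv_set_nth atLeast0LessThan)
  finally have cp: "char_poly X = (\<Prod>i<n. [:- T $$ (i, i), 1:])" .
  have "mat_poly (char_poly X) T = 0\<^sub>m n n"
  proof (rule eq_mat_mult_vecI)
    fix v :: "complex vec" assume "v \<in> carrier_vec n"
    then show "mat_poly (char_poly X) T *\<^sub>v v = 0\<^sub>m n n *\<^sub>v v"
      unfolding cp using mat_poly_upper_triangular_kills[OF s(5) ut le_refl] by auto
  qed (use s in auto)
  then show ?thesis using mat_poly_similar[OF s(5,6,7,1,2), of "char_poly X"] s by simp
qed

text \<open>Apply the linear factors one after another: the last nonzero vector is killed by the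
  next factor \<open>X - e\<close> and so is an eigenvector. Being a polynomial in \<open>X\<close>
  applied to \<open>v\<close>, it inherits orthogonality to eigenvectors of a Hermitian
  \<open>X\<close> from \<open>v\<close>.\<close>

lemma eigenvector_in_orbit:
  assumes X: "X \<in> carrier_mat n n" and v: "v \<in> carrier_vec n" "v \<noteq> 0\<^sub>v n"
    and "mat_poly (\<Prod>a\<leftarrow>es. [:- a, 1:]) X *\<^sub>v v = 0\<^sub>v n"
  shows "\<exists>p e. mat_poly p X *\<^sub>v v \<noteq> 0\<^sub>v n \<and> X *\<^sub>v (mat_poly p X *\<^sub>v v) = e \<cdot>\<^sub>v (mat_poly p X *\<^sub>v v)"
  using assms(4)
proof (induction es)
  case Nil
  have "1 \<cdot>\<^sub>m 1\<^sub>m n *\<^sub>v v = v" using v by (intro eq_vecI) auto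
  then show ?case using Nil v X by (simp add: one_pCons mat_poly_1)
next
  case (Cons e es)
  interpret sq_mat n .
  let ?p = "\<Prod>a\<leftarrow>es. [:- a, 1:]"
  define w where "w = mat_poly ?p X *\<^sub>v v"
  have w: "w \<in> carrier_vec n" using X v by (simp add: w_def)
  show ?case
  proof (cases "w = 0\<^sub>v n")
    case True
    then have "mat_poly ?p X *\<^sub>v v = 0\<^sub>v n" by (simp add: w_def)
    then show ?thesis by (rule Cons.IH)
  next
    case False
    have "mat_poly [:- e, 1:] X *\<^sub>v w = 0\<^sub>v n"
      using Cons.prems X v by (simp add: mat_poly_mult w_def del: mult_pCons_left)
    then have "(X *\<^sub>v w) $ i = (e \<cdot>\<^sub>v w) $ i" if "i < n" for i
      using X w that by (auto simp: mat_poly_linear sq_distrib dest!: arg_cong[where f = "\<lambda>u. u $ i"])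
    then have "X *\<^sub>v w = e \<cdot>\<^sub>v w" using X w by (intro eq_vecI) auto
    then show ?thesis using False unfolding w_def by (intro exI conjI)
  qed
qed

text \<open>Fewer than \<open>n\<close> linear conditions leave a kernel: padded with zero rows, of
  which row \<open>k\<close> is one, the coefficient matrix has determinant zero.\<close>

lemma exists_orthogonal_vec:
  assumes "k < n" "\<And>i. i < k \<Longrightarrow> u i \<in> carrier_vec n"
  shows "\<exists>v \<in> carrier_vec n. v \<noteq> 0\<^sub>v n \<and> (\<forall>i<k. ip v (u i) = 0)"
proof -
  let ?A = "mat\<^sub>r n n (\<lambda>i. if i = k then 0\<^sub>v n else if i < k then conjugate (u i) else 0\<^sub>v n)"
  have "det ?A = 0" by (rule det_row_0) (use assms in auto)
  then obtain v where v: "v \<in> carrier_vec n" "v \<noteq> 0\<^sub>v n" "?A *\<^sub>v v = 0\<^sub>v n"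
    using det_0_iff_vec_prod_zero_field[of ?A n] by auto
  have "ip v (u i) = 0" if "i < k" for i
  proof -
    have "(?A *\<^sub>v v) $ i = conjugate (u i) \<bullet> v" using assms that by simp
    then show ?thesis using v assms that
      by (metis carrier_vec_conjugate comm_scalar_prod index_zero_vec(1) ip_eq_cscalar_prod less_trans)
  qed
  then show ?thesis using v by blast
qed

lemma hermitian_matD: "hermitian_mat X \<Longrightarrow> X \<in> carrier_mat n m \<Longrightarrow> mat_adjoint X = X"
  by (simp add: hermitian_mat_def)

text \<open>A vector orthogonal to the eigenvectors found so far has an eigenvector in its orbit under polynomials
  in \<open>X\<close>, by Cayley-Hamilton, and the orbit stays orthogonal.\<close>
lemma exists_orthonormal_eigenvectors:
  assumes X: "X \<in> carrier_mat n n" "hermitian_mat X" and "k \<le> n"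
  shows "\<exists>u d. (\<forall>i<k. u i \<in> carrier_vec n \<and> X *\<^sub>v u i = complex_of_real (d i) \<cdot>\<^sub>v u i) \<and>
               (\<forall>i<k. \<forall>j<k. ip (u i) (u j) = (if i = j then 1 else 0))"
  using assms(3)
proof (induction k)
  case 0
  then show ?case by simp
next
  case (Suc k)
  interpret sq_mat n .
  from Suc obtain u d where u: "\<And>i. i < k \<Longrightarrow> u i \<in> carrier_vec n"
      "\<And>i. i < k \<Longrightarrow> X *\<^sub>v u i = complex_of_real (d i) \<cdot>\<^sub>v u i"
      "\<And>i j. i < k \<Longrightarrow> j < k \<Longrightarrow> ip (u i) (u j) = (if i = j then 1 else 0)"
    by (metis Suc_leD)
  obtain v where v: "v \<in> carrier_vec n" "v \<noteq> 0\<^sub>v n" "\<And>i. i < k \<Longrightarrow> ip v (u i) = 0"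
    using exists_orthogonal_vec[of k n u] u Suc.prems by auto
  obtain es where "char_poly X = (\<Prod>a\<leftarrow>es. [:- a, 1:])" using char_poly_factorized[OF X(1)] by blast
  with Cayley_Hamilton[OF X(1)] have "mat_poly (\<Prod>a\<leftarrow>es. [:- a, 1:]) X = 0\<^sub>m n n" by simp
  then have "mat_poly (\<Prod>a\<leftarrow>es. [:- a, 1:]) X *\<^sub>v v = 0\<^sub>v n"
    using v(1) by (auto intro!: eq_vecI)
  from eigenvector_in_orbit[OF X(1) v(1,2) this] obtain p e
    where pe: "mat_poly p X *\<^sub>v v \<noteq> 0\<^sub>v n" "X *\<^sub>v (mat_poly p X *\<^sub>v v) = e \<cdot>\<^sub>v (mat_poly p X *\<^sub>v v)" by blast
  define w where "w = mat_poly p X *\<^sub>v v"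
  have w: "w \<in> carrier_vec n" "w \<noteq> 0\<^sub>v n" "X *\<^sub>v w = e \<cdot>\<^sub>v w" using pe X v by (auto simp: w_def)
  have orth: "ip (mat_poly q X *\<^sub>v v) (u i) = 0" if i: "i < k" for q i
  proof (induction q)
    case 0
    have "0\<^sub>m n n *\<^sub>v v = 0\<^sub>v n" using v by (intro eq_vecI) auto
    then show ?case using X u(1)[OF i] by (simp add: mat_poly_0 ip_def)
  next
    case (pCons a q)
    let ?w = "mat_poly q X *\<^sub>v v"
    have c: "?w \<in> carrier_vec n" using X v by simp
    have "ip (X *\<^sub>v ?w) (u i) = ip ?w (X *\<^sub>v u i)"
      using ip_adjoint[OF X(1) c u(1)[OF i]] hermitian_matD[OF X(2,1)] by simp
    also have "\<dots> = 0" using pCons(2) c u(1)[OF i] by (simp add: u(2)[OF i] ip_sq)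
    finally have "ip (X *\<^sub>v ?w) (u i) = 0" .
    moreover have "mat_poly (pCons a q) X *\<^sub>v v = a \<cdot>\<^sub>v v + X *\<^sub>v ?w"
      using X v by (simp add: mat_poly_pCons sq_distrib)
    ultimately show ?case using X v c u(1)[OF i] v(3)[OF i] by (simp add: ip_sq)
  qed
  have wu: "ip w (u i) = 0" if "i < k" for i unfolding w_def by (rule orth[OF that])
  have "e * ip w w = cnj e * ip w w"
    using ip_adjoint[OF X(1) w(1) w(1)] hermitian_matD[OF X(2,1)] w by (simp add: ip_sq)
  then have "e = cnj e" using ip_self_pos[OF w(1,2)] by auto
  then have e: "e = complex_of_real (Re e)" by (simp add: complex_eq_iff)
  define r where "r = 1 / sqrt (Re (ip w w))"
  define z where "z = complex_of_real r \<cdot>\<^sub>v w"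
  have z: "z \<in> carrier_vec n" using w by (simp add: z_def)
  have ipw: "ip w w = complex_of_real (Re (ip w w))" by (simp add: complex_eq_iff)
  have zz: "ip z z = 1"
  proof -
    have "ip z z = complex_of_real (r * r) * ip w w" using w by (simp add: z_def ip_sq)
    also have "\<dots> = complex_of_real (r * r * Re (ip w w))" by (subst ipw) simp
    also have "r * r * Re (ip w w) = 1"
      using ip_self_pos[OF w(1,2)] by (simp add: r_def)
    finally show ?thesis by simp
  qed
  have zu: "ip z (u i) = 0" "ip (u i) z = 0" if "i < k" for i
    using wu[OF that] w u(1)[OF that] ip_sym[of w "u i"] by (auto simp: z_def ip_sq)
  have Xz: "X *\<^sub>v z = complex_of_real (Re e) \<cdot>\<^sub>v z"
    unfolding z_def using w X by (simp add: e[symmetric] smult_smult_assoc mult.commute)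
  show ?case
  proof (intro exI[of _ "u(k := z)"] exI[of _ "d(k := Re e)"] conjI allI impI)
    fix i assume "i < Suc k"
    then show "(u(k := z)) i \<in> carrier_vec n"
      "X *\<^sub>v (u(k := z)) i = complex_of_real ((d(k := Re e)) i) \<cdot>\<^sub>v (u(k := z)) i"
      using u z Xz by (auto simp: less_Suc_eq)
  next
    fix i j assume "i < Suc k" "j < Suc k"
    then show "ip ((u(k := z)) i) ((u(k := z)) j) = (if i = j then 1 else 0)"
      using u(3) zz zu by (auto simp: less_Suc_eq)
  qed
qed

section \<open>Unitary diagonalization as a calculus of diagonal entries\<close>

definition dg :: "nat \<Rightarrow> (nat \<Rightarrow> complex) \<Rightarrow> complex mat" where
  "dg n d = mat n n (\<lambda>(i, j). if i = j then d i else 0)"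

definition unitary :: "nat \<Rightarrow> complex mat \<Rightarrow> bool" where
  "unitary n U \<longleftrightarrow> U \<in> carrier_mat n n \<and> mat_adjoint U * U = 1\<^sub>m n \<and> U * mat_adjoint U = 1\<^sub>m n"

text \<open>With \<open>U\<close> fixed and \<open>d\<close> variable, every function of one
  Hermitian matrix is an operation on \<open>d\<close>: sums, products, polynomials and adjoints act
  entrywise.\<close>

definition spec :: "nat \<Rightarrow> complex mat \<Rightarrow> (nat \<Rightarrow> complex) \<Rightarrow> complex mat" where
  "spec n U d = U * dg n d * mat_adjoint U"

abbreviation rspec :: "nat \<Rightarrow> complex mat \<Rightarrow> (nat \<Rightarrow> real) \<Rightarrow> complex mat" where
  "rspec n U d \<equiv> spec n U (\<lambda>i. complex_of_real (d i))"

theorem hermitian_spectral: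
  assumes X: "X \<in> carrier_mat n n" "hermitian_mat X"
  obtains U d where "unitary n U" "X = rspec n U d"
proof -
  interpret sq_mat n .
  from exists_orthonormal_eigenvectors[OF X le_refl] obtain u d where
    u: "\<And>i. i < n \<Longrightarrow> u i \<in> carrier_vec n"
      "\<And>i. i < n \<Longrightarrow> X *\<^sub>v u i = complex_of_real (d i) \<cdot>\<^sub>v u i"
      "\<And>i j. i < n \<Longrightarrow> j < n \<Longrightarrow> ip (u i) (u j) = (if i = j then 1 else 0)" by metis
  define U where "U = mat n n (\<lambda>(i, j). u j $ i)"
  have U: "U \<in> carrier_mat n n" by (simp add: U_def)
  have UU: "mat_adjoint U * U = 1\<^sub>m n"
  proof (rule eq_matI)
    fix i j assume "i < dim_row (1\<^sub>m n :: complex mat)" "j < dim_col (1\<^sub>m n :: complex mat)"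
    then have ij: "i < n" "j < n" by auto
    have "(mat_adjoint U * U) $$ (i, j) = (\<Sum>l<n. mat_adjoint U $$ (i, l) * U $$ (l, j))"
      using U ij by (simp add: scalar_prod_def atLeast0LessThan)
    also have "\<dots> = (\<Sum>l<n. u j $ l * cnj (u i $ l))"
      using ij U by (intro sum.cong) (auto simp: U_def)
    also have "\<dots> = ip (u j) (u i)" using u(1)[OF ij(1)] by (simp add: ip_def)
    finally show "(mat_adjoint U * U) $$ (i, j) = 1\<^sub>m n $$ (i, j)" using u(3)[OF ij(2,1)] ij by auto
  qed (use U in auto)
  have UU': "U * mat_adjoint U = 1\<^sub>m n"
    using mat_mult_left_right_inverse[OF _ U UU] U by simp
  have XU: "X * U = U * dg n (\<lambda>i. complex_of_real (d i))"
  proof (rule eq_matI)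
    fix i j assume "i < dim_row (U * dg n (\<lambda>i. complex_of_real (d i)))" "j < dim_col (U * dg n (\<lambda>i. complex_of_real (d i)))"
    then have ij: "i < n" "j < n" using U by (auto simp: dg_def)
    have "(X * U) $$ (i, j) = (X *\<^sub>v u j) $ i"
      using X U ij u(1)[OF ij(2)] by (auto simp: U_def scalar_prod_def intro!: sum.cong)
    also have "\<dots> = complex_of_real (d j) * u j $ i" using u(1,2)[OF ij(2)] ij by simp
    also have "\<dots> = (U * dg n (\<lambda>i. complex_of_real (d i))) $$ (i, j)"
      using ij by (simp add: U_def dg_def scalar_prod_def if_distrib sum.delta cong: if_cong)
    finally show "(X * U) $$ (i, j) = (U * dg n (\<lambda>i. complex_of_real (d i))) $$ (i, j)" .
  qed (use X U in \<open>auto simp: dg_def\<close>)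
  have D: "dg n (\<lambda>i. complex_of_real (d i)) \<in> carrier_mat n n" by (simp add: dg_def)
  have "X = X * (U * mat_adjoint U)" using UU' X by simp
  also have "\<dots> = (X * U) * mat_adjoint U" using X U by simp
  finally have "X = rspec n U d" unfolding XU spec_def .
  then show ?thesis using that U UU UU' by (auto simp: unitary_def)
qed

lemma dg_carrier [simp]: "dg n d \<in> carrier_mat n n"
  by (simp add: dg_def)

lemma dg_mult: "dg n d * dg n e = dg n (\<lambda>i. d i * e i)"
proof (rule eq_matI)
  fix i j assume "i < dim_row (dg n (\<lambda>i. d i * e i))" "j < dim_col (dg n (\<lambda>i. d i * e i))"
  then have ij: "i < n" "j < n" by (auto simp: dg_def)
  have "(dg n d * dg n e) $$ (i, j) = (\<Sum>l<n. (if i = l then d i else 0) * (if l = j then e l else 0))"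
    using ij by (simp add: dg_def scalar_prod_def atLeast0LessThan)
  also have "\<dots> = (\<Sum>l<n. if l = i then (if i = j then d i * e i else 0) else 0)"
    by (intro sum.cong) auto
  finally show "(dg n d * dg n e) $$ (i, j) = dg n (\<lambda>i. d i * e i) $$ (i, j)"
    using ij by (simp add: dg_def)
qed (auto simp: dg_def)

lemma mat_poly_dg: "mat_poly p (dg n d) = dg n (\<lambda>i. poly p (d i))"
proof (induction p)
  case 0
  show ?case by (auto simp: mat_poly_0 dg_def intro!: eq_matI)
next
  case (pCons a p)
  have "mat_poly (pCons a p) (dg n d) = a \<cdot>\<^sub>m 1\<^sub>m n + dg n (\<lambda>i. d i * poly p (d i))"
    by (simp add: mat_poly_pCons[OF dg_carrier] pCons dg_mult)
  then show ?case by (auto simp: dg_def intro!: eq_matI)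
qed

lemma unitaryD:
  assumes "unitary n U"
  shows "U \<in> carrier_mat n n" "mat_adjoint U \<in> carrier_mat n n"
    "mat_adjoint U * U = 1\<^sub>m n" "U * mat_adjoint U = 1\<^sub>m n"
  using assms by (auto simp: unitary_def)

lemma spec_carrier [simp]: "unitary n U \<Longrightarrow> spec n U d \<in> carrier_mat n n"
  unfolding spec_def by (meson dg_carrier mult_carrier_mat unitaryD(1,2))

lemma spec_cong: "(\<And>i. i < n \<Longrightarrow> d i = e i) \<Longrightarrow> spec n U d = spec n U e"
proof -
  assume "\<And>i. i < n \<Longrightarrow> d i = e i"
  then have "dg n d = dg n e" by (auto simp: dg_def)
  then show ?thesis by (simp add: spec_def)
qed

lemma mat_poly_spec:
  assumes "unitary n U"
  shows "mat_poly p (spec n U d) = spec n U (\<lambda>i. poly p (d i))"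
  unfolding spec_def using mat_poly_similar[OF dg_carrier unitaryD(1,2,4,3)[OF assms]] by (simp add: mat_poly_dg)

lemma unitary_cancel:
  assumes "unitary n U" "Z \<in> carrier_mat n n"
  shows "mat_adjoint U * (U * Z) = Z"
proof -
  interpret sq_mat n .
  show ?thesis using unitaryD[OF assms(1)] assms(2) by (metis sq_assoc(1) left_mult_one_mat)
qed

lemma spec_mult:
  assumes "unitary n U"
  shows "spec n U d * spec n U e = spec n U (\<lambda>i. d i * e i)"
proof -
  interpret sq_mat n .
  note u = unitaryD[OF assms]
  have "spec n U d * spec n U e = U * (dg n d * (dg n e * mat_adjoint U))"
    unfolding spec_def using u by (simp add: unitary_cancel[OF assms])
  also have "\<dots> = U * (dg n d * dg n e) * mat_adjoint U" using u by simp
  finally show ?thesis unfolding dg_mult spec_def .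
qed

lemma spec_const:
  assumes "unitary n U"
  shows "spec n U (\<lambda>_. c) = c \<cdot>\<^sub>m 1\<^sub>m n"
proof -
  have "spec n U (\<lambda>_. c) = spec n U (\<lambda>i. poly [:c:] (0 :: complex))" by simp
  also have "\<dots> = mat_poly [:c:] (spec n U (\<lambda>_. 0))" by (rule mat_poly_spec[OF assms, symmetric])
  finally show ?thesis using spec_carrier[OF assms] by (simp add: mat_poly_1)
qed

lemma spec_adjoint:
  assumes "unitary n U"
  shows "mat_adjoint (spec n U d) = spec n U (\<lambda>i. cnj (d i))"
proof -
  interpret sq_mat n .
  have "mat_adjoint (dg n d) = dg n (\<lambda>i. cnj (d i))"
    by (rule eq_matI) (auto simp: dg_def)
  then show ?thesis unfolding spec_def using unitaryD[OF assms] by simp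
qed

lemma ip_spec:
  assumes U: "unitary n U" and x: "x \<in> carrier_vec n" and y: "y \<in> carrier_vec n"
  shows "ip (spec n U d *\<^sub>v x) y
    = (\<Sum>i<n. d i * ((mat_adjoint U *\<^sub>v x) $ i) * cnj ((mat_adjoint U *\<^sub>v y) $ i))"
proof -
  interpret sq_mat n .
  note u = unitaryD[OF U]
  let ?x = "mat_adjoint U *\<^sub>v x" and ?y = "mat_adjoint U *\<^sub>v y"
  have c: "?x \<in> carrier_vec n" "?y \<in> carrier_vec n" using u x y by auto
  have "ip (spec n U d *\<^sub>v x) y = ip (U *\<^sub>v (dg n d *\<^sub>v ?x)) y"
    unfolding spec_def using u x by simp
  also have "\<dots> = ip (dg n d *\<^sub>v ?x) ?y" by (rule ip_adjoint) (use u y c in auto)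
  also have "dg n d *\<^sub>v ?x = vec n (\<lambda>i. d i * ?x $ i)"
  proof (rule eq_vecI)
    fix i assume "i < dim_vec (vec n (\<lambda>i. d i * ?x $ i))"
    then have i: "i < n" by simp
    have "(dg n d *\<^sub>v ?x) $ i = (\<Sum>l<n. (if i = l then d i else 0) * ?x $ l)"
      using i c u by (simp add: dg_def scalar_prod_def atLeast0LessThan)
    also have "\<dots> = (\<Sum>l<n. if l = i then d i * ?x $ i else 0)" by (intro sum.cong) auto
    finally show "(dg n d *\<^sub>v ?x) $ i = vec n (\<lambda>i. d i * ?x $ i) $ i" using i by simp
  qed (simp add: dg_def)
  finally have eq: "ip (spec n U d *\<^sub>v x) y = ip (vec n (\<lambda>i. d i * ?x $ i)) ?y" .
  show ?thesis unfolding eq unfolding ip_def carrier_vecD[OF c(2)]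
    by (intro sum.cong) (simp_all del: index_mult_mat_vec)
qed

lemma ip_unitary:
  assumes U: "unitary n U" and x: "x \<in> carrier_vec n" and y: "y \<in> carrier_vec n"
  shows "ip x y = (\<Sum>i<n. ((mat_adjoint U *\<^sub>v x) $ i) * cnj ((mat_adjoint U *\<^sub>v y) $ i))"
proof -
  have "spec n U (\<lambda>_. 1) *\<^sub>v x = x" using x by (simp add: spec_const[OF U]) (auto intro!: eq_vecI)
  then show ?thesis using ip_spec[OF assms, of "\<lambda>_. 1"] by simp
qed

lemma qform_spec:
  assumes U: "unitary n U" and x: "x \<in> carrier_vec n"
  shows "rform (rspec n U d) x
    = (\<Sum>i<n. d i * (cmod ((mat_adjoint U *\<^sub>v x) $ i))\<^sup>2)"
proof -
  have "Re (complex_of_real a * z * cnj z) = a * (cmod z)\<^sup>2" for a z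
    by (simp only: mult.assoc complex_norm_square[symmetric] of_real_mult[symmetric] Re_complex_of_real)
  then show ?thesis unfolding ip_spec[OF U x x] Re_sum by simp
qed

lemma char_poly_spec:
  assumes U: "unitary n U"
  shows "char_poly (spec n U d) = (\<Prod>i<n. [:- d i, 1:])"
proof -
  note u = unitaryD[OF U]
  have "similar_mat (spec n U d) (dg n d)"
    unfolding similar_mat_def similar_mat_wit_def Let_def
    by (rule exI[of _ U], rule exI[of _ "mat_adjoint U"]) (use u spec_carrier[OF U, of d] in \<open>auto simp: spec_def dg_def\<close>)
  then have "char_poly (spec n U d) = char_poly (dg n d)" by (rule char_poly_similar)
  also have "\<dots> = (\<Prod>a\<leftarrow>diag_mat (dg n d). [:- a, 1:])"
    by (rule char_poly_upper_triangular[of _ n]) (auto simp: dg_def)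
  also have "\<dots> = (\<Prod>i<n. [:- d i, 1:])"
    by (simp add: diag_mat_def dg_def prod.list_conv_set_nth atLeast0LessThan)
  finally show ?thesis .
qed

lemma hermitian_mat_iff: "X \<in> carrier_mat n n \<Longrightarrow> hermitian_mat X \<longleftrightarrow> mat_adjoint X = X"
  by (auto simp: hermitian_mat_def)

lemma hermitian_spec:
  "unitary n U \<Longrightarrow> hermitian_mat (rspec n U d)"
  by (simp add: hermitian_mat_iff[OF spec_carrier] spec_adjoint)

section \<open>Hermite interpolation and the functional calculi\<close>

text \<open>In characteristic zero each derivative lowers the order of a root by exactly
  one.\<close>

lemma poly_higher_pderiv_order:
  fixes p :: "complex poly"
  assumes "p \<noteq> 0"
  shows "j < Polynomial.order z p \<Longrightarrow> poly ((pderiv ^^ j) p) z = 0"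
    and "poly ((pderiv ^^ Polynomial.order z p) p) z \<noteq> 0"
proof -
  have "(\<forall>j<k. poly ((pderiv ^^ j) p) z = 0) \<and> poly ((pderiv ^^ k) p) z \<noteq> 0" if "Polynomial.order z p = k" for k
    using that assms
  proof (induction k arbitrary: p)
    case 0
    then show ?case by (simp add: order_root)
  next
    case (Suc k)
    have root: "poly p z = 0" using Suc.prems by (metis order_root nat.distinct(1))
    have d0: "pderiv p \<noteq> 0"
    proof
      assume "pderiv p = 0"
      then obtain c where "p = [:c:]" by (metis pderiv_iszero)
      with root Suc.prems show False by simp
    qed
    then have "Polynomial.order z (pderiv p) = k" using order_pderiv[of p z] root Suc.prems by simp
    from Suc.IH[OF this d0] have IH: "\<And>j. j < k \<Longrightarrow> poly ((pderiv ^^ Suc j) p) z = 0" "poly ((pderiv ^^ Suc k) p) z \<noteq> 0"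
      by (simp_all add: funpow_Suc_right del: funpow.simps(2))
    have "poly ((pderiv ^^ j) p) z = 0" if "j < Suc k" for j
      using that root IH(1) by (cases j) (simp_all del: funpow.simps(2))
    with IH(2) show ?case by blast
  qed
  then show "j < Polynomial.order z p \<Longrightarrow> poly ((pderiv ^^ j) p) z = 0"
    and "poly ((pderiv ^^ Polynomial.order z p) p) z \<noteq> 0" by auto
qed

text \<open>Induction on the total number of conditions. After dropping the highest condition at one
  node \<open>w\<close>, the others are solved by \<open>p\<close>. The correction \<open>W\<close>
  vanishes at each node to exactly the order already fixed, so it disturbs none of these conditions,
  and its first nonzero derivative at \<open>w\<close> can be scaled to fit.\<close>

lemma hermite_interpolation:
  fixes a :: "complex \<Rightarrow> nat \<Rightarrow> complex"
  assumes Z: "finite Z"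
  shows "\<exists>p. \<forall>z\<in>Z. \<forall>j<k z. poly ((pderiv ^^ j) p) z = a z j"
proof (induction "\<Sum>z\<in>Z. k z" arbitrary: k)
  case 0
  then have "\<forall>z\<in>Z. k z = 0" using Z by simp
  then show ?case by auto
next
  case (Suc s)
  then obtain w where w: "w \<in> Z" "k w > 0"
    by (metis gr0I nat.distinct(1) sum.neutral)
  define k' where "k' = k(w := k w - 1)"
  have "sum k Z = Suc (sum k' Z)"
    using Z w by (simp add: k'_def sum.remove[of Z w])
  then have "s = sum k' Z" using Suc.hyps(2) by simp
  from Suc.hyps(1)[OF this] obtain p where p: "\<forall>z\<in>Z. \<forall>j<k' z. poly ((pderiv ^^ j) p) z = a z j" by blast
  define W where "W = (\<Prod>z\<in>Z. [:- z, 1:] ^ k' z)"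
  have W0: "W \<noteq> 0" using Z by (simp add: W_def)
  have ordW: "Polynomial.order z W = k' z" if "z \<in> Z" for z
  proof -
    have "W = [:- z, 1:] ^ k' z * (\<Prod>y\<in>Z - {z}. [:- y, 1:] ^ k' y)"
      unfolding W_def using Z that by (simp add: prod.remove)
    moreover have "Polynomial.order z (\<Prod>y\<in>Z - {z}. [:- y, 1:] ^ k' y) = 0"
      using Z by (intro order_0I) (auto simp: poly_prod)
    ultimately show ?thesis using W0 by (simp add: order_mult order_power_n_n)
  qed
  define c where "c = (a w (k' w) - poly ((pderiv ^^ k' w) p) w) / poly ((pderiv ^^ k' w) W) w"
  show ?case
  proof (intro exI[of _ "p + Polynomial.smult c W"] ballI allI impI)
    fix z j assume z: "z \<in> Z" and j: "j < k z"
    have "poly ((pderiv ^^ j) (p + Polynomial.smult c W)) z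
      = poly ((pderiv ^^ j) p) z + c * poly ((pderiv ^^ j) W) z"
      by (simp add: higher_pderiv_add higher_pderiv_smult)
    also have "\<dots> = a z j"
    proof (cases "j < k' z")
      case True
      then show ?thesis using p z poly_higher_pderiv_order(1)[OF W0, of j z] ordW[OF z] by simp
    next
      case False
      then have zw: "z = w" and jk: "j = k' w" using j by (auto simp: k'_def split: if_splits)
      have "poly ((pderiv ^^ k' w) W) w \<noteq> 0"
        using poly_higher_pderiv_order(2)[OF W0, of w] ordW[OF w(1)] by simp
      then show ?thesis unfolding zw jk c_def by simp
    qed
    finally show "poly ((pderiv ^^ j) (p + Polynomial.smult c W)) z = a z j" .
  qed
qed

lemma prod_linear_dvd:
  fixes r :: "complex poly"
  assumes "r \<noteq> 0" "\<And>z. Polynomial.order z (\<Prod>a\<leftarrow>es. [:- a, 1:]) \<le> Polynomial.order z r"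
  shows "(\<Prod>a\<leftarrow>es. [:- a, 1:]) dvd r"
  using assms
proof (induction es arbitrary: r)
  case Nil
  then show ?case by simp
next
  case (Cons e es)
  let ?q = "\<Prod>a\<leftarrow>es. [:- a, 1:]"
  have q0: "?q \<noteq> 0" by (simp add: prod_list_zero_iff image_iff)
  have ordq: "Polynomial.order z ([:- e, 1:] * ?q) = Polynomial.order z [:- e, 1:] + Polynomial.order z ?q" for z
    using q0 by (subst order_mult) (auto simp del: mult_pCons_left)
  have "Polynomial.order e [:- e, 1:] = 1" using order_power_n_n[of e 1] by simp
  then have "Polynomial.order e r \<noteq> 0" using Cons.prems(2)[of e] ordq[of e] by simp
  then have "poly r e = 0" by (simp add: order_root)
  then obtain s where s: "r = [:- e, 1:] * s" using poly_eq_0_iff_dvd dvd_def by metis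
  have s0: "s \<noteq> 0" using s Cons.prems(1) by auto
  have "Polynomial.order z ?q \<le> Polynomial.order z s" for z
  proof -
    have "Polynomial.order z r = Polynomial.order z [:- e, 1:] + Polynomial.order z s" unfolding s using s0 by (subst order_mult) (auto simp del: mult_pCons_left)
    with Cons.prems(2)[of z] ordq[of z] show ?thesis by simp
  qed
  from Cons.IH[OF s0 this] have "?q dvd s" .
  then have "[:- e, 1:] * ?q dvd [:- e, 1:] * s" by (rule mult_dvd_mono[OF dvd_refl])
  then show ?case by (simp add: s)
qed

abbreviation amult :: "complex mat \<Rightarrow> complex \<Rightarrow> nat" where
  "amult X z \<equiv> Polynomial.order z (char_poly X)"

text \<open>The condition under the choice in \<open>holo_calc\<close>. It is empty off the
  spectrum, where \<open>amult X z = 0\<close>.\<close>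

definition interpolates :: "(complex \<Rightarrow> complex) \<Rightarrow> complex mat \<Rightarrow> complex poly \<Rightarrow> bool" where
  "interpolates F X p \<longleftrightarrow>
    (\<forall>z. \<forall>j<amult X z. (deriv ^^ j) F z = poly ((pderiv ^^ j) p) z)"

lemma char_poly_nonzero: "X \<in> carrier_mat n n \<Longrightarrow> char_poly (X :: complex mat) \<noteq> 0"
  by (metis coeff_0 degree_monic_char_poly zero_neq_one)

lemma interpolates_jets_ex:
  fixes X :: "complex mat"
  assumes X: "X \<in> carrier_mat n n"
  shows "\<exists>p. \<forall>z. \<forall>j<amult X z. a z j = poly ((pderiv ^^ j) p) z"
proof -
  have "finite {z. poly (char_poly X) z = 0}"
    using poly_roots_finite[OF char_poly_nonzero[OF X]] .
  from hermite_interpolation[OF this, of "\<lambda>z. amult X z" a] obtain p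
    where p: "\<forall>z\<in>{z. poly (char_poly X) z = 0}. \<forall>j<amult X z. poly ((pderiv ^^ j) p) z = a z j" by blast
  have "a z j = poly ((pderiv ^^ j) p) z" if "j < amult X z" for z j
  proof -
    have "poly (char_poly X) z = 0" using that by (metis order_root not_less_zero gr0I)
    with p that show ?thesis by simp
  qed
  then show ?thesis by blast
qed

lemma interpolates_ex: "X \<in> carrier_mat n n \<Longrightarrow> \<exists>p. interpolates F X p"
  unfolding interpolates_def by (rule interpolates_jets_ex)

text \<open>Two interpolants differ by a multiple of the characteristic polynomial, which
  Cayley-Hamilton annihilates. This makes the choice in \<open>holo_calc\<close> well
  defined.\<close>

lemma interpolates_unique:
  assumes X: "X \<in> carrier_mat n n" and "interpolates F X p" "interpolates F X q"
  shows "mat_poly p X = mat_poly q X"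
proof (cases "p = q")
  case False
  define r where "r = p - q"
  have r0: "r \<noteq> 0" using False by (simp add: r_def)
  have pr: "p = q + r" by (simp add: r_def)
  obtain es where es: "char_poly X = (\<Prod>a\<leftarrow>es. [:- a, 1:])" using char_poly_factorized[OF X] by blast
  have "amult X z \<le> Polynomial.order z r" for z
  proof (rule ccontr)
    assume "\<not> amult X z \<le> Polynomial.order z r"
    then have "poly ((pderiv ^^ Polynomial.order z r) p) z = poly ((pderiv ^^ Polynomial.order z r) q) z"
      using assms(2,3) unfolding interpolates_def by (metis not_le)
    then have "poly ((pderiv ^^ Polynomial.order z r) r) z = 0" by (simp add: pr higher_pderiv_add)
    with poly_higher_pderiv_order(2)[OF r0] show False by blast
  qed
  then have "char_poly X dvd r" using prod_linear_dvd[OF r0] unfolding es by blast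
  then obtain s where "r = char_poly X * s" by (auto simp: dvd_def)
  then have "mat_poly r X = 0\<^sub>m n n"
    using X by (simp add: mat_poly_mult Cayley_Hamilton left_mult_zero_mat[of _ n n])
  then show ?thesis unfolding pr using X by (simp add: mat_poly_add)
qed simp

lemma holo_calc_eq:
  assumes X: "X \<in> carrier_mat n n" and p: "interpolates F X p"
  shows "holo_calc F X = mat_poly p X"
proof -
  have "\<exists>q. holo_calc F X = mat_poly q X \<and> interpolates F X q"
    unfolding holo_calc_def interpolates_def by (rule someI_ex) (use p in \<open>auto simp: interpolates_def\<close>)
  then show ?thesis using interpolates_unique[OF X] p by metis
qed

text \<open>Values without derivatives suffice, since a polynomial of a diagonalizable matrix
  depends only on its values at the eigenvalues.\<close>

lemma herm_calc_spec:
  assumes U: "unitary n U"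
  shows "herm_calc f (rspec n U d) = spec n U (\<lambda>i. complex_of_real (f (d i)))"
proof -
  let ?X = "rspec n U d"
  have cp: "poly (char_poly ?X) z = 0 \<longleftrightarrow> (\<exists>i<n. z = complex_of_real (d i))" for z
    by (auto simp: char_poly_spec[OF U] poly_prod)
  have "\<exists>Y p. Y = mat_poly p ?X \<and> (\<forall>z. poly (char_poly ?X) z = 0 \<longrightarrow> poly p z = complex_of_real (f (Re z)))"
  proof -
    from hermite_interpolation[of "{z. \<exists>i<n. z = complex_of_real (d i)}" "\<lambda>_. 1" "\<lambda>z _. complex_of_real (f (Re z))"]
    obtain p where "\<forall>z. (\<exists>i<n. z = complex_of_real (d i)) \<longrightarrow> poly p z = complex_of_real (f (Re z))" by auto
    then show ?thesis unfolding cp by blast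
  qed
  from someI_ex[OF this] obtain p where p: "herm_calc f ?X = mat_poly p ?X"
    "\<forall>z. poly (char_poly ?X) z = 0 \<longrightarrow> poly p z = complex_of_real (f (Re z))"
    unfolding herm_calc_def by blast
  show ?thesis unfolding p(1) mat_poly_spec[OF U] by (rule spec_cong) (use p(2) cp in auto)
qed

lemma higher_deriv_poly: "(deriv ^^ j) (poly p) = poly ((pderiv ^^ j) (p :: complex poly))"
proof (induction j)
  case (Suc j)
  have "deriv (poly q) = poly (pderiv q)" for q :: "complex poly"
    by (rule ext) (rule DERIV_imp_deriv[OF poly_DERIV])
  then show ?case by (simp add: Suc)
qed simp

lemma interpolates_poly: "interpolates (poly p) X p"
  unfolding interpolates_def higher_deriv_poly by simp

lemma holo_calc_poly: "X \<in> carrier_mat n n \<Longrightarrow> holo_calc (poly p) X = mat_poly p X"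
  by (rule holo_calc_eq[OF _ interpolates_poly])

lemma holo_calc_carrier [simp]: "X \<in> carrier_mat n n \<Longrightarrow> holo_calc F X \<in> carrier_mat n n"
  using interpolates_ex[of X n F] holo_calc_eq by (metis mat_poly_carrier)

lemma order_char_poly_pos:
  "X \<in> carrier_mat n n \<Longrightarrow> j < amult X z \<Longrightarrow> eigenvalue (X :: complex mat) z"
  using eigenvalue_root_char_poly[of X n z] order_root by (metis gr_implies_not0)

text \<open>The Leibniz rule expresses the derivatives of the product by those of the factors, for
  \<open>F\<close>, \<open>G\<close> in the same way as for their interpolants \<open>p\<close>,
  \<open>q\<close>; hence \<open>p * q\<close> interpolates the product.\<close>

lemma holo_calc_mult:
  assumes X: "X \<in> carrier_mat n n" and S: "open S" "\<And>z. eigenvalue X z \<Longrightarrow> z \<in> S"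
    and F: "F holomorphic_on S" "G holomorphic_on S"
  shows "holo_calc (\<lambda>z. F z * G z) X = holo_calc F X * holo_calc G X"
proof -
  obtain p q where p: "interpolates F X p" "interpolates G X q" using interpolates_ex[OF X] by blast
  have "interpolates (\<lambda>z. F z * G z) X (p * q)"
    unfolding interpolates_def
  proof (intro allI impI)
    fix z j assume j: "j < amult X z"
    then have z: "z \<in> S" using S(2) order_char_poly_pos[OF X] by blast
    have "(deriv ^^ j) (\<lambda>w. F w * G w) z
      = (\<Sum>i = 0..j. of_nat (j choose i) * (deriv ^^ i) F z * (deriv ^^ (j - i)) G z)"
      by (rule higher_deriv_mult[OF F S(1) z])
    also have "\<dots> = (\<Sum>i = 0..j. of_nat (j choose i) * (deriv ^^ i) (poly p) z * (deriv ^^ (j - i)) (poly q) z)"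
      using p j by (intro sum.cong) (auto simp: interpolates_def higher_deriv_poly)
    also have "\<dots> = (deriv ^^ j) (\<lambda>w. poly p w * poly q w) z"
      by (rule higher_deriv_mult[symmetric, where S = UNIV]) (auto intro!: holomorphic_intros)
    also have "(\<lambda>w. poly p w * poly q w) = poly (p * q)" by auto
    finally show "(deriv ^^ j) (\<lambda>w. F w * G w) z = poly ((pderiv ^^ j) (p * q)) z" unfolding higher_deriv_poly .
  qed
  then show ?thesis using p by (simp add: holo_calc_eq[OF X] mat_poly_mult[OF X])
qed

lemma holo_calc_cong:
  assumes X: "X \<in> carrier_mat n n" and S: "open S" "\<And>z. eigenvalue X z \<Longrightarrow> z \<in> S"
    and F: "F holomorphic_on S" "\<And>z. z \<in> S \<Longrightarrow> F z = G z"
  shows "holo_calc F X = holo_calc G X"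
proof -
  have G: "G holomorphic_on S" using F holomorphic_transform by blast
  obtain p where p: "interpolates F X p" using interpolates_ex[OF X] by blast
  then have "interpolates G X p"
    unfolding interpolates_def
    using higher_deriv_transform_within_open[OF F(1) G S(1) _ F(2)] S(2) order_char_poly_pos[OF X]
    by metis
  with p show ?thesis by (simp add: holo_calc_eq[OF X])
qed

lemma poly_higher_pderiv_sum:
  "poly ((pderiv ^^ j) (\<Sum>i\<in>I. h i)) z = (\<Sum>i\<in>I. poly ((pderiv ^^ j) (h i)) (z :: complex))"
  by (induction I rule: infinite_finite_induct) (auto simp: higher_pderiv_add)

text \<open>\<open>Z\<close> and \<open>\<kappa>\<close> are chosen before \<open>F\<close>, so the
  form is one fixed linear functional of the derivatives of \<open>F\<close> at the eigenvalues.
  Linearity in \<open>F\<close> and convergence along sequences of functions are both read off from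
  it.\<close>

lemma holo_calc_form_expansion:
  assumes X: "X \<in> carrier_mat n n" "S \<in> carrier_mat n n" and y: "y \<in> carrier_vec n"
  shows "\<exists>Z \<kappa>. finite Z \<and> (\<forall>z\<in>Z. eigenvalue X z) \<and> (\<forall>F. ip ((S * holo_calc F X * S) *\<^sub>v y) y =
    (\<Sum>z\<in>Z. \<Sum>j<amult X z. (deriv ^^ j) F z * \<kappa> z j))"
proof -
  interpret sq_mat n .
  define \<phi> where "\<phi> p = ip ((S * mat_poly p X * S) *\<^sub>v y) y" for p
  have add: "\<phi> (p + q) = \<phi> p + \<phi> q" for p q
    using X y by (simp add: \<phi>_def mat_poly_add sq_distrib ip_sq)
  have smult: "\<phi> (Polynomial.smult c p) = c * \<phi> p" for c p
    using X y by (simp add: \<phi>_def mat_poly_smult ip_sq)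
  have \<phi>0: "\<phi> 0 = 0" using smult[of 0 0] by simp
  have sum': "\<phi> (\<Sum>i<m. h i) = (\<Sum>i<m. \<phi> (h i))" for m :: nat and h
    by (induction m) (auto simp: \<phi>0 add)
  define Z where "Z = {z. eigenvalue X z}"
  have Zroots: "Z = {z. poly (char_poly X) z = 0}"
    unfolding Z_def using eigenvalue_root_char_poly[OF X(1)] by auto
  have Z: "finite Z" unfolding Zroots using poly_roots_finite[OF char_poly_nonzero[OF X(1)]] .
  \<comment> \<open>Dual Hermite basis: \<open>e w i\<close> has \<open>i\<close>-th derivative one
    at \<open>w\<close> and all other prescribed derivatives zero. The coefficients
    \<open>\<kappa>\<close> are the values of \<open>\<phi>\<close> on this basis.\<close>
  have "\<exists>e. \<forall>z. \<forall>j<amult X z. (if z = w \<and> j = i then 1 else 0) = poly ((pderiv ^^ j) e) z" for w i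
    by (rule interpolates_jets_ex[OF X(1)])
  then obtain e where e: "\<And>w i z j. j < amult X z \<Longrightarrow>
      poly ((pderiv ^^ j) (e w i)) z = (if z = w \<and> j = i then 1 else 0)"
    by metis
  have "ip ((S * holo_calc F X * S) *\<^sub>v y) y
    = (\<Sum>z\<in>Z. \<Sum>j<amult X z. (deriv ^^ j) F z * \<phi> (e z j))" for F
  proof -
    define p where "p = (\<Sum>w\<in>Z. \<Sum>i<amult X w. Polynomial.smult ((deriv ^^ i) F w) (e w i))"
    have "interpolates F X p"
      unfolding interpolates_def
    proof (intro allI impI)
      fix z j assume j: "j < amult X z"
      then have z: "z \<in> Z" using order_char_poly_pos[OF X(1)] by (auto simp: Z_def)
      have "poly ((pderiv ^^ j) p) z = (\<Sum>w\<in>Z. \<Sum>i<amult X w. (deriv ^^ i) F w * (if z = w \<and> j = i then 1 else 0))"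
        unfolding p_def using Z j
        by (simp add: poly_higher_pderiv_sum higher_pderiv_smult e)
      also have "\<dots> = (\<Sum>w\<in>Z. if w = z then (deriv ^^ j) F z else 0)"
      proof (intro sum.cong refl)
        fix w assume "w \<in> Z"
        have "(\<Sum>i<amult X w. (deriv ^^ i) F w * (if z = w \<and> j = i then 1 else 0))
          = (\<Sum>i<amult X w. if i = j then (if w = z then (deriv ^^ j) F z else 0) else 0)"
          by (intro sum.cong) auto
        then show "(\<Sum>i<amult X w. (deriv ^^ i) F w * (if z = w \<and> j = i then 1 else 0)) = (if w = z then (deriv ^^ j) F z else 0)"
          using j by auto
      qed
      also have "\<dots> = (deriv ^^ j) F z" using Z z by simp
      finally show "(deriv ^^ j) F z = poly ((pderiv ^^ j) p) z" ..
    qed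
    then have "ip ((S * holo_calc F X * S) *\<^sub>v y) y = \<phi> p" by (simp add: holo_calc_eq[OF X(1)] \<phi>_def)
    also have "\<dots> = (\<Sum>z\<in>Z. \<Sum>j<amult X z. (deriv ^^ j) F z * \<phi> (e z j))"
    proof -
      have "\<phi> (\<Sum>w\<in>A. h w) = (\<Sum>w\<in>A. \<phi> (h w))" if "finite A" for A :: "complex set" and h
        using that by (induction A) (auto simp: \<phi>0 add)
      then show ?thesis unfolding p_def using Z by (simp add: sum' smult)
    qed
    finally show ?thesis .
  qed
  then show ?thesis using Z unfolding Z_def by (intro exI[of _ Z] exI[of _ "\<lambda>z j. \<phi> (e z j)"]) (auto simp: Z_def)
qed

section \<open>Loewner's theorem on finitely many nodes\<close>

text \<open>The derivative at \<open>t m\<close> of the monic polynomial with the nodes as roots;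
  its reciprocals are the weights of a divided difference.\<close>

definition node_diff :: "(nat \<Rightarrow> real) \<Rightarrow> nat \<Rightarrow> nat \<Rightarrow> real" where
  "node_diff t N m = (\<Prod>j\<in>{..<N} - {m}. t m - t j)"

lemma node_diff_nonzero: "inj_on t {..<N} \<Longrightarrow> m < N \<Longrightarrow> node_diff t N m \<noteq> 0"
  by (auto simp: node_diff_def inj_on_def)

lemma lagrange_representation:
  assumes inj: "inj_on b {..<n}" and g: "degree g < n"
  shows "g = (\<Sum>j<n. Polynomial.smult (poly g (b j) / node_diff b n j) (\<Prod>k\<in>{..<n} - {j}. [:- b k, 1:]))"
    (is "g = ?L")
proof (rule poly_eqI_degree)
  show "degree g < card (b ` {..<n})" using inj g by (simp add: card_image)
  have "degree ?L \<le> n - 1"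
  proof (rule degree_sum_le)
    fix j assume "j \<in> {..<n}"
    then have "degree (\<Prod>k\<in>{..<n} - {j}. [:- b k, 1:]) = n - 1"
      by (subst degree_prod_eq_sum_degree) auto
    then show "degree (Polynomial.smult (poly g (b j) / node_diff b n j) (\<Prod>k\<in>{..<n} - {j}. [:- b k, 1:])) \<le> n - 1"
      using degree_smult_le by metis
  qed simp
  then show "degree ?L < card (b ` {..<n})" using inj g by (simp add: card_image)
next
  fix x assume "x \<in> b ` {..<n}"
  then obtain i where i: "i < n" "x = b i" by auto
  have "poly ?L x = (\<Sum>j<n. poly g (b j) / node_diff b n j * (\<Prod>k\<in>{..<n} - {j}. b i - b k))"
    unfolding i by (simp add: poly_sum poly_prod)
  also have "\<dots> = (\<Sum>j<n. if j = i then poly g (b i) else 0)"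
  proof (intro sum.cong refl)
    fix j assume "j \<in> {..<n}"
    show "poly g (b j) / node_diff b n j * (\<Prod>k\<in>{..<n} - {j}. b i - b k) = (if j = i then poly g (b i) else 0)"
    proof (cases "j = i")
      case True then show ?thesis using node_diff_nonzero[OF inj i(1)] by (simp add: node_diff_def)
    next
      case False
      then have "(\<Prod>k\<in>{..<n} - {j}. b i - b k) = 0" using i by (intro prod_zero) auto
      then show ?thesis using False by simp
    qed
  qed
  also have "\<dots> = poly g x" using i by simp
  finally show "poly g x = poly ?L x" ..
qed

text \<open>Compare coefficients of degree \<open>n - 1\<close> in Lagrange's formula, where each
  summand is a multiple of a monic polynomial of that degree.\<close>

lemma lagrange_lead_coeff:
  assumes inj: "inj_on b {..<n}" and g: "degree g < n"
  shows "(\<Sum>j<n. poly g (b j) / node_diff b n j) = coeff g (n - 1)"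
proof -
  have "coeff (\<Prod>k\<in>{..<n} - {j}. [:- b k, 1:]) (n - 1) = 1" if "j < n" for j
  proof -
    have "degree (\<Prod>k\<in>{..<n} - {j}. [:- b k, 1:]) = n - 1"
      using that by (subst degree_prod_eq_sum_degree) auto
    moreover have "lead_coeff (\<Prod>k\<in>{..<n} - {j}. [:- b k, 1:]) = 1" by (simp add: lead_coeff_prod)
    ultimately show ?thesis by simp
  qed
  then show ?thesis by (subst lagrange_representation[OF assms]) (simp add: coeff_sum)
qed

lemma lagrange_partial_fraction:
  assumes inj: "inj_on b {..<n}" and g: "degree g < n" and z: "z \<notin> b ` {..<n}"
  shows "(\<Sum>j<n. poly g (b j) / (node_diff b n j * (z - b j))) = poly g z / (\<Prod>k<n. z - b k)"
proof -
  have nz: "(\<Prod>k<n. z - b k) \<noteq> 0" using z by auto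
  have "poly g z = (\<Sum>j<n. poly g (b j) / node_diff b n j * (\<Prod>k\<in>{..<n} - {j}. z - b k))"
    by (subst lagrange_representation[OF inj g]) (simp add: poly_sum poly_prod)
  also have "\<dots> = (\<Sum>j<n. poly g (b j) / (node_diff b n j * (z - b j)) * (\<Prod>k<n. z - b k))"
  proof (intro sum.cong refl)
    fix j assume j: "j \<in> {..<n}"
    then have eq: "(\<Prod>k<n. z - b k) = (z - b j) * (\<Prod>k\<in>{..<n} - {j}. z - b k)" by (intro prod.remove) auto
    have "z - b j \<noteq> 0" using z j by auto
    then show "poly g (b j) / node_diff b n j * (\<Prod>k\<in>{..<n} - {j}. z - b k)
      = poly g (b j) / (node_diff b n j * (z - b j)) * (\<Prod>k<n. z - b k)" unfolding eq by simp
  qed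
  finally show ?thesis unfolding nonzero_eq_divide_eq[OF nz] sum_distrib_right ..
qed

lemma divide_mult_split:
  fixes u w c :: real
  assumes "u \<noteq> 0" "w \<noteq> 0" "w - u \<noteq> 0"
  shows "c / (u * w) = (c / u - c / w) / (w - u)"
proof -
  have "c / u - c / w = c * (w - u) / (u * w)"
    using assms by (simp add: diff_frac_eq right_diff_distrib)
  then show ?thesis using assms(3) by simp
qed

section \<open>The Loewner order through quadratic forms\<close>

lemma psd_mat_iff:
  "X \<in> carrier_mat n n \<Longrightarrow> psd_mat X \<longleftrightarrow> hermitian_mat X \<and> (\<forall>x\<in>carrier_vec n. 0 \<le> rform X x)"
  by (auto simp: psd_mat_def qform_eq_ip)

lemma hermitian_minus:
  assumes "X \<in> carrier_mat n n" "Y \<in> carrier_mat n n" "hermitian_mat X" "hermitian_mat Y"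
  shows "hermitian_mat (Y - X)"
proof -
  have "mat_adjoint (Y - X) = mat_adjoint Y - mat_adjoint X" using assms by (intro eq_matI) auto
  then show ?thesis using assms by (auto simp: hermitian_mat_def)
qed

lemma loewner_le_iff:
  assumes "X \<in> carrier_mat n n" "Y \<in> carrier_mat n n"
  shows "loewner_le X Y \<longleftrightarrow> hermitian_mat X \<and> hermitian_mat Y \<and>
    (\<forall>x\<in>carrier_vec n. rform X x \<le> rform Y x)"
proof -
  interpret sq_mat n .
  have "rform (Y - X) x = rform Y x - rform X x" if "x \<in> carrier_vec n" for x
    using assms that by (simp add: sq_distrib ip_sq)
  then show ?thesis using assms hermitian_minus[OF assms]
    by (auto simp: loewner_le_def psd_mat_iff[of _ n] sq_mat.sq_carrier)
qed

lemma unitary_one: "unitary n (1\<^sub>m n)"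
  by (simp add: unitary_def)

lemma spec_one: "spec n (1\<^sub>m n) d = dg n d"
  by (simp add: spec_def dg_def)

lemma norm_unitary:
  assumes U: "unitary n U" and x: "x \<in> carrier_vec n"
  shows "Re (ip x x) = (\<Sum>i<n. (cmod ((mat_adjoint U *\<^sub>v x) $ i))\<^sup>2)"
  unfolding ip_unitary[OF U x x]
  by (simp only: complex_norm_square[symmetric] of_real_sum[symmetric] Re_complex_of_real)

lemma pd_mat_spec:
  assumes U: "unitary n U" and d: "\<And>i. i < n \<Longrightarrow> 0 < d i"
  shows "pd_mat (rspec n U d)"
proof -
  let ?X = "rspec n U d"
  have X: "?X \<in> carrier_mat n n" using U by simp
  have "0 < rform ?X x" if x: "x \<in> carrier_vec n" "x \<noteq> 0\<^sub>v n" for x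
  proof -
    let ?c = "\<lambda>i. (cmod ((mat_adjoint U *\<^sub>v x) $ i))\<^sup>2"
    have "(\<Sum>i<n. ?c i) > 0"
      using ip_self_pos[OF x] norm_unitary[OF U x(1)] by simp
    then obtain i where i: "i < n" "?c i > 0"
      by (metis (no_types, lifting) lessThan_iff not_less sum_nonpos)
    have "0 < (\<Sum>i<n. d i * ?c i)"
      by (rule sum_pos2[of _ i]) (use i d in \<open>auto simp: less_imp_le\<close>)
    then show ?thesis unfolding qform_spec[OF U x(1)] .
  qed
  then show ?thesis using X hermitian_spec[OF U, of d] by (auto simp: pd_mat_def qform_eq_ip)
qed

text \<open>The order \<open>a 0 < b 0 < a 1 < b 1 < ...\<close> is that of eigenvalues before and
  after a positive rank-one perturbation. It makes the weights \<open>V\<close> and \<open>W\<close>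
  positive, so that their square roots yield a real orthogonal matrix.\<close>

locale interlacing =
  fixes n :: nat and a b :: "nat \<Rightarrow> real"
  assumes ab: "i < n \<Longrightarrow> a i < b i" and ba: "i < j \<Longrightarrow> j < n \<Longrightarrow> b i < a j"
begin

lemma a_less: "i < j \<Longrightarrow> j < n \<Longrightarrow> a i < a j"
  using ab[of i] ba[of i j] by linarith
lemma b_less: "i < j \<Longrightarrow> j < n \<Longrightarrow> b i < b j"
  using ab[of j] ba[of i j] by linarith
lemma inj_a: "inj_on a {..<n}"
  by (rule inj_onI) (metis a_less lessThan_iff linorder_neqE_nat order_less_irrefl)
lemma inj_b: "inj_on b {..<n}"
  by (rule inj_onI) (metis b_less lessThan_iff linorder_neqE_nat order_less_irrefl)
lemma ab_neq: "i < n \<Longrightarrow> j < n \<Longrightarrow> a i \<noteq> b j"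
  by (metis ab ba a_less b_less linorder_neqE_nat order_less_irrefl order_less_trans)

text \<open>\<open>V\<close> and \<open>W\<close> are the squared scaling factors that make the Cauchy matrix \<open>1 / (b j - a i)\<close> orthogonal; this
  orthogonal matrix turns \<open>diag b\<close> into \<open>diag a\<close> plus a matrix of rank one.\<close>
definition "V j = (b j - a j) * (\<Prod>k\<in>{..<n} - {j}. (b j - a k) / (b j - b k))"
definition "W i = (b i - a i) * (\<Prod>k\<in>{..<n} - {i}. (a i - b k) / (a i - a k))"

lemma V_pos: "j < n \<Longrightarrow> V j > 0"
  unfolding V_def
proof (intro mult_pos_pos prod_pos ballI)
  fix k assume j: "j < n" and k: "k \<in> {..<n} - {j}"
  then consider "k < j" | "j < k" by force
  then show "0 < (b j - a k) / (b j - b k)"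
  proof cases
    case 1 then show ?thesis using j b_less[of k j] ab[of k] by simp
  next
    case 2 then show ?thesis using k b_less[of j k] ba[of j k] by (simp add: divide_neg_neg)
  qed
qed (use ab in simp)

lemma W_pos: "i < n \<Longrightarrow> W i > 0"
  unfolding W_def
proof (intro mult_pos_pos prod_pos ballI)
  fix k assume j: "i < n" and k: "k \<in> {..<n} - {i}"
  then consider "k < i" | "i < k" by force
  then show "0 < (a i - b k) / (a i - a k)"
  proof cases
    case 1 then show ?thesis using j a_less[of k i] ba[of k i] by simp
  next
    case 2 then show ?thesis using k a_less[of i k] ab[of k] by (simp add: divide_neg_neg)
  qed
qed (use ab in simp)

lemma V_eq: "j < n \<Longrightarrow> V j = (\<Prod>k<n. b j - a k) / node_diff b n j"
  unfolding V_def node_diff_def by (simp add: prod_dividef prod.remove[of "{..<n}" j])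
lemma W_eq: "i < n \<Longrightarrow> W i = - (\<Prod>k<n. a i - b k) / node_diff a n i"
proof -
  assume "i < n"
  then have P: "(\<Prod>k<n. a i - b k) = (a i - b i) * (\<Prod>k\<in>{..<n} - {i}. a i - b k)"
    by (intro prod.remove) auto
  show "W i = - (\<Prod>k<n. a i - b k) / node_diff a n i"
    unfolding W_def node_diff_def P prod_dividef
    by (simp only: mult_minus_left[symmetric] minus_diff_eq times_divide_eq_right)
qed

lemma V_quotient:
  assumes "j < n" "k < n"
  shows "V j / (b j - a k) = poly (\<Prod>i\<in>{..<n} - {k}. [:- a i, 1:]) (b j) / node_diff b n j"
proof -
  have "(\<Prod>i<n. b j - a i) = (b j - a k) * (\<Prod>i\<in>{..<n} - {k}. b j - a i)"
    using assms by (intro prod.remove) auto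
  then show ?thesis using assms ab_neq[of k j] by (simp add: V_eq poly_prod)
qed

lemma degree_omit: "k < n \<Longrightarrow> degree (\<Prod>i\<in>{..<n} - {k}. [:- a i, 1:]) = n - 1"
  by (subst degree_prod_eq_sum_degree) auto

text \<open>\<open>V j / (b j - a k)\<close> is the Lagrange weight at \<open>b j\<close> of the
  monic polynomial with the roots \<open>a i\<close>, \<open>i \<noteq> k\<close>; the sum is its
  leading coefficient.\<close>

lemma sum_V: "k < n \<Longrightarrow> (\<Sum>j<n. V j / (b j - a k)) = 1"
proof -
  assume k: "k < n"
  let ?q = "\<Prod>i\<in>{..<n} - {k}. [:- a i, 1:]"
  have "(\<Sum>j<n. V j / (b j - a k)) = (\<Sum>j<n. poly ?q (b j) / node_diff b n j)"
    using k by (intro sum.cong) (auto simp: V_quotient)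
  also have "\<dots> = coeff ?q (n - 1)"
    by (rule lagrange_lead_coeff[OF inj_b]) (use k degree_omit[OF k] in auto)
  also have "\<dots> = lead_coeff ?q" using degree_omit[OF k] by simp
  also have "\<dots> = 1" by (simp add: lead_coeff_prod)
  finally show ?thesis .
qed

text \<open>For \<open>i \<noteq> k\<close> partial fractions turn the sum into a difference of two
  sums equal to one. For \<open>i = k\<close> it is a partial fraction expansion with poles
  \<open>b j\<close>, evaluated at \<open>a i\<close>.\<close>

lemma sum_V_orth:
  assumes i: "i < n" and k: "k < n"
  shows "(\<Sum>j<n. V j / ((b j - a i) * (b j - a k))) = (if i = k then 1 / W i else 0)"
proof (cases "i = k")
  case True
  let ?q = "\<Prod>l\<in>{..<n} - {i}. [:- a l, 1:]"
  have "(\<Sum>j<n. V j / ((b j - a i) * (b j - a i))) = (\<Sum>j<n. - (poly ?q (b j) / (node_diff b n j * (a i - b j))))"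
  proof (intro sum.cong refl)
    fix j assume "j \<in> {..<n}"
    then have j: "j < n" by simp
    have "V j / ((b j - a i) * (b j - a i)) = (V j / (b j - a i)) / (b j - a i)" by simp
    also have "\<dots> = poly ?q (b j) / node_diff b n j / (b j - a i)" unfolding V_quotient[OF j i] ..
    also have "\<dots> = - (poly ?q (b j) / (node_diff b n j * (a i - b j)))"
    proof -
      have "node_diff b n j * (a i - b j) = - (node_diff b n j * (b j - a i))" by (simp add: algebra_simps)
      then show ?thesis by simp
    qed
    finally show "V j / ((b j - a i) * (b j - a i)) = - (poly ?q (b j) / (node_diff b n j * (a i - b j)))" .
  qed
  also have "\<dots> = - (poly ?q (a i) / (\<Prod>k<n. a i - b k))"
    unfolding sum_negf using i degree_omit[OF i] ab_neq
    by (subst lagrange_partial_fraction[OF inj_b]) auto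
  also have "\<dots> = 1 / W i" using i by (simp add: W_eq node_diff_def poly_prod)
  finally show ?thesis using True by simp
next
  case False
  then have ne: "a i - a k \<noteq> 0" using inj_a i k by (auto simp: inj_on_def)
  have "(\<Sum>j<n. V j / ((b j - a i) * (b j - a k))) = (\<Sum>j<n. (V j / (b j - a i) - V j / (b j - a k)) / (a i - a k))"
  proof (intro sum.cong refl)
    fix j assume "j \<in> {..<n}"
    then have "b j - a i \<noteq> 0" "b j - a k \<noteq> 0" using ab_neq i k by force+
    moreover have "a i - a k = (b j - a k) - (b j - a i)" by simp
    ultimately show "V j / ((b j - a i) * (b j - a k)) = (V j / (b j - a i) - V j / (b j - a k)) / (a i - a k)"
      using divide_mult_split[of "b j - a i" "b j - a k" "V j"] ne by simp
  qed
  also have "\<dots> = 0" by (simp add: sum_divide_distrib[symmetric] sum_subtractf sum_V i k)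
  finally show ?thesis using False by simp
qed

definition "U = mat n n (\<lambda>(i, j). complex_of_real (sqrt (W i) * sqrt (V j) / (b j - a i)))"

lemma U_carrier [simp]: "U \<in> carrier_mat n n"
  by (simp add: U_def)

lemma U_dim [simp]: "dim_row U = n" "dim_col U = n"
  by (simp_all add: U_def)

lemma U_unitary: "unitary n U"
proof -
  have 1: "U * mat_adjoint U = 1\<^sub>m n"
  proof (rule eq_matI)
    fix i k assume "i < dim_row (1\<^sub>m n :: complex mat)" "k < dim_col (1\<^sub>m n :: complex mat)"
    then have ik: "i < n" "k < n" by auto
    have "(U * mat_adjoint U) $$ (i, k) = (\<Sum>j<n. U $$ (i, j) * cnj (U $$ (k, j)))"
      using ik U_carrier by (simp add: scalar_prod_def atLeast0LessThan)
    also have "\<dots> = (\<Sum>j<n. complex_of_real (sqrt (W i) * sqrt (W k) * (V j / ((b j - a i) * (b j - a k)))))"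
    proof (intro sum.cong refl)
      fix j assume "j \<in> {..<n}"
      then have s: "sqrt (V j) * sqrt (V j) = V j" using V_pos[of j] by simp
      have "(sqrt (W i) * sqrt (V j) / (b j - a i)) * (sqrt (W k) * sqrt (V j) / (b j - a k))
        = sqrt (W i) * sqrt (W k) * (sqrt (V j) * sqrt (V j) / ((b j - a i) * (b j - a k)))"
        by simp
      then have "(sqrt (W i) * sqrt (V j) / (b j - a i)) * (sqrt (W k) * sqrt (V j) / (b j - a k))
        = sqrt (W i) * sqrt (W k) * (V j / ((b j - a i) * (b j - a k)))" unfolding s .
      then show "U $$ (i, j) * cnj (U $$ (k, j)) = complex_of_real (sqrt (W i) * sqrt (W k) * (V j / ((b j - a i) * (b j - a k))))"
        using ik \<open>j \<in> {..<n}\<close> by (simp add: U_def flip: of_real_mult of_real_divide of_real_diff)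
    qed
    also have "\<dots> = complex_of_real (sqrt (W i) * sqrt (W k) * (if i = k then 1 / W i else 0))"
      by (simp only: of_real_sum[symmetric] sum_distrib_left[symmetric] sum_V_orth[OF ik])
    also have "sqrt (W i) * sqrt (W k) * (if i = k then 1 / W i else 0) = (if i = k then 1 else 0)"
      using W_pos[OF ik(1)] by auto
    also have "complex_of_real (if i = k then 1 else 0) = 1\<^sub>m n $$ (i, k)" using ik by auto
    finally show "(U * mat_adjoint U) $$ (i, k) = 1\<^sub>m n $$ (i, k)" .
  qed (use U_carrier in auto)
  then show ?thesis
    using mat_mult_left_right_inverse[OF U_carrier _ 1] by (simp add: unitary_def)
qed

text \<open>Writing \<open>b j = (b j - a i) + a i\<close> splits each entry into a
  \<open>sum_V\<close> term, which gives the rank-one part, and a \<open>sum_V_orth\<close> term,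
  which gives the diagonal.\<close>

lemma spec_b_entries:
  assumes ik: "i < n" "k < n"
  shows "rspec n U b $$ (i, k)
    = complex_of_real ((if i = k then a i else 0) + sqrt (W i) * sqrt (W k))"
proof -
  interpret sq_mat n .
  let ?B = "rspec n U b"
  have D: "(dg n (\<lambda>j. complex_of_real (b j)) * mat_adjoint U) $$ (j, k) = complex_of_real (b j) * cnj (U $$ (k, j))"
    if "j < n" for j
  proof -
    have "(dg n (\<lambda>j. complex_of_real (b j)) * mat_adjoint U) $$ (j, k)
      = (\<Sum>l<n. (if j = l then complex_of_real (b j) else 0) * cnj (U $$ (k, l)))"
      using that ik U_carrier by (simp add: dg_def scalar_prod_def atLeast0LessThan)
    also have "\<dots> = (\<Sum>l<n. if l = j then complex_of_real (b j) * cnj (U $$ (k, j)) else 0)"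
      by (intro sum.cong) auto
    finally show ?thesis using that by simp
  qed
  have "?B = U * (dg n (\<lambda>j. complex_of_real (b j)) * mat_adjoint U)"
    unfolding spec_def by (rule sq_assoc) auto
  then have "?B $$ (i, k) = (\<Sum>j<n. U $$ (i, j) * (complex_of_real (b j) * cnj (U $$ (k, j))))"
    using ik U_carrier D by (simp add: scalar_prod_def atLeast0LessThan dg_def del: assoc_mult_mat)
  also have "\<dots> = (\<Sum>j<n. complex_of_real (sqrt (W i) * sqrt (W k) *
      (V j / (b j - a k) + a i * (V j / ((b j - a i) * (b j - a k))))))"
  proof (intro sum.cong refl)
    fix j assume "j \<in> {..<n}"
    then have j: "j < n" by simp
    have s: "sqrt (V j) * sqrt (V j) = V j" using V_pos[OF j] by simp
    have ne: "b j - a i \<noteq> 0" "b j - a k \<noteq> 0" using ab_neq ik j by force+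
    have "(sqrt (W i) * sqrt (V j) / (b j - a i)) * (b j * (sqrt (W k) * sqrt (V j) / (b j - a k)))
      = sqrt (W i) * sqrt (W k) * (b j * (sqrt (V j) * sqrt (V j)) / ((b j - a i) * (b j - a k)))"
      by simp
    also have "b j * (sqrt (V j) * sqrt (V j)) / ((b j - a i) * (b j - a k))
      = V j / (b j - a k) + a i * (V j / ((b j - a i) * (b j - a k)))"
    proof -
      have "b j * V j / ((b j - a i) * (b j - a k)) = ((b j - a i) * V j + a i * V j) / ((b j - a i) * (b j - a k))"
        by (simp add: algebra_simps)
      also have "\<dots> = V j / (b j - a k) + a i * (V j / ((b j - a i) * (b j - a k)))"
        using ne by (simp add: add_divide_distrib)
      finally show ?thesis unfolding s .
    qed
    finally show "U $$ (i, j) * (complex_of_real (b j) * cnj (U $$ (k, j))) = complex_of_real (sqrt (W i) * sqrt (W k) *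
      (V j / (b j - a k) + a i * (V j / ((b j - a i) * (b j - a k)))))"
      using ik j by (simp add: U_def flip: of_real_mult of_real_divide of_real_diff of_real_add)
  qed
  also have "\<dots> = complex_of_real (sqrt (W i) * sqrt (W k) * (1 + a i * (if i = k then 1 / W i else 0)))"
    by (simp only: of_real_sum[symmetric] sum_distrib_left[symmetric] sum.distrib sum_V_orth[OF ik] sum_V[OF ik(2)])
  also have "sqrt (W i) * sqrt (W k) * (1 + a i * (if i = k then 1 / W i else 0))
      = (if i = k then a i else 0) + sqrt (W i) * sqrt (W k)"
    using W_pos[OF ik(1)] by (auto simp: algebra_simps)
  finally show ?thesis .
qed

lemma loewner_a_b:
  "loewner_le (rspec n (1\<^sub>m n) a) (rspec n U b)"
proof -
  let ?A = "rspec n (1\<^sub>m n) a" and ?B = "rspec n U b"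
  have c: "?A \<in> carrier_mat n n" "?B \<in> carrier_mat n n" using U_unitary unitary_one by auto
  have "rform ?A x \<le> rform ?B x" if x: "x \<in> carrier_vec n" for x
  proof -
    define s where "s = (\<Sum>k<n. complex_of_real (sqrt (W k)) * x $ k)"
    have A: "(?A *\<^sub>v x) $ i = complex_of_real (a i) * x $ i" if i: "i < n" for i
    proof -
      have "(?A *\<^sub>v x) $ i = (\<Sum>k<n. (if i = k then complex_of_real (a i) else 0) * x $ k)"
        unfolding spec_one using i x by (simp add: dg_def scalar_prod_def atLeast0LessThan)
      also have "\<dots> = (\<Sum>k<n. if k = i then complex_of_real (a i) * x $ i else 0)" by (intro sum.cong) auto
      finally show ?thesis using i by simp
    qed
    have B: "(?B *\<^sub>v x) $ i = complex_of_real (a i) * x $ i + complex_of_real (sqrt (W i)) * s" if i: "i < n" for i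
    proof -
      have "(?B *\<^sub>v x) $ i = (\<Sum>k<n. ?B $$ (i, k) * x $ k)"
        using i x c by (simp add: scalar_prod_def atLeast0LessThan)
      also have "\<dots> = (\<Sum>k<n. (if k = i then complex_of_real (a i) * x $ i else 0)
          + complex_of_real (sqrt (W i)) * (complex_of_real (sqrt (W k)) * x $ k))"
        using i by (intro sum.cong) (auto simp: spec_b_entries algebra_simps)
      finally show ?thesis using i by (simp add: sum.distrib s_def sum_distrib_left)
    qed
    have "ip (?B *\<^sub>v x) x = ip (?A *\<^sub>v x) x + (\<Sum>i<n. s * cnj (complex_of_real (sqrt (W i)) * x $ i))"
      unfolding ip_def carrier_vecD[OF x] by (simp add: A B algebra_simps sum.distrib del: index_mult_mat_vec)
    also have "(\<Sum>i<n. s * cnj (complex_of_real (sqrt (W i)) * x $ i)) = complex_of_real ((cmod s)\<^sup>2)"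
      by (simp only: sum_distrib_left[symmetric] cnj_sum[symmetric] s_def[symmetric] complex_norm_square)
    finally show ?thesis by simp
  qed
  then show ?thesis
    using c hermitian_spec[OF unitary_one, of n a] hermitian_spec[OF U_unitary, of b] by (simp add: loewner_le_iff)
qed

text \<open>Operator monotonicity for the pair in \<open>loewner_a_b\<close>, tested on a single
  vector. The product of the \<open>a i - b k\<close> carries the minus sign of the left-hand side,
  so both sums appear with a plus.\<close>

lemma operator_monotone_interlacing:
  assumes f: "operator_monotone f" and pos: "n > 0 \<Longrightarrow> 0 < a 0" and g: "degree g < n"
  shows "0 \<le> (\<Sum>j<n. f (b j) * (poly g (b j))\<^sup>2 / (node_diff b n j * (\<Prod>k<n. b j - a k)))
           + (\<Sum>i<n. f (a i) * (poly g (a i))\<^sup>2 / (node_diff a n i * (\<Prod>k<n. a i - b k)))"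
proof -
  let ?A = "rspec n (1\<^sub>m n) a" and ?B = "rspec n U b"
  note u1 = unitary_one[of n]
  have apos: "0 < a i" if "i < n" for i
    using pos a_less[of 0 i] that by (cases "i = 0") auto
  have bpos: "0 < b i" if "i < n" for i using apos[OF that] ab[OF that] by simp
  have "loewner_le (herm_calc f ?A) (herm_calc f ?B)"
    using f loewner_a_b pd_mat_spec[OF u1, of a] pd_mat_spec[OF U_unitary, of b] apos bpos
      spec_carrier[OF u1] spec_carrier[OF U_unitary] unfolding operator_monotone_def by blast
  then have le: "loewner_le (spec n (1\<^sub>m n) (\<lambda>i. complex_of_real (f (a i)))) (spec n U (\<lambda>i. complex_of_real (f (b i))))"
    by (simp only: herm_calc_spec[OF u1] herm_calc_spec[OF U_unitary])
  \<comment> \<open>Scaled so that each component of \<open>U* x\<close> is a partial fraction sum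
    with poles at the \<open>a i\<close>, which evaluates to a multiple of
    \<open>poly g (b j)\<close>.\<close>
  define x where "x = vec n (\<lambda>i. complex_of_real (poly g (a i) / (node_diff a n i * sqrt (W i))))"
  have x: "x \<in> carrier_vec n" by (simp add: x_def)
  have le': "(\<Sum>i<n. f (a i) * (cmod ((mat_adjoint (1\<^sub>m n) *\<^sub>v x) $ i))\<^sup>2) \<le> (\<Sum>i<n. f (b i) * (cmod ((mat_adjoint U *\<^sub>v x) $ i))\<^sup>2)"
    using le x unfolding loewner_le_iff[OF spec_carrier[OF u1] spec_carrier[OF U_unitary]]
    by (simp only: qform_spec[OF u1 x, symmetric] qform_spec[OF U_unitary x, symmetric])
  have xa: "(cmod ((mat_adjoint (1\<^sub>m n) *\<^sub>v x) $ i))\<^sup>2 = - ((poly g (a i))\<^sup>2 / (node_diff a n i * (\<Prod>k<n. a i - b k)))"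
    if i: "i < n" for i
  proof -
    have "(mat_adjoint (1\<^sub>m n) *\<^sub>v x) $ i = complex_of_real (poly g (a i) / (node_diff a n i * sqrt (W i)))"
      using x i by (simp add: x_def)
    then have "(cmod ((mat_adjoint (1\<^sub>m n) *\<^sub>v x) $ i))\<^sup>2 = (poly g (a i))\<^sup>2 / ((node_diff a n i)\<^sup>2 * W i)"
      using W_pos[OF i] by (simp only: norm_of_real power2_abs) (simp add: power_divide power_mult_distrib)
    also have "\<dots> = - ((poly g (a i))\<^sup>2 / (node_diff a n i * (\<Prod>k<n. a i - b k)))"
      using node_diff_nonzero[OF inj_a i] by (simp add: W_eq[OF i] power2_eq_square)
    finally show ?thesis .
  qed
  have xb: "(cmod ((mat_adjoint U *\<^sub>v x) $ j))\<^sup>2 = (poly g (b j))\<^sup>2 / (node_diff b n j * (\<Prod>k<n. b j - a k))"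
    if j: "j < n" for j
  proof -
    have nz: "(\<Prod>k<n. b j - a k) \<noteq> 0" using ab_neq[OF _ j] by force
    have "(mat_adjoint U *\<^sub>v x) $ j = (\<Sum>i<n. cnj (U $$ (i, j)) * x $ i)"
      using j x U_carrier by (simp add: scalar_prod_def atLeast0LessThan)
    also have "\<dots> = (\<Sum>i<n. complex_of_real (sqrt (V j) * (poly g (a i) / (node_diff a n i * (b j - a i)))))"
    proof (intro sum.cong refl)
      fix i assume "i \<in> {..<n}"
      then have i: "i < n" by simp
      have "(sqrt (W i) * sqrt (V j) / (b j - a i)) * (poly g (a i) / (node_diff a n i * sqrt (W i)))
        = sqrt (V j) * (poly g (a i) / (node_diff a n i * (b j - a i)))"
        using W_pos[OF i] by simp
      then show "cnj (U $$ (i, j)) * x $ i = complex_of_real (sqrt (V j) * (poly g (a i) / (node_diff a n i * (b j - a i))))"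
        using i j by (simp add: U_def x_def flip: of_real_mult of_real_divide of_real_diff)
    qed
    also have "\<dots> = complex_of_real (sqrt (V j) * (poly g (b j) / (\<Prod>k<n. b j - a k)))"
    proof -
      have "b j \<notin> a ` {..<n}" using ab_neq[OF _ j] by force
      from lagrange_partial_fraction[OF inj_a g this] show ?thesis
        by (simp only: of_real_sum[symmetric] sum_distrib_left[symmetric])
    qed
    finally have "(cmod ((mat_adjoint U *\<^sub>v x) $ j))\<^sup>2 = V j * (poly g (b j) / (\<Prod>k<n. b j - a k))\<^sup>2"
      using V_pos[OF j] by (simp only: norm_of_real power2_abs power_mult_distrib real_sqrt_pow2 less_imp_le)
    also have "\<dots> = (poly g (b j))\<^sup>2 / (node_diff b n j * (\<Prod>k<n. b j - a k))"
      using nz by (simp add: V_eq[OF j] power2_eq_square)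
    finally show ?thesis .
  qed
  have "(\<Sum>i<n. f (a i) * - ((poly g (a i))\<^sup>2 / (node_diff a n i * (\<Prod>k<n. a i - b k))))
     \<le> (\<Sum>j<n. f (b j) * ((poly g (b j))\<^sup>2 / (node_diff b n j * (\<Prod>k<n. b j - a k))))"
    using le' by (simp add: xa xb del: mat_adjoint_one index_mult_mat_vec)
  then show ?thesis by (simp add: sum_negf)
qed

end

section \<open>Divided differences of operator monotone functions\<close>

lemma sum_even_odd: "(\<Sum>i<2*n. h i) = (\<Sum>i<n. h (2*i)) + (\<Sum>i<n. h (2*i+1 :: nat))" for h :: "nat \<Rightarrow> real"
  by (induction n) (auto simp: algebra_simps)

lemma prod_even_odd: "(\<Prod>i<2*n. h i) = (\<Prod>i<n. h (2*i)) * (\<Prod>i<n. h (2*i+1 :: nat))" for h :: "nat \<Rightarrow> real"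
  by (induction n) (auto simp: algebra_simps)

lemma node_diff_even:
  assumes "i < n"
  shows "node_diff t (2*n) (2*i) = node_diff (\<lambda>i. t (2*i)) n i * (\<Prod>k<n. t (2*i) - t (2*k+1))"
proof -
  let ?h = "\<lambda>j. if j = 2*i then 1 else t (2*i) - t j"
  have "node_diff t (2*n) (2*i) = (\<Prod>j<2*n. ?h j)"
    unfolding node_diff_def using assms by (subst prod.remove[of "{..<2*n}" "2*i"]) auto
  also have "\<dots> = (\<Prod>k<n. ?h (2*k)) * (\<Prod>k<n. ?h (2*k+1))" by (rule prod_even_odd)
  also have "(\<Prod>k<n. ?h (2*k)) = node_diff (\<lambda>i. t (2*i)) n i"
    unfolding node_diff_def using assms by (subst prod.remove[of "{..<n}" i]) auto
  also have "(\<Prod>k<n. ?h (2*k+1)) = (\<Prod>k<n. t (2*i) - t (2*k+1))"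
    by (intro prod.cong) (auto, presburger)
  finally show ?thesis .
qed

lemma node_diff_odd:
  assumes "i < n"
  shows "node_diff t (2*n) (2*i+1) = node_diff (\<lambda>i. t (2*i+1)) n i * (\<Prod>k<n. t (2*i+1) - t (2*k))"
proof -
  let ?h = "\<lambda>j. if j = 2*i+1 then 1 else t (2*i+1) - t j"
  have "node_diff t (2*n) (2*i+1) = (\<Prod>j<2*n. ?h j)"
    unfolding node_diff_def using assms by (subst prod.remove[of "{..<2*n}" "2*i+1"]) auto
  also have "\<dots> = (\<Prod>k<n. ?h (2*k)) * (\<Prod>k<n. ?h (2*k+1))" by (rule prod_even_odd)
  also have "(\<Prod>k<n. ?h (2*k+1)) = node_diff (\<lambda>i. t (2*i+1)) n i"
    unfolding node_diff_def using assms by (subst prod.remove[of "{..<n}" i]) auto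
  also have "(\<Prod>k<n. ?h (2*k)) = (\<Prod>k<n. t (2*i+1) - t (2*k))"
    by (intro prod.cong) (auto, presburger)
  finally show ?thesis by simp
qed

text \<open>Even-indexed nodes serve as \<open>a\<close>, odd-indexed ones as \<open>b\<close>; the
  two sums then merge into one divided difference, of order \<open>2*n - 1\<close>, of
  \<open>f\<close> times the square of \<open>g\<close>.\<close>

lemma operator_monotone_divided_difference:
  assumes f: "operator_monotone f"
    and t: "\<And>i j. i < j \<Longrightarrow> j < 2*n \<Longrightarrow> t i < t j" "0 < t 0" and g: "degree g < n"
  shows "0 \<le> (\<Sum>m<2*n. f (t m) * (poly g (t m))\<^sup>2 / node_diff t (2*n) m)"
proof -
  interpret interlacing n "\<lambda>i. t (2*i)" "\<lambda>i. t (2*i+1)"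
    by unfold_locales (auto intro!: t)
  have "(\<Sum>m<n. f (t (2*m)) * (poly g (t (2*m)))\<^sup>2 / node_diff t (2*n) (2*m))
    = (\<Sum>i<n. f (t (2*i)) * (poly g (t (2*i)))\<^sup>2 / (node_diff (\<lambda>i. t (2*i)) n i * (\<Prod>k<n. t (2*i) - t (2*k+1))))"
    by (intro sum.cong) (simp_all only: lessThan_iff node_diff_even)
  moreover have "(\<Sum>m<n. f (t (2*m+1)) * (poly g (t (2*m+1)))\<^sup>2 / node_diff t (2*n) (2*m+1))
    = (\<Sum>i<n. f (t (2*i+1)) * (poly g (t (2*i+1)))\<^sup>2 / (node_diff (\<lambda>i. t (2*i+1)) n i * (\<Prod>k<n. t (2*i+1) - t (2*k))))"
    by (intro sum.cong) (simp_all only: lessThan_iff node_diff_odd)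
  ultimately show ?thesis
    using operator_monotone_interlacing[OF f _ g] t(2) unfolding sum_even_odd by simp
qed

lemma node_diff_extend:
  assumes t': "t' 0 = \<epsilon>" "\<And>i. i < N \<Longrightarrow> t' (Suc i) = t i" "t' (Suc N) = T"
  shows "m < N \<Longrightarrow> node_diff t' (Suc (Suc N)) (Suc m) = (t m - \<epsilon>) * (t m - T) * node_diff t N m"
    and "node_diff t' (Suc (Suc N)) 0 = (\<epsilon> - T) * (\<Prod>j<N. \<epsilon> - t j)"
    and "node_diff t' (Suc (Suc N)) (Suc N) = (T - \<epsilon>) * (\<Prod>j<N. T - t j)"
proof -
  have S: "{..<Suc (Suc N)} = insert 0 (insert (Suc N) (Suc ` {..<N}))"
    unfolding lessThan_Suc_eq_insert_0[of "Suc N"] lessThan_Suc[of N] by simp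
  have im: "(\<Prod>j\<in>Suc ` A. s - t' j) = (\<Prod>j\<in>A. s - t j)" if "A \<subseteq> {..<N}" for A s
    using that t'(2) by (subst prod.reindex) (auto intro!: prod.cong)
  show "node_diff t' (Suc (Suc N)) 0 = (\<epsilon> - T) * (\<Prod>j<N. \<epsilon> - t j)"
  proof -
    have "{..<Suc (Suc N)} - {0} = insert (Suc N) (Suc ` {..<N})" unfolding S by auto
    then show ?thesis unfolding node_diff_def using t' by (simp add: im image_iff)
  qed
  show "node_diff t' (Suc (Suc N)) (Suc N) = (T - \<epsilon>) * (\<Prod>j<N. T - t j)"
  proof -
    have "{..<Suc (Suc N)} - {Suc N} = insert 0 (Suc ` {..<N})" unfolding S by auto
    then show ?thesis unfolding node_diff_def using t' by (simp add: im image_iff)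
  qed
  show "node_diff t' (Suc (Suc N)) (Suc m) = (t m - \<epsilon>) * (t m - T) * node_diff t N m" if m: "m < N"
  proof -
    have "{..<Suc (Suc N)} - {Suc m} = insert 0 (insert (Suc N) (Suc ` ({..<N} - {m})))" unfolding S using m by auto
    then show ?thesis unfolding node_diff_def using t' m by (simp add: im image_iff)
  qed
qed

lemma prod_neg_even:
  fixes h :: "nat \<Rightarrow> real"
  assumes "\<And>i. i < 2*n \<Longrightarrow> h i < 0"
  shows "(\<Prod>i<2*n. h i) > 0"
  using assms
proof (induction n)
  case (Suc n)
  have eq: "(\<Prod>i<2*Suc n. h i) = (\<Prod>i<2*n. h i) * (h (2*n) * h (2*n+1))" by (simp add: mult.assoc)
  show ?case unfolding eq
    by (intro mult_pos_pos[OF Suc.IH] mult_neg_neg) (use Suc.prems in auto)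
qed simp

text \<open>Two further nodes, \<open>\<epsilon>\<close> below and \<open>T\<close> above the given
  ones, enter the previous inequality. The term at \<open>\<epsilon>\<close> is non-positive and is
  dropped. After multiplication by \<open>T\<close> the term at \<open>T\<close> is bounded by a
  quantity that vanishes at infinity, while the factor \<open>T / (t m - T)\<close> in the other
  terms tends to \<open>-1\<close> and reverses the sign.\<close>

lemma operator_monotone_divided_difference_extended:
  assumes f: "operator_monotone f" and fpos: "\<And>s. 0 < s \<Longrightarrow> 0 < f s" and fle: "\<And>s. 0 < s \<Longrightarrow> f s \<le> 1 + s"
    and t: "\<And>i j. i < j \<Longrightarrow> j < 2*n \<Longrightarrow> t i < t j" and n: "0 < n" and g: "degree g < n"
    and eps: "0 < \<epsilon>" "\<epsilon> < t 0"
  shows "(\<Sum>m<2*n. f (t m) * (poly g (t m))\<^sup>2 / ((t m - \<epsilon>) * node_diff t (2*n) m)) \<le> 0"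
proof -
  let ?N = "2*n"
  let ?q = "[:0,1:] * [:1,1:] * (g * g)" and ?p = "[:-\<epsilon>,1:] * (\<Prod>m<?N. [:- t m,1:])"
  define L where "L = t (?N - 1)"
  have tL: "t m \<le> L" if "m < ?N" for m
  proof (cases "m = ?N - 1")
    case False
    with that have "m < ?N - 1" by linarith
    with t[of m "?N - 1"] n show ?thesis by (simp add: L_def)
  qed (simp add: L_def)
  have et: "\<epsilon> < t m" if "m < ?N" for m
    using t[of 0 m] that eps by (cases "m = 0") auto
  have L: "\<epsilon> < L" using et[of "?N - 1"] n by (simp add: L_def)
  have main: "0 \<le> (\<Sum>m<?N. f (t m) * (poly g (t m))\<^sup>2 / ((t m - \<epsilon>) * node_diff t ?N m) * (T / (t m - T))) + poly ?q T / poly ?p T"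
    if T: "T > L" for T
  proof -
    define t' where "t' i = (if i = 0 then \<epsilon> else if i = Suc ?N then T else t (i - 1))" for i
    have t'1: "t' 0 = \<epsilon>" "\<And>i. i < ?N \<Longrightarrow> t' (Suc i) = t i" "t' (Suc ?N) = T"
      by (auto simp: t'_def)
    have inc: "t' i < t' j" if "i < j" "j < 2 * Suc n" for i j
    proof -
      obtain j' where j': "j = Suc j'" using \<open>i < j\<close> by (cases j) auto
      show ?thesis
      proof (cases "j' = ?N")
        case True
        then show ?thesis using that j' T L tL[of "i - 1"]
          by (cases i) (auto simp: t'_def)
      next
        case False
        then show ?thesis using that j' et[of j'] t[of "i - 1" j']
          by (cases i) (auto simp: t'_def)
      qed
    qed
    have "0 \<le> (\<Sum>m<2 * Suc n. f (t' m) * (poly g (t' m))\<^sup>2 / node_diff t' (2 * Suc n) m)"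
      by (rule operator_monotone_divided_difference[OF f inc]) (use eps g t'1 in auto)
    also have "2 * Suc n = Suc (Suc ?N)" by simp
    also have "(\<Sum>m<Suc (Suc ?N). f (t' m) * (poly g (t' m))\<^sup>2 / node_diff t' (Suc (Suc ?N)) m)
      = f \<epsilon> * (poly g \<epsilon>)\<^sup>2 / ((\<epsilon> - T) * (\<Prod>j<?N. \<epsilon> - t j))
        + (\<Sum>m<?N. f (t m) * (poly g (t m))\<^sup>2 / ((t m - \<epsilon>) * (t m - T) * node_diff t ?N m))
        + f T * (poly g T)\<^sup>2 / ((T - \<epsilon>) * (\<Prod>j<?N. T - t j))"
      using t'1 by (subst sum.lessThan_Suc, subst sum.lessThan_Suc_shift)
        (simp add: node_diff_extend[of t' \<epsilon> ?N t T, OF t'1] del: mult_Suc mult_Suc_right)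
    finally have 1: "0 \<le> f \<epsilon> * (poly g \<epsilon>)\<^sup>2 / ((\<epsilon> - T) * (\<Prod>j<?N. \<epsilon> - t j))
        + (\<Sum>m<?N. f (t m) * (poly g (t m))\<^sup>2 / ((t m - \<epsilon>) * (t m - T) * node_diff t ?N m))
        + f T * (poly g T)\<^sup>2 / ((T - \<epsilon>) * (\<Prod>j<?N. T - t j))" .
    \<comment> \<open>An even number of negative factors, since \<open>\<epsilon>\<close> lies below
      all \<open>2*n\<close> nodes.\<close>
    have "(\<Prod>j<?N. \<epsilon> - t j) > 0" by (rule prod_neg_even) (use et in auto)
    then have "(\<epsilon> - T) * (\<Prod>j<?N. \<epsilon> - t j) < 0" using T L by (simp add: mult_neg_pos)
    then have 2: "f \<epsilon> * (poly g \<epsilon>)\<^sup>2 / ((\<epsilon> - T) * (\<Prod>j<?N. \<epsilon> - t j)) \<le> 0"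
      using fpos[OF eps(1)] by (simp add: divide_nonneg_neg)
    have Tp: "0 < T" using T L eps by simp
    have "(\<Prod>j<?N. T - t j) > 0" using T tL by (intro prod_pos) force
    then have den: "(T - \<epsilon>) * (\<Prod>j<?N. T - t j) > 0" using T L by simp
    have "f T * (poly g T)\<^sup>2 / ((T - \<epsilon>) * (\<Prod>j<?N. T - t j)) \<le> (1 + T) * (poly g T)\<^sup>2 / ((T - \<epsilon>) * (\<Prod>j<?N. T - t j))"
      using fle[OF Tp] den by (intro divide_right_mono mult_right_mono) auto
    with 1 2 have "0 \<le> (\<Sum>m<?N. f (t m) * (poly g (t m))\<^sup>2 / ((t m - \<epsilon>) * (t m - T) * node_diff t ?N m))
        + (1 + T) * (poly g T)\<^sup>2 / ((T - \<epsilon>) * (\<Prod>j<?N. T - t j))" by linarith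
    then have "0 \<le> T * ((\<Sum>m<?N. f (t m) * (poly g (t m))\<^sup>2 / ((t m - \<epsilon>) * (t m - T) * node_diff t ?N m))
        + (1 + T) * (poly g T)\<^sup>2 / ((T - \<epsilon>) * (\<Prod>j<?N. T - t j)))" using Tp by simp
    also have "\<dots> = (\<Sum>m<?N. f (t m) * (poly g (t m))\<^sup>2 / ((t m - \<epsilon>) * node_diff t ?N m) * (T / (t m - T)))
        + T * ((1 + T) * (poly g T)\<^sup>2 / ((T - \<epsilon>) * (\<Prod>j<?N. T - t j)))"
      unfolding distrib_left sum_distrib_left by (intro arg_cong2[of _ _ _ _ "(+)"] sum.cong refl) (simp add: mult_ac)
    also have "T * ((1 + T) * (poly g T)\<^sup>2 / ((T - \<epsilon>) * (\<Prod>j<?N. T - t j))) = poly ?q T / poly ?p T"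
      by (simp add: poly_prod power2_eq_square algebra_simps)
    finally show ?thesis .
  qed
  \<comment> \<open>Since \<open>degree g < n\<close>, the numerator has degree at most
    \<open>2*n\<close> against \<open>2*n + 1\<close> in the denominator. The linear growth of
    \<open>f\<close> and the factor \<open>T\<close> cost one degree each.\<close>
  have "degree ?q \<le> 2 + 2 * degree g"
    using degree_mult_le[of "[:0,1:] * [:1,1:]" "g * g"] degree_mult_le[of g g] by simp
  moreover have "degree ?p = Suc ?N"
    by (subst degree_mult_eq) (auto simp: degree_prod_eq_sum_degree)
  ultimately have "degree ?q < degree ?p" using g by linarith
  from poly_divide_tendsto_0_at_infinity[OF this]
  have l1: "((\<lambda>T. poly ?q T / poly ?p T) \<longlongrightarrow> 0) at_top"
    using at_top_le_at_infinity filterlim_mono order_refl by blast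
  have l2: "((\<lambda>T. T / (c - T)) \<longlongrightarrow> - 1) at_top" for c :: real
    by real_asymp
  have "((\<lambda>T. (\<Sum>m<?N. f (t m) * (poly g (t m))\<^sup>2 / ((t m - \<epsilon>) * node_diff t ?N m) * (T / (t m - T))) + poly ?q T / poly ?p T)
     \<longlongrightarrow> (\<Sum>m<?N. f (t m) * (poly g (t m))\<^sup>2 / ((t m - \<epsilon>) * node_diff t ?N m) * (- 1)) + 0) at_top"
    by (intro tendsto_add tendsto_sum tendsto_mult tendsto_const l1 l2)
  then have "0 \<le> (\<Sum>m<?N. f (t m) * (poly g (t m))\<^sup>2 / ((t m - \<epsilon>) * node_diff t ?N m) * (- 1)) + 0"
    by (rule tendsto_lowerbound) (rule eventually_mono[OF eventually_gt_at_top[of L] main], simp_all)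
  then show ?thesis by (simp add: sum_negf)
qed

text \<open>Adding nodes near \<open>0\<close> and \<open>\<infinity>\<close> turns the previous inequality into one for \<open>f t / t\<close>.\<close>
lemma operator_monotone_divided_difference_quotient:
  assumes f: "operator_monotone f" and fpos: "\<And>s. 0 < s \<Longrightarrow> 0 < f s" and fle: "\<And>s. 0 < s \<Longrightarrow> f s \<le> 1 + s"
    and t: "\<And>i j. i < j \<Longrightarrow> j < 2*n \<Longrightarrow> t i < t j" "0 < t 0" and n: "0 < n" and g: "degree g < n"
  shows "(\<Sum>m<2*n. f (t m) * (poly g (t m))\<^sup>2 / (t m * node_diff t (2*n) m)) \<le> 0"
proof -
  have tpos: "0 < t m" if "m < 2*n" for m
    using t(1)[of 0 m] t(2) that by (cases "m = 0") auto
  have inj: "inj_on t {..<2*n}"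
    by (rule inj_onI) (metis t(1) lessThan_iff linorder_neqE_nat order_less_irrefl)
  have "((\<lambda>\<epsilon>. \<Sum>m<2*n. f (t m) * (poly g (t m))\<^sup>2 / ((t m - \<epsilon>) * node_diff t (2*n) m))
     \<longlongrightarrow> (\<Sum>m<2*n. f (t m) * (poly g (t m))\<^sup>2 / ((t m - 0) * node_diff t (2*n) m))) (at_right 0)"
    by (intro tendsto_intros) (use tpos node_diff_nonzero[OF inj] in force)
  then have "(\<Sum>m<2*n. f (t m) * (poly g (t m))\<^sup>2 / ((t m - 0) * node_diff t (2*n) m)) \<le> 0"
  proof (rule tendsto_upperbound)
    show "\<forall>\<^sub>F \<epsilon> in at_right 0. (\<Sum>m<2*n. f (t m) * (poly g (t m))\<^sup>2 / ((t m - \<epsilon>) * node_diff t (2*n) m)) \<le> 0"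
      using eventually_at_right_real[OF t(2)]
      by eventually_elim (use operator_monotone_divided_difference_extended[OF f fpos fle t(1) n g] in auto)
  qed simp
  then show ?thesis by simp
qed

text \<open>Clearing denominators turns the last hypothesis into non-negativity of \<open>P\<close>
  on the positive axis, so \<open>P = p^2 + s q^2\<close>. Evaluation at \<open>s = - t i\<close>
  isolates \<open>c i\<close>, and the two squares match the divided-difference inequalities for
  \<open>f\<close> (from \<open>q\<close>) and for \<open>f t / t\<close> (from
  \<open>p\<close>).\<close>

lemma operator_monotone_dual_cone:
  fixes t c :: "nat \<Rightarrow> real" and n :: nat
  assumes f: "operator_monotone f" and fpos: "\<And>s. 0 < s \<Longrightarrow> 0 < f s" and fle: "\<And>s. 0 < s \<Longrightarrow> f s \<le> 1 + s"
    and t: "\<And>i j. i < j \<Longrightarrow> j < 2*n \<Longrightarrow> t i < t j" "0 < t 0" and n: "0 < n"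
    and c: "\<And>s. 0 < s \<Longrightarrow> 0 \<le> (\<Sum>i<2*n. c i * (t i / (t i + s)))"
  shows "0 \<le> (\<Sum>i<2*n. c i * f (t i))"
proof -
  let ?N = "2*n"
  have tpos: "0 < t m" if "m < ?N" for m
    using t(1)[of 0 m] t(2) that by (cases "m = 0") auto
  have inj: "inj_on t {..<?N}"
    by (rule inj_onI) (metis t(1) lessThan_iff linorder_neqE_nat order_less_irrefl)
  define P where "P = (\<Sum>i<?N. Polynomial.smult (c i * t i) (\<Prod>j\<in>{..<?N} - {i}. [:t j, 1:]))"
  have P: "poly P s = (\<Sum>i<?N. c i * t i * (\<Prod>j\<in>{..<?N} - {i}. t j + s))" for s
    by (simp add: P_def poly_sum poly_prod)
  have "0 \<le> poly P s" if s: "0 < s" for s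
  proof -
    have "poly P s = (\<Sum>i<?N. c i * (t i / (t i + s)) * (\<Prod>j<?N. t j + s))"
      unfolding P
    proof (intro sum.cong refl)
      fix i assume i: "i \<in> {..<?N}"
      then have eq: "(\<Prod>j<?N. t j + s) = (t i + s) * (\<Prod>j\<in>{..<?N} - {i}. t j + s)" by (intro prod.remove) auto
      have "t i + s \<noteq> 0" using tpos[of i] i s by simp
      then show "c i * t i * (\<Prod>j\<in>{..<?N} - {i}. t j + s) = c i * (t i / (t i + s)) * (\<Prod>j<?N. t j + s)"
        unfolding eq by simp
    qed
    also have "\<dots> = (\<Sum>i<?N. c i * (t i / (t i + s))) * (\<Prod>j<?N. t j + s)" by (simp add: sum_distrib_right)
    also have "\<dots> \<ge> 0" using c[OF s] tpos s by (intro mult_nonneg_nonneg prod_nonneg) (auto simp: less_imp_le add_nonneg_nonneg)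
    finally show ?thesis .
  qed
  then obtain p q where pq: "P = p*p + [:0,1:]*(q*q)" using poly_nonneg_halfline_sos by blast
  have "degree P \<le> ?N - 1"
    unfolding P_def
  proof (rule degree_sum_le)
    fix i assume "i \<in> {..<?N}"
    then have "degree (\<Prod>j\<in>{..<?N} - {i}. [:t j, 1:]) = ?N - 1"
      by (subst degree_prod_eq_sum_degree) auto
    then show "degree (Polynomial.smult (c i * t i) (\<Prod>j\<in>{..<?N} - {i}. [:t j, 1:])) \<le> ?N - 1"
      using degree_smult_le by metis
  qed simp
  then have "degree (p*p + [:0,1:]*(q*q)) < 2 * n" using n pq by simp
  from degree_sos_halfline[OF this n] have deg: "degree p < n" "degree q < n" by auto
  \<comment> \<open>Reflection moves the evaluation at \<open>- t i\<close> to the node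
    \<open>t i\<close>.\<close>
  let ?r = "\<lambda>p. pcompose p [:0, -1:]"
  have deg': "degree (?r p) < n" "degree (?r q) < n" using deg by auto
  have ci: "c i * f (t i) = f (t i) * (poly (?r q) (t i))\<^sup>2 / node_diff t ?N i
      - f (t i) * (poly (?r p) (t i))\<^sup>2 / (t i * node_diff t ?N i)" if i: "i < ?N" for i
  proof -
    have "poly P (- t i) = (\<Sum>k<?N. if k = i then c i * t i * (\<Prod>j\<in>{..<?N} - {i}. t j - t i) else 0)"
      unfolding P
    proof (intro sum.cong refl)
      fix k assume "k \<in> {..<?N}"
      show "c k * t k * (\<Prod>j\<in>{..<?N} - {k}. t j + - t i) = (if k = i then c i * t i * (\<Prod>j\<in>{..<?N} - {i}. t j - t i) else 0)"
      proof (cases "k = i")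
        case False
        then have "(\<Prod>j\<in>{..<?N} - {k}. t j + - t i) = 0" using i by (intro prod_zero) auto
        then show ?thesis using False by simp
      qed simp
    qed
    also have "\<dots> = c i * t i * (\<Prod>j\<in>{..<?N} - {i}. - (t i - t j))" using i by simp
    \<comment> \<open>An odd number \<open>2*n - 1\<close> of sign changes. This sign lets
      \<open>q\<close> contribute positively and \<open>p\<close> negatively to
      \<open>c i\<close>.\<close>
    also have "(\<Prod>j\<in>{..<?N} - {i}. - (t i - t j)) = - node_diff t ?N i"
    proof -
      have "(\<Prod>j\<in>{..<?N} - {i}. - (t i - t j)) = (\<Prod>j\<in>{..<?N} - {i}. -1 * (t i - t j))" by simp
      also have "\<dots> = (-1) ^ card ({..<?N} - {i}) * node_diff t ?N i"
        unfolding prod.distrib node_diff_def by simp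
      also have "odd (card ({..<?N} - {i}))" using i n by simp
      then have "(-1 :: real) ^ card ({..<?N} - {i}) = -1" by simp
      finally show ?thesis by simp
    qed
    finally have "c i * t i * node_diff t ?N i = t i * (poly q (- t i))\<^sup>2 - (poly p (- t i))\<^sup>2"
      by (simp add: pq power2_eq_square)
    moreover have "t i * node_diff t ?N i \<noteq> 0" using tpos[OF i] node_diff_nonzero[OF inj i] by simp
    ultimately have "c i = (t i * (poly q (- t i))\<^sup>2 - (poly p (- t i))\<^sup>2) / (t i * node_diff t ?N i)"
      by (simp add: nonzero_eq_divide_eq mult.assoc)
    then show ?thesis using tpos[OF i] by (simp add: poly_pcompose diff_divide_distrib left_diff_distrib right_diff_distrib mult.commute)
  qed
  have "(\<Sum>i<?N. c i * f (t i)) = (\<Sum>i<?N. f (t i) * (poly (?r q) (t i))\<^sup>2 / node_diff t ?N i)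
      - (\<Sum>i<?N. f (t i) * (poly (?r p) (t i))\<^sup>2 / (t i * node_diff t ?N i))"
    using ci by (simp add: sum_subtractf[symmetric])
  then show ?thesis
    using operator_monotone_divided_difference[where t = t and n = n, OF f t deg'(2)]
      operator_monotone_divided_difference_quotient[where t = t and n = n, OF f fpos fle t n deg'(1)] by simp
qed

section \<open>Approximation by mixtures of weighted harmonic means\<close>

lemma slit_plane_eq: "slit_plane = - \<real>\<^sub>\<le>\<^sub>0"
  by (auto simp: slit_plane_def nonpos_Reals_def)

lemma open_slit_plane: "open slit_plane"
  unfolding slit_plane_eq by (rule open_Compl) (rule closed_nonpos_Reals_complex)

lemma of_real_in_slit_plane: "0 < t \<Longrightarrow> complex_of_real t \<in> slit_plane"
  by (auto simp: slit_plane_eq)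

lemma connected_slit_plane: "connected slit_plane"
  unfolding slit_plane_def by (rule starlike_imp_connected) (rule starlike_slotted_complex_plane_left)

definition hmean :: "real \<Rightarrow> complex \<Rightarrow> complex" where
  "hmean x z = z / (of_real x * z + of_real (1 - x))"

lemma hmean_denominator_nonzero:
  assumes "z \<in> slit_plane" "0 \<le> x" "x \<le> 1"
  shows "of_real x * z + of_real (1 - x) \<noteq> 0"
proof
  assume eq: "of_real x * z + of_real (1 - x) = 0"
  then have im: "x * Im z = 0" and re: "x * Re z = - (1 - x)" by (simp_all add: complex_eq_iff)
  have "x \<noteq> 0" using re by auto
  then have "Im z = 0" "Re z \<le> 0" using im re assms(2,3)
    by (auto simp: less_eq_real_def mult_le_0_iff) (smt (verit) mult_pos_pos)
  then show False using assms(1) by (auto simp: slit_plane_eq complex_nonpos_Reals_iff)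
qed

text \<open>Stands for a finitely supported probability measure on \<open>{0..1}\<close>, recorded
  by the mixed function and the mean. A bound that is affine in the parameter sees a measure only
  through its mean.\<close>

inductive mixture :: "(complex \<Rightarrow> complex) \<Rightarrow> real \<Rightarrow> bool" where
  hmean: "0 \<le> x \<Longrightarrow> x \<le> 1 \<Longrightarrow> mixture (hmean x) x"
| convex: "mixture g p \<Longrightarrow> mixture h q \<Longrightarrow> 0 \<le> l \<Longrightarrow> l \<le> 1 \<Longrightarrow>
    mixture (\<lambda>z. of_real l * g z + of_real (1 - l) * h z) (l * p + (1 - l) * q)"

lemma mixture_holomorphic: "mixture g p \<Longrightarrow> g holomorphic_on slit_plane"
proof (induction rule: mixture.induct)
  case (hmean x)
  then show ?case unfolding hmean_def[abs_def] using hmean_denominator_nonzero by (intro holomorphic_intros) auto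
qed (intro holomorphic_intros)

lemma mixture_real:
  assumes "mixture g p" "0 < t"
  shows "\<exists>r. g (of_real t) = of_real r \<and> 0 \<le> r \<and> r \<le> 1 + t"
  using assms
proof (induction rule: mixture.induct)
  case (hmean x)
  have den: "x * t + (1 - x) > 0" using hmean by (cases "x = 0") (auto intro: add_pos_nonneg)
  have "(1 + t) * (x * t + (1 - x)) - t = 1 - x + x * t\<^sup>2" by (simp add: power2_eq_square algebra_simps)
  also have "\<dots> \<ge> 0" using hmean by (intro add_nonneg_nonneg mult_nonneg_nonneg) auto
  finally have "t / (x * t + (1 - x)) \<le> 1 + t" using den by (simp add: divide_le_eq)
  then show ?case using hmean den
    by (intro exI[of _ "t / (x * t + (1 - x))"]) (simp add: hmean_def)
next
  case (convex g p h q l)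
  then obtain r s where "g (of_real t) = of_real r" "0 \<le> r" "r \<le> 1 + t" "h (of_real t) = of_real s" "0 \<le> s" "s \<le> 1 + t" by blast
  note rs = this
  have "l * r + (1 - l) * s \<le> l * (1 + t) + (1 - l) * (1 + t)"
    using rs convex.hyps by (intro add_mono mult_left_mono) auto
  also have "\<dots> = 1 + t" by (simp add: algebra_simps)
  finally have "l * r + (1 - l) * s \<le> 1 + t" .
  moreover have "0 \<le> l * r + (1 - l) * s"
    using rs convex.hyps by (intro add_nonneg_nonneg mult_nonneg_nonneg) auto
  ultimately show ?case using rs
    by (intro exI[of _ "l * r + (1 - l) * s"]) simp
qed

lemma mixture_Re:
  assumes "mixture g p" "0 < t"
  shows "g (of_real t) = of_real (Re (g (of_real t)))" "0 \<le> Re (g (of_real t))" "Re (g (of_real t)) \<le> 1 + t"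
  using mixture_real[OF assms] by auto

text \<open>\<open>hmean x z\<close> is bounded on the compact set \<open>{0..1} \<times> K\<close>,
  and convex combinations do not leave a ball. So the mixtures form a normal family, as Montel's
  theorem requires.\<close>

lemma mixture_bounded:
  assumes K: "compact K" "K \<subseteq> slit_plane"
  shows "\<exists>B. \<forall>g p. mixture g p \<longrightarrow> (\<forall>z\<in>K. norm (g z) \<le> B)"
proof -
  have "continuous_on ({0..1} \<times> K) (\<lambda>(x, z). hmean x z)"
    unfolding hmean_def split_beta using hmean_denominator_nonzero K(2)
    by (intro continuous_intros) auto
  then have "compact ((\<lambda>(x, z). hmean x z) ` ({0..1} \<times> K))"
    using K(1) by (intro compact_continuous_image compact_Times) auto
  then obtain B where B: "\<forall>w\<in>(\<lambda>(x, z). hmean x z) ` ({0..1} \<times> K). norm w \<le> B"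
    using compact_imp_bounded bounded_iff by metis
  have "\<forall>z\<in>K. norm (g z) \<le> B" if "mixture g p" for g p
    using that
  proof (induction rule: mixture.induct)
    case (hmean x)
    then show ?case using B by force
  next
    case (convex g p h q l)
    show ?case
    proof
      fix z assume z: "z \<in> K"
      have "norm (of_real l * g z + of_real (1 - l) * h z) \<le> l * norm (g z) + (1 - l) * norm (h z)"
        using convex.hyps by (intro norm_triangle_le) (simp add: norm_mult del: of_real_diff)
      also have "\<dots> \<le> l * B + (1 - l) * B"
        using convex z by (intro add_mono mult_left_mono) auto
      finally show "norm (of_real l * g z + of_real (1 - l) * h z) \<le> B" by (simp add: algebra_simps)
    qed
  qed
  then show ?thesis by blast
qed

text \<open>Each \<open>hmean x\<close> has slope \<open>1 - x\<close> at \<open>1\<close>, affine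
  in \<open>x\<close>; hence the mean of a mixture can be recovered from the mixed function.\<close>

lemma mixture_deriv_1:
  assumes "mixture g p"
  shows "(g has_field_derivative of_real (1 - p)) (at 1)"
  using assms
proof (induction rule: mixture.induct)
  case (hmean x)
  have "(hmean x has_field_derivative ((1 * (of_real x * 1 + of_real (1 - x)) - 1 * (of_real x * 1 + 0)) /
     ((of_real x * 1 + of_real (1 - x)) * (of_real x * 1 + of_real (1 - x))))) (at 1)"
    unfolding hmean_def[abs_def] by (rule derivative_eq_intros refl | simp)+
  then show ?case by simp
next
  case (convex g p h q l)
  have "((\<lambda>z. of_real l * g z + of_real (1 - l) * h z) has_field_derivative
     of_real l * of_real (1 - p) + of_real (1 - l) * of_real (1 - q)) (at 1)"
    using convex.IH by (intro DERIV_add DERIV_cmult)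
  then show ?case by (simp add: algebra_simps)
qed

lemma hmean_real: "0 < t \<Longrightarrow> hmean x (of_real t) = of_real (t / (x * t + (1 - x)))"
  by (simp add: hmean_def)

text \<open>Separation: a point at positive distance from the convex set of sampled mixtures would be cut off by a
  functional that is non-negative on all the functions \<open>hmean x\<close> but not on \<open>f\<close>.\<close>
lemma mixture_approximation:
  fixes t :: "nat \<Rightarrow> real" and n :: nat
  assumes f: "operator_monotone f" and fpos: "\<And>s. 0 < s \<Longrightarrow> 0 < f s" and fle: "\<And>s. 0 < s \<Longrightarrow> f s \<le> 1 + s"
    and f1: "f 1 = 1"
    and t: "\<And>i j. i < j \<Longrightarrow> j < 2*n \<Longrightarrow> t i < t j" "t 0 = 1" and n: "0 < n" and e: "0 < e"
  shows "\<exists>g p. mixture g p \<and> (\<Sum>i<2*n. (f (t i) - Re (g (of_real (t i))))\<^sup>2) < e"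
proof (rule ccontr)
  let ?N = "2*n"
  let ?d = "\<lambda>g. \<Sum>i<?N. (f (t i) - Re (g (complex_of_real (t i))))\<^sup>2"
  assume "\<not> ?thesis"
  then have far: "e \<le> ?d g" if "mixture g p" for g p using that not_less by blast
  have tpos: "0 < t m" if "m < ?N" for m
    using t(1)[of 0 m] t(2) that by (cases "m = 0") auto
  define D where "D = {?d g | g p. mixture g p}"
  have "mixture (hmean 0) 0" by (rule mixture.hmean) auto
  then have Dne: "D \<noteq> {}" unfolding D_def by blast
  have Dbd: "bdd_below D" unfolding D_def using far by (intro bdd_belowI[of _ e]) auto
  \<comment> \<open>\<open>R\<close> dominates the squared distance on the nodes between
    \<open>g\<close> and any \<open>hmean x\<close>. The infimum need not be attained, so
    \<open>g\<close> minimizes only up to \<open>\<eta>\<close>; the step length \<open>l\<close> is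
    small enough that \<open>\<eta> + l^2 * R \<le> l * e\<close>.\<close>
  define R where "R = (\<Sum>i<?N. (1 + t i)\<^sup>2) + 1"
  have R: "R > 0" unfolding R_def by (simp add: add_nonneg_pos sum_nonneg)
  define l where "l = min 1 (e / (2 * R))"
  have l: "0 < l" "l \<le> 1" "l * R \<le> e / 2" using R e by (auto simp: l_def field_simps min_def)
  define \<eta> where "\<eta> = l * e / 2"
  have \<eta>: "0 < \<eta>" using l e by (simp add: \<eta>_def)
  have "Inf D < Inf D + \<eta>" using \<eta> by simp
  then obtain d where "d \<in> D" "d < Inf D + \<eta>" using cInf_lessD[OF Dne] by blast
  then obtain g p where g: "mixture g p" "?d g < Inf D + \<eta>" unfolding D_def by blast
  define z where "z i = Re (g (complex_of_real (t i)))" for i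
  define c where "c i = f (t i) - z i" for i
  \<comment> \<open>Approximate variational inequality: a step of length \<open>l\<close> from
    \<open>g\<close> towards \<open>hmean x\<close> cannot reduce the squared distance by
    \<open>\<eta>\<close> or more.\<close>
  have key: "(\<Sum>i<?N. c i * (Re (hmean x (of_real (t i))) - z i)) \<le> e / 2" if x: "0 \<le> x" "x \<le> 1" for x
  proof -
    define k where "k i = Re (hmean x (complex_of_real (t i))) - z i" for i
    have mx: "mixture (hmean x) x" using x by (rule mixture.hmean)
    have "\<bar>k i\<bar> \<le> 1 + t i" if "i < ?N" for i
      using mixture_Re[OF mx tpos[OF that]] mixture_Re[OF g(1) tpos[OF that]] by (auto simp: k_def z_def)
    then have "(k i)\<^sup>2 \<le> (1 + t i)\<^sup>2" if "i < ?N" for i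
      using that tpos[OF that] by (intro abs_le_square_iff[THEN iffD1]) auto
    then have "(\<Sum>i<?N. (k i)\<^sup>2) \<le> (\<Sum>i<?N. (1 + t i)\<^sup>2)" by (intro sum_mono) auto
    then have kR: "(\<Sum>i<?N. (k i)\<^sup>2) \<le> R" unfolding R_def by simp
    let ?h = "\<lambda>z. of_real l * hmean x z + of_real (1 - l) * g z"
    have "mixture ?h (l * x + (1 - l) * p)" using mx g(1) l by (intro mixture.convex) auto
    then have "?d ?h \<in> D" unfolding D_def
      by (intro CollectI exI[of _ ?h] exI[of _ "l * x + (1 - l) * p"] conjI refl)
    then have "Inf D \<le> ?d ?h" using Dbd by (rule cInf_lower)
    also have "?d ?h = (\<Sum>i<?N. (c i)\<^sup>2 - 2 * l * (c i * k i) + l\<^sup>2 * (k i)\<^sup>2)"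
    proof (intro sum.cong refl)
      fix i
      have "Re (?h (of_real (t i))) = l * Re (hmean x (of_real (t i))) + (1 - l) * z i"
        by (simp add: z_def del: of_real_diff)
      then have eq: "f (t i) - Re (?h (of_real (t i))) = c i - l * k i" by (simp add: c_def k_def algebra_simps)
      show "(f (t i) - Re (?h (of_real (t i))))\<^sup>2 = (c i)\<^sup>2 - 2 * l * (c i * k i) + l\<^sup>2 * (k i)\<^sup>2"
        unfolding eq by (simp add: power2_eq_square algebra_simps)
    qed
    also have "\<dots> = ?d g - 2 * l * (\<Sum>i<?N. c i * k i) + l\<^sup>2 * (\<Sum>i<?N. (k i)\<^sup>2)"
      by (simp add: sum.distrib sum_subtractf sum_distrib_left c_def z_def)
    finally have "2 * l * (\<Sum>i<?N. c i * k i) \<le> \<eta> + l\<^sup>2 * (\<Sum>i<?N. (k i)\<^sup>2)" using g(2) by linarith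
    also have "\<dots> \<le> \<eta> + l\<^sup>2 * R" using kR by (simp add: mult_left_mono)
    also have "\<dots> = l * (e / 2 + l * R)" by (simp add: \<eta>_def power2_eq_square algebra_simps)
    also have "\<dots> \<le> l * e" using l by (intro mult_left_mono) auto
    finally have "l * (2 * (\<Sum>i<?N. c i * k i)) \<le> l * e" by (simp add: mult_ac)
    then have "2 * (\<Sum>i<?N. c i * k i) \<le> e" using l(1) by simp
    then show ?thesis by (simp add: k_def)
  qed
  \<comment> \<open>The separating functional is affine with constant term \<open>\<gamma>\<close>.
    Since \<open>f\<close> and every \<open>hmean x\<close> take the value \<open>1\<close> at the
    node \<open>t 0 = 1\<close>, the constant becomes an extra coefficient at that node, and the
    functional becomes linear.\<close>
  define \<gamma> where "\<gamma> = (\<Sum>i<?N. c i * z i) + e / 2"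
  define c' where "c' i = (if i = 0 then \<gamma> else 0) - c i" for i
  have sumc': "(\<Sum>i<?N. c' i * h i) = \<gamma> * h 0 - (\<Sum>i<?N. c i * h i)" for h :: "nat \<Rightarrow> real"
  proof -
    have "(\<Sum>i<?N. c' i * h i) = (\<Sum>i<?N. (if i = 0 then \<gamma> * h 0 else 0) - c i * h i)"
      by (intro sum.cong) (auto simp: c'_def algebra_simps)
    then show ?thesis using n by (simp add: sum_subtractf)
  qed
  have "0 \<le> (\<Sum>i<?N. c' i * f (t i))"
  proof (rule operator_monotone_dual_cone[OF f fpos fle t(1) _ n])
    fix s :: real assume s: "0 < s"
    \<comment> \<open>With this \<open>x\<close>, \<open>t / (t + s)\<close> is \<open>x\<close>
      times the value of \<open>hmean x\<close> at \<open>t\<close>, so the kernels of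
      \<open>operator_monotone_dual_cone\<close> are positive multiples of weighted harmonic
      means.\<close>
    define x where "x = 1 / (1 + s)"
    have x: "0 \<le> x" "x \<le> 1" "x \<noteq> 0" "(1 - x) / x = s" using s by (auto simp: x_def field_simps)
    have h: "t i / (t i + s) = x * Re (hmean x (of_real (t i)))" if "i < ?N" for i
    proof -
      have "x * t i + (1 - x) = x * (t i + s)" using x(3,4) by (simp add: field_simps)
      then have "Re (hmean x (of_real (t i))) = t i / (x * (t i + s))" using tpos[OF that] by (simp add: hmean_real)
      then show ?thesis using x(3) by simp
    qed
    have nonneg: "0 \<le> \<gamma> - (\<Sum>i<?N. c i * Re (hmean x (of_real (t i))))"
      using key[OF x(1,2)] by (simp add: \<gamma>_def algebra_simps sum_subtractf)
    have "(\<Sum>i<?N. c' i * (t i / (t i + s))) = x * (\<Sum>i<?N. c' i * Re (hmean x (of_real (t i))))"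
      unfolding sum_distrib_left by (intro sum.cong) (auto simp: h mult_ac)
    also have "(\<Sum>i<?N. c' i * Re (hmean x (of_real (t i)))) = \<gamma> - (\<Sum>i<?N. c i * Re (hmean x (of_real (t i))))"
      unfolding sumc' t(2) by (simp add: hmean_def)
    finally show "0 \<le> (\<Sum>i<?N. c' i * (t i / (t i + s)))" using mult_nonneg_nonneg[OF x(1) nonneg] by simp
  qed (use t(2) in auto)
  also have "\<dots> = \<gamma> - (\<Sum>i<?N. c i * f (t i))" unfolding sumc' t(2) f1 by simp
  also have "(\<Sum>i<?N. c i * f (t i)) = ?d g + (\<Sum>i<?N. c i * z i)"
    unfolding sum.distrib[symmetric] by (intro sum.cong) (auto simp: c_def z_def power2_eq_square algebra_simps)
  finally have "?d g \<le> e / 2" by (simp add: \<gamma>_def)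
  with far[OF g(1)] e show False by simp
qed

text \<open>Convergence of all derivatives is required because \<open>holo_calc\<close> interpolates
  them at multiple eigenvalues; locally uniform convergence supplies it.\<close>

theorem mixture_limit:
  assumes f: "operator_monotone f" and fpos: "\<And>s. 0 < s \<Longrightarrow> 0 < f s" and f1: "f 1 = 1"
    and v: "0 \<le> v" "v \<le> 1" and fle: "\<And>s. 0 < s \<Longrightarrow> f s \<le> v + (1 - v) * s"
    and F: "F holomorphic_on slit_plane" "\<And>s. 0 < s \<Longrightarrow> F (of_real s) = of_real (f s)"
  obtains g p where "\<And>k. mixture (g k) (p k)" "p \<longlonglongrightarrow> v"
    "\<And>z j. z \<in> slit_plane \<Longrightarrow> (\<lambda>k::nat. (deriv ^^ j) (g k) z) \<longlonglongrightarrow> (deriv ^^ j) F z"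
proof -
  have fle': "f s \<le> 1 + s" if "0 < s" for s
  proof -
    have "v + (1 - v) * s \<le> 1 + 1 * s" using v that by (intro add_mono mult_right_mono) auto
    with fle[OF that] show ?thesis by simp
  qed
  \<comment> \<open>The nodes start at \<open>1\<close>, as \<open>mixture_approximation\<close>
    demands, and accumulate at the interior point \<open>2\<close>, so that agreement on them
    determines a holomorphic function on the slit plane.\<close>
  define t where "t i = 2 - 1 / (real i + 1)" for i :: nat
  have t: "t i < t j" if "i < j" for i j using that by (simp add: t_def frac_less2)
  have t0: "t 0 = 1" by (simp add: t_def)
  have tpos: "0 < t i" for i using t[of 0 i] t0 by (cases "i = 0") auto
  have "\<exists>g p. mixture g p \<and> (\<Sum>i<2*Suc k. (f (t i) - Re (g (of_real (t i))))\<^sup>2) < (1 / Suc k)\<^sup>2" for k :: nat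
    by (rule mixture_approximation[OF f fpos fle' f1, where t = t and n = "Suc k"]) (use t t0 in auto)
  then obtain G P where G: "\<And>k. mixture (G k) (P k)"
      "\<And>k. (\<Sum>i<2*Suc k. (f (t i) - Re (G k (of_real (t i))))\<^sup>2) < (1 / Suc k)\<^sup>2" by metis
  have near: "\<bar>f (t i) - Re (G k (of_real (t i)))\<bar> \<le> 1 / Suc k" if "i < k" for i k
  proof -
    have "(f (t i) - Re (G k (of_real (t i))))\<^sup>2 \<le> (\<Sum>i<2*Suc k. (f (t i) - Re (G k (of_real (t i))))\<^sup>2)"
      by (rule member_le_sum) (use that in auto)
    with G(2)[of k] have "(f (t i) - Re (G k (of_real (t i))))\<^sup>2 \<le> (1 / Suc k)\<^sup>2" by linarith
    then show ?thesis by (metis abs_le_square_iff abs_of_nonneg divide_nonneg_nonneg of_nat_0_le_iff zero_le_one)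
  qed
  have lim_t: "(\<lambda>k. G k (of_real (t i))) \<longlonglongrightarrow> F (of_real (t i))" for i
  proof -
    have "(\<lambda>k. f (t i) - Re (G k (of_real (t i)))) \<longlonglongrightarrow> 0"
    proof (rule Lim_null_comparison)
      show "\<forall>\<^sub>F k in sequentially. norm (f (t i) - Re (G k (of_real (t i)))) \<le> 1 / Suc k"
        using eventually_gt_at_top[of i] by eventually_elim (use near in simp)
      show "(\<lambda>k. 1 / real (Suc k)) \<longlonglongrightarrow> 0" by (rule lim_1_over_n[THEN LIMSEQ_Suc])
    qed
    then have "(\<lambda>k. f (t i) - (f (t i) - Re (G k (of_real (t i))))) \<longlonglongrightarrow> f (t i) - 0"
      by (intro tendsto_diff tendsto_const)
    then have "(\<lambda>k. complex_of_real (Re (G k (of_real (t i))))) \<longlonglongrightarrow> of_real (f (t i))"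
      by (intro tendsto_of_real) simp
    then show ?thesis using mixture_Re(1)[OF G(1) tpos] F(2)[OF tpos] by simp
  qed
  obtain H r where H: "H holomorphic_on slit_plane" "strict_mono (r :: nat \<Rightarrow> nat)"
      "\<And>x. x \<in> slit_plane \<Longrightarrow> (\<lambda>n. G (r n) x) \<longlonglongrightarrow> H x"
      "\<And>K. compact K \<Longrightarrow> K \<subseteq> slit_plane \<Longrightarrow> uniform_limit K (G \<circ> r) H sequentially"
  proof (rule Montel[OF open_slit_plane, of "{g. \<exists>p. mixture g p}" G])
    show "\<exists>B. \<forall>h\<in>{g. \<exists>p. mixture g p}. \<forall>z\<in>K. norm (h z) \<le> B" if "compact K" "K \<subseteq> slit_plane" for K
      using mixture_bounded[OF that] by blast
    show "h holomorphic_on slit_plane" if "h \<in> {g. \<exists>p. mixture g p}" for h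
      using that mixture_holomorphic by blast
    show "range G \<subseteq> {g. \<exists>p. mixture g p}" using G(1) by blast
  qed auto
  have HFt: "H (of_real (t i)) = F (of_real (t i))" for i
    using LIMSEQ_unique[OF H(3)[OF of_real_in_slit_plane[OF tpos]]]
      LIMSEQ_subseq_LIMSEQ[OF lim_t[of i] H(2)] by (auto simp: comp_def)
  have HF: "H z = F z" if "z \<in> slit_plane" for z
  proof -
    have "(\<lambda>z. H z - F z) holomorphic_on slit_plane" using H(1) F(1) by (intro holomorphic_intros)
    moreover have "2 islimpt range (\<lambda>i. complex_of_real (t i))"
      unfolding islimpt_sequential
    proof (intro exI[of _ "\<lambda>i. complex_of_real (t i)"] conjI allI)
      fix i
      have "t i \<noteq> 2" by (simp add: t_def)
      then show "complex_of_real (t i) \<in> range (\<lambda>i. complex_of_real (t i)) - {2}"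
        by (metis DiffI of_real_eq_iff of_real_numeral rangeI singletonD)
      have "t \<longlonglongrightarrow> 2" unfolding t_def by real_asymp
      then show "(\<lambda>i. complex_of_real (t i)) \<longlonglongrightarrow> 2" using tendsto_of_real[of t 2] by simp
    qed
    moreover have "2 \<in> slit_plane" using of_real_in_slit_plane[of 2] by simp
    ultimately have "(\<lambda>z. H z - F z) z = 0"
      using analytic_continuation[OF _ open_slit_plane connected_slit_plane, of "\<lambda>z. H z - F z" "range (\<lambda>i. complex_of_real (t i))" 2 z]
        of_real_in_slit_plane[OF tpos] HFt that by auto
    then show ?thesis by simp
  qed
  have lim: "(\<lambda>k. (deriv ^^ j) (G (r k)) z) \<longlonglongrightarrow> (deriv ^^ j) F z" if z: "z \<in> slit_plane" for z j
  proof -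
    obtain \<delta> where \<delta>: "0 < \<delta>" "cball z \<delta> \<subseteq> slit_plane"
      using open_slit_plane z open_contains_cball by blast
    have ul: "uniform_limit (ball z \<delta>) (\<lambda>k. G (r k)) H sequentially"
      using uniform_limit_on_subset[OF H(4)[OF compact_cball \<delta>(2)] ball_subset_cball] by (simp add: comp_def)
    have "(\<lambda>k. (deriv ^^ j) (G (r k)) z) \<longlonglongrightarrow> (deriv ^^ j) H z"
    proof (rule higher_deriv_complex_uniform_limit[OF ul])
      show "\<forall>\<^sub>F n in sequentially. G (r n) holomorphic_on ball z \<delta>"
        by (intro always_eventually allI holomorphic_on_subset[OF mixture_holomorphic[OF G(1)]])
          (use \<delta>(2) ball_subset_cball[of z \<delta>] in blast)
    qed (use \<delta> in auto)
    also have "(deriv ^^ j) H z = (deriv ^^ j) F z"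
      by (rule higher_deriv_transform_within_open[OF H(1) F(1) open_slit_plane z HF])
    finally show ?thesis .
  qed
  have one: "1 \<in> slit_plane" using of_real_in_slit_plane[of 1] by simp
  have "deriv (G k) 1 = of_real (1 - P k)" for k
    by (rule DERIV_imp_deriv[OF mixture_deriv_1[OF G(1)]])
  then have "(\<lambda>k. complex_of_real (1 - P (r k))) \<longlonglongrightarrow> deriv F 1" using lim[OF one, of 1] by simp
  from tendsto_Re[OF this] have P1: "(\<lambda>k. 1 - P (r k)) \<longlonglongrightarrow> Re (deriv F 1)" by simp
  \<comment> \<open>The gap between the line \<open>v + (1 - v) * s\<close> and \<open>f\<close> is
    non-negative and zero at \<open>1\<close>, so its derivative vanishes there.\<close>
  have "Re (deriv F 1) = 1 - v"
  proof -
    have "(F has_field_derivative deriv F 1) (at 1)"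
      using F(1) open_slit_plane one holomorphic_derivI by blast
    then have "((\<lambda>s. F (of_real s)) has_vector_derivative deriv F 1) (at 1)"
      using has_vector_derivative_real_field[of F "deriv F 1" 1 UNIV] by simp
    then have "((\<lambda>s. Re (F (of_real s))) has_real_derivative Re (deriv F 1)) (at 1)"
      using bounded_linear.has_vector_derivative[OF bounded_linear_Re] has_real_derivative_iff_has_vector_derivative by blast
    moreover have "((\<lambda>s. v + (1 - v) * s) has_real_derivative 1 - v) (at 1)"
      by (auto intro!: derivative_eq_intros)
    ultimately have d: "((\<lambda>s. v + (1 - v) * s - Re (F (of_real s))) has_real_derivative ((1 - v) - Re (deriv F 1))) (at 1)"
      by (intro DERIV_diff)
    have "(1 - v) - Re (deriv F 1) = 0"
    proof (rule DERIV_local_min[OF d])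
      show "\<forall>s. \<bar>1 - s\<bar> < 1 \<longrightarrow> v + (1 - v) * 1 - Re (F (of_real 1)) \<le> v + (1 - v) * s - Re (F (of_real s))"
      proof (intro allI impI)
        fix s :: real assume "\<bar>1 - s\<bar> < 1"
        then have s: "0 < s" by linarith
        have "F 1 = 1" using F(2)[of 1] f1 by simp
        then show "v + (1 - v) * 1 - Re (F (of_real 1)) \<le> v + (1 - v) * s - Re (F (of_real s))"
          using fle[OF s] F(2)[OF s] by simp
      qed
    qed simp
    then show ?thesis by simp
  qed
  moreover have "(\<lambda>k. 1 - (1 - P (r k))) \<longlonglongrightarrow> 1 - Re (deriv F 1)" by (intro tendsto_diff tendsto_const P1)
  ultimately have "(\<lambda>k. P (r k)) \<longlonglongrightarrow> v" by simp
  from that[OF G(1) this lim] show ?thesis .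
qed

section \<open>Norm inequalities and powers of positive matrices\<close>

lemma spec_add:
  assumes U: "unitary n U"
  shows "spec n U (\<lambda>i. d i + e i) = spec n U d + spec n U e"
proof -
  interpret sq_mat n .
  have "dg n (\<lambda>i. d i + e i) = dg n d + dg n e" by (auto simp: dg_def intro!: eq_matI)
  then show ?thesis unfolding spec_def using unitaryD[OF U] by (simp add: sq_distrib)
qed

lemma spec_smult:
  assumes U: "unitary n U"
  shows "spec n U (\<lambda>i. c * d i) = c \<cdot>\<^sub>m spec n U d"
proof -
  interpret sq_mat n .
  have "dg n (\<lambda>i. c * d i) = c \<cdot>\<^sub>m dg n d" by (auto simp: dg_def intro!: eq_matI)
  then show ?thesis unfolding spec_def using unitaryD[OF U] by simp
qed

lemma spec_inverse:
  assumes U: "unitary n U" and d: "\<And>i. i < n \<Longrightarrow> d i * e i = 1" and x: "x \<in> carrier_vec n"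
  shows "spec n U d *\<^sub>v (spec n U e *\<^sub>v x) = x"
proof -
  interpret sq_mat n .
  have "spec n U d * spec n U e = spec n U (\<lambda>_. 1)" unfolding spec_mult[OF U] using d by (intro spec_cong) auto
  also have "\<dots> = 1\<^sub>m n" by (simp add: spec_const[OF U])  (auto intro!: eq_matI)
  finally have "spec n U d * spec n U e *\<^sub>v x = x" using x by simp
  then show ?thesis using U x by simp
qed

lemma mult_mat_zero_vec: "(A :: complex mat) \<in> carrier_mat n n \<Longrightarrow> A *\<^sub>v 0\<^sub>v n = 0\<^sub>v n"
  by (intro eq_vecI) auto

lemma unitary_cancel_vec:
  assumes U: "unitary n U" and x: "x \<in> carrier_vec n"
  shows "mat_adjoint U *\<^sub>v (U *\<^sub>v x) = x"
proof -
  interpret sq_mat n .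
  note u = unitaryD[OF U]
  have "mat_adjoint U *\<^sub>v (U *\<^sub>v x) = mat_adjoint U * U *\<^sub>v x"
    by (rule sq_assoc(2)[symmetric]) (use u x in auto)
  also have "\<dots> = x" unfolding u(3) using x by simp
  finally show ?thesis .
qed

lemma ip_hermitian:
  assumes "X \<in> carrier_mat n n" "hermitian_mat X" "x \<in> carrier_vec n" "y \<in> carrier_vec n"
  shows "ip (X *\<^sub>v x) y = ip x (X *\<^sub>v y)"
  using ip_adjoint[OF assms(1,3,4)] assms(1,2) by (simp add: hermitian_matD)

lemma Re_ip_sym: "x \<in> carrier_vec n \<Longrightarrow> y \<in> carrier_vec n \<Longrightarrow> Re (ip x y) = Re (ip y x)"
  using ip_sym[of x y] by simp

lemma quadratic_expand:
  assumes X: "X \<in> carrier_mat n n" "hermitian_mat X" and x: "x \<in> carrier_vec n" and z: "z \<in> carrier_vec n"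
  shows "rform X (x + complex_of_real c \<cdot>\<^sub>v z)
    = rform X x + 2 * c * Re (ip (X *\<^sub>v x) z) + c\<^sup>2 * rform X z"
proof -
  interpret sq_mat n .
  have "Re (ip (X *\<^sub>v z) x) = Re (ip (X *\<^sub>v x) z)"
    using ip_hermitian[OF X z x] Re_ip_sym[of z n "X *\<^sub>v x"] X x z by simp
  then show ?thesis using X x z by (simp add: sq_distrib ip_sq power2_eq_square algebra_simps)
qed

lemma spec_eigenvector:
  assumes U: "unitary n U" and i: "i < n"
  obtains y where "y \<in> carrier_vec n" "y \<noteq> 0\<^sub>v n" "\<And>d. spec n U d *\<^sub>v y = d i \<cdot>\<^sub>v y"
proof -
  interpret sq_mat n .
  note u = unitaryD[OF U]
  let ?e = "unit_vec n i :: complex vec"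
  have cancel: "mat_adjoint U *\<^sub>v (U *\<^sub>v ?e) = ?e" by (rule unitary_cancel_vec[OF U]) simp
  show ?thesis
  proof (rule that[of "U *\<^sub>v ?e"])
    show "U *\<^sub>v ?e \<noteq> 0\<^sub>v n"
    proof
      assume "U *\<^sub>v ?e = 0\<^sub>v n"
      then have "?e = 0\<^sub>v n" using cancel mult_mat_zero_vec[OF u(2)] by simp
      then have "?e $ i = 0" using i by simp
      then show False using i by simp
    qed
    fix d
    have "dg n d *\<^sub>v ?e = d i \<cdot>\<^sub>v ?e"
    proof (rule eq_vecI)
      fix j assume "j < dim_vec (d i \<cdot>\<^sub>v ?e)"
      then have j: "j < n" by simp
      then show "(dg n d *\<^sub>v ?e) $ j = (d i \<cdot>\<^sub>v ?e) $ j"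
        using i scalar_prod_right_unit[OF i, of "row (dg n d) j"] by (simp add: dg_def)
    qed (simp add: dg_def)
    then show "spec n U d *\<^sub>v (U *\<^sub>v ?e) = d i \<cdot>\<^sub>v (U *\<^sub>v ?e)"
      unfolding spec_def using u by (simp add: cancel)
  qed (use u in simp)
qed

text \<open>Reduces a form inequality to eigenvectors. For products of positive matrices the
  equation \<open>T y = l y\<close> is easier to transform than the form itself.\<close>

lemma hermitian_form_le_eigenvalue_bound:
  assumes T: "T \<in> carrier_mat n n" "hermitian_mat T"
    and ev: "\<And>l y. y \<in> carrier_vec n \<Longrightarrow> y \<noteq> 0\<^sub>v n \<Longrightarrow> T *\<^sub>v y = complex_of_real l \<cdot>\<^sub>v y \<Longrightarrow> l \<le> k"
    and x: "x \<in> carrier_vec n"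
  shows "rform T x \<le> k * Re (ip x x)"
proof -
  obtain U d where U: "unitary n U" and Td: "T = rspec n U d"
    using hermitian_spectral[OF T] .
  have "d i \<le> k" if "i < n" for i
    using spec_eigenvector[OF U that] ev unfolding Td by metis
  then show ?thesis
    unfolding Td qform_spec[OF U x] norm_unitary[OF U x] sum_distrib_left
    by (intro sum_mono mult_right_mono) auto
qed

section \<open>Norm of a product of two positive matrices\<close>

locale psd_pair = sq_mat n for n +
  fixes A B :: "complex mat" and N :: real
  assumes A: "A \<in> carrier_mat n n" "hermitian_mat A" "\<And>x. x \<in> carrier_vec n \<Longrightarrow> 0 \<le> rform A x"
    and B: "B \<in> carrier_mat n n" "hermitian_mat B" "\<And>x. x \<in> carrier_vec n \<Longrightarrow> 0 \<le> rform B x"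
    and N: "0 < N" "\<And>x. x \<in> carrier_vec n \<Longrightarrow> rform A x + rform B x \<le> N * Re (ip x x)"
begin

text \<open>\<open>A + B \<le> N\<close> says that the row \<open>(A^(1/2), B^(1/2))\<close> has
  squared norm at most \<open>N\<close>. Square roots are avoided by expanding the non-negative
  forms of \<open>A\<close> at \<open>x - z / N\<close> and of \<open>B\<close> at
  \<open>y - z / N\<close>, where \<open>z = A x + B y\<close>.\<close>

lemma norm_bound:
  assumes x: "x \<in> carrier_vec n" and y: "y \<in> carrier_vec n"
  shows "Re (ip (A *\<^sub>v x + B *\<^sub>v y) (A *\<^sub>v x + B *\<^sub>v y)) \<le> N * (rform A x + rform B y)"
proof -
  define z where "z = A *\<^sub>v x + B *\<^sub>v y"
  have z: "z \<in> carrier_vec n" using A B x y by (simp add: z_def)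
  have agm: "2 * Re (ip (X *\<^sub>v w) z) \<le> N * rform X w + rform X z / N"
    if X: "X \<in> carrier_mat n n" "hermitian_mat X" "\<And>x. x \<in> carrier_vec n \<Longrightarrow> 0 \<le> rform X x"
      and w: "w \<in> carrier_vec n" for X w
  proof -
    have "0 \<le> rform X w + 2 * (- 1 / N) * Re (ip (X *\<^sub>v w) z) + (- 1 / N)\<^sup>2 * rform X z"
      unfolding quadratic_expand[OF X(1,2) w z, symmetric] using X w z by simp
    then have "0 \<le> N * (rform X w + 2 * (- 1 / N) * Re (ip (X *\<^sub>v w) z) + (- 1 / N)\<^sup>2 * rform X z)"
      using N(1) by simp
    also have "\<dots> = N * rform X w - 2 * Re (ip (X *\<^sub>v w) z) + rform X z / N"
      using N(1) by (simp add: field_simps power2_eq_square)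
    finally show ?thesis by simp
  qed
  have "2 * Re (ip z z) = 2 * Re (ip (A *\<^sub>v x) z) + 2 * Re (ip (B *\<^sub>v y) z)"
    using A B x y z by (subst (1) z_def) (simp add: ip_sq)
  also have "\<dots> \<le> N * (rform A x + rform B y) + (rform A z + rform B z) / N"
    using agm[OF A x] agm[OF B y] by (simp add: distrib_left add_divide_distrib)
  also have "(rform A z + rform B z) / N \<le> Re (ip z z)"
    using N(2)[OF z] N(1) by (simp add: divide_le_eq mult.commute)
  finally show ?thesis unfolding z_def by simp
qed

text \<open>Compare the form of \<open>A + B\<close> at \<open>B y + A x\<close> and at \<open>B y - A x\<close>.\<close>
lemma singular_value_bound:
  assumes x: "x \<in> carrier_vec n" and y: "y \<in> carrier_vec n" "y \<noteq> 0\<^sub>v n"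
    and s: "0 < s" "A *\<^sub>v (B *\<^sub>v y) = complex_of_real s \<cdot>\<^sub>v x" "B *\<^sub>v (A *\<^sub>v x) = complex_of_real s \<cdot>\<^sub>v y"
  shows "s \<le> N\<^sup>2 / 4"
proof -
  define u w where "u = A *\<^sub>v x" and "w = B *\<^sub>v y"
  define \<alpha> \<beta> where "\<alpha> = rform A x" and "\<beta> = rform B y"
  have uw: "u \<in> carrier_vec n" "w \<in> carrier_vec n" using A B x y by (auto simp: u_def w_def)
  have z0: "B *\<^sub>v 0\<^sub>v n = 0\<^sub>v n" by (rule mult_mat_zero_vec[OF B(1)])
  have "\<alpha> > 0"
  proof (rule ccontr)
    assume "\<not> \<alpha> > 0"
    then have "\<alpha> \<le> 0" by simp
    have "Re (ip u u) \<le> N * \<alpha>"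
    proof -
      have "A *\<^sub>v x + B *\<^sub>v 0\<^sub>v n = u" using uw by (simp add: z0 u_def)
      moreover have "ip (B *\<^sub>v 0\<^sub>v n) (0\<^sub>v n) = 0" by (simp add: z0 ip_def)
      ultimately show ?thesis using norm_bound[OF x, of "0\<^sub>v n"] by (simp add: \<alpha>_def)
    qed
    also have "\<dots> \<le> 0" using N(1) \<open>\<alpha> \<le> 0\<close> by (simp add: mult_nonneg_nonpos)
    finally have "Re (ip u u) = 0" using ip_self_ge0(1)[of u] by linarith
    then have "u = 0\<^sub>v n" using ip_self_eq_0_iff[OF uw(1)] by simp
    then have sy: "complex_of_real s \<cdot>\<^sub>v y = 0\<^sub>v n" using s(3) z0 by (simp add: u_def)
    have "y = 0\<^sub>v n"
    proof (rule eq_vecI)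
      fix i assume "i < dim_vec (0\<^sub>v n :: complex vec)"
      then have "(complex_of_real s \<cdot>\<^sub>v y) $ i = 0" "i < n" using sy by simp_all
      then show "y $ i = 0\<^sub>v n $ i" using s(1) y by simp
    qed (use y in simp)
    with y show False by simp
  qed
  moreover have "\<beta> \<ge> 0" unfolding \<beta>_def using B(3) y by simp
  ultimately have pos: "\<alpha> + \<beta> > 0" by simp
  have Aw: "Re (ip (A *\<^sub>v w) u) = s * \<alpha>"
    using x uw s(2) Re_ip_sym[of x n u] by (simp add: w_def[symmetric] ip_sq \<alpha>_def u_def[symmetric])
  have Bw: "Re (ip (B *\<^sub>v w) u) = s * \<beta>"
    using ip_hermitian[OF B(1,2) uw(2,1)] s(3) y uw by (simp add: u_def[symmetric] ip_sq \<beta>_def w_def[symmetric])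
  have wu: "Re (ip (w + complex_of_real (1) \<cdot>\<^sub>v u) (w + complex_of_real (1) \<cdot>\<^sub>v u)) \<le> N * (\<alpha> + \<beta>)"
  proof -
    have "w + complex_of_real (1) \<cdot>\<^sub>v u = u + w" using uw by (intro eq_vecI) auto
    then show ?thesis using norm_bound[OF x y(1)] by (simp add: u_def w_def \<alpha>_def \<beta>_def)
  qed
  let ?z = "w + complex_of_real 1 \<cdot>\<^sub>v u" and ?z' = "w + complex_of_real (- 1) \<cdot>\<^sub>v u"
  have zc: "?z \<in> carrier_vec n" "?z' \<in> carrier_vec n" using uw by auto
  \<comment> \<open>The difference of the two forms is four times the cross term, which the singular
    vector equations evaluate to \<open>s * (\<alpha> + \<beta>)\<close>.\<close>
  have "4 * (s * (\<alpha> + \<beta>)) = (rform A ?z + rform B ?z) - (rform A ?z' + rform B ?z')"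
    unfolding quadratic_expand[OF A(1,2) uw(2,1)] quadratic_expand[OF B(1,2) uw(2,1)] Aw Bw by (simp add: algebra_simps)
  also have "\<dots> \<le> rform A ?z + rform B ?z"
    using A(3)[OF zc(2)] B(3)[OF zc(2)] by linarith
  also have "\<dots> \<le> N * Re (ip ?z ?z)" by (rule N(2)[OF zc(1)])
  also have "\<dots> \<le> N * (N * (\<alpha> + \<beta>))" using wu N(1) by (intro mult_left_mono) auto
  finally have "4 * s * (\<alpha> + \<beta>) \<le> N\<^sup>2 * (\<alpha> + \<beta>)" by (simp add: power2_eq_square mult.assoc)
  then show ?thesis using pos by simp
qed

text \<open>A positive eigenvalue of \<open>(A B)* (A B) = B A A B\<close> is the square of a
  singular value \<open>s\<close> of \<open>A B\<close>. With the singular vectors \<open>y\<close>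
  and \<open>x = A B y / s\<close>, \<open>singular_value_bound\<close> applies.\<close>

lemma product_norm:
  assumes y: "y \<in> carrier_vec n"
  shows "Re (ip (A *\<^sub>v (B *\<^sub>v y)) (A *\<^sub>v (B *\<^sub>v y))) \<le> (N\<^sup>2 / 4)\<^sup>2 * Re (ip y y)"
proof -
  note [simp] = hermitian_matD[OF A(2,1)] hermitian_matD[OF B(2,1)]
  let ?T = "B * (A * (A * B))"
  have T: "?T \<in> carrier_mat n n" "hermitian_mat ?T"
    using A(1) B(1) by (auto simp: hermitian_mat_iff[of _ n])
  have "rform ?T y \<le> (N\<^sup>2 / 4)\<^sup>2 * Re (ip y y)"
  proof (rule hermitian_form_le_eigenvalue_bound[OF T _ y])
    fix l :: real and y :: "complex vec" assume y: "y \<in> carrier_vec n" "y \<noteq> 0\<^sub>v n" and l: "?T *\<^sub>v y = complex_of_real l \<cdot>\<^sub>v y"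
    show "l \<le> (N\<^sup>2 / 4)\<^sup>2"
    proof (cases "l > 0")
      case True
      define s x where "s = sqrt l" and "x = complex_of_real (1 / s) \<cdot>\<^sub>v (A *\<^sub>v (B *\<^sub>v y))"
      have s: "s > 0" "s * s = l" using True by (auto simp: s_def)
      have x: "x \<in> carrier_vec n" using A(1) B(1) y by (simp add: x_def)
      have 1: "A *\<^sub>v (B *\<^sub>v y) = complex_of_real s \<cdot>\<^sub>v x"
        using s(1) A(1) B(1) y by (simp add: x_def smult_smult_assoc)
      have "B *\<^sub>v (A *\<^sub>v x) = complex_of_real (1 / s) \<cdot>\<^sub>v (?T *\<^sub>v y)"
        using A(1) B(1) y by (simp add: x_def)
      also have "\<dots> = complex_of_real (1 / s * l) \<cdot>\<^sub>v y" unfolding l by (simp add: smult_smult_assoc)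
      also have "1 / s * l = s" using s by (simp add: s(2)[symmetric])
      finally have 2: "B *\<^sub>v (A *\<^sub>v x) = complex_of_real s \<cdot>\<^sub>v y" .
      from singular_value_bound[OF x y s(1) 1 2] have "s \<le> N\<^sup>2 / 4" .
      then have "s\<^sup>2 \<le> (N\<^sup>2 / 4)\<^sup>2" using s(1) by (intro power_mono) auto
      then show ?thesis using s(2) by (simp add: power2_eq_square)
    next
      case False
      then show ?thesis by (meson not_le order_trans zero_le_power2 less_imp_le)
    qed
  qed
  moreover have "ip (?T *\<^sub>v y) y = ip (A *\<^sub>v (B *\<^sub>v y)) (A *\<^sub>v (B *\<^sub>v y))"
    using A B y ip_hermitian[OF B(1,2), of "A *\<^sub>v (A *\<^sub>v (B *\<^sub>v y))" y] ip_hermitian[OF A(1,2), of "A *\<^sub>v (B *\<^sub>v y)" "B *\<^sub>v y"]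
    by simp
  ultimately show ?thesis by simp
qed

end

section \<open>Real powers of positive matrices\<close>

abbreviation rpow :: "nat \<Rightarrow> complex mat \<Rightarrow> (nat \<Rightarrow> real) \<Rightarrow> real \<Rightarrow> complex mat" where
  "rpow n U d r \<equiv> spec n U (\<lambda>i. complex_of_real (d i powr r))"

lemma rpow_add:
  assumes "unitary n U" "x \<in> carrier_vec n" 
  shows "rpow n U d r *\<^sub>v (rpow n U d s *\<^sub>v x) = rpow n U d (r + s) *\<^sub>v x"
proof -
  interpret sq_mat n .
  have "rpow n U d r * rpow n U d s = rpow n U d (r + s)"
    by (simp add: spec_mult[OF assms(1)] powr_add)
  then show ?thesis using assms sq_assoc(2)[of "rpow n U d r" "rpow n U d s" x] by simp
qed

text \<open>Positivity matters because \<open>0 powr 0 = 0\<close>. The second equation covers the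
  shape into which simplification brings \<open>d i powr 0\<close>.\<close>

lemma rpow_0:
  assumes "unitary n U" "\<And>i. i < n \<Longrightarrow> 0 < d i" "x \<in> carrier_vec n"
  shows "rpow n U d 0 *\<^sub>v x = x"
    and "spec n U (\<lambda>i. complex_of_real (if d i = 0 then 0 else 1)) *\<^sub>v x = x"
proof -
  have "d i \<noteq> 0" if "i < n" for i using assms(2)[OF that] by simp
  then have "rpow n U d 0 = spec n U (\<lambda>_. 1)" by (intro spec_cong) simp
  also have "\<dots> = 1\<^sub>m n" by (simp add: spec_const[OF assms(1)]) (auto intro!: eq_matI)
  finally have eq: "rpow n U d 0 = 1\<^sub>m n" .
  then show "rpow n U d 0 *\<^sub>v x = x" using assms(3) by simp
  then show "spec n U (\<lambda>i. complex_of_real (if d i = 0 then 0 else 1)) *\<^sub>v x = x" by simp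
qed

lemma rpow_norm:
  assumes "unitary n U" "x \<in> carrier_vec n"
  shows "Re (ip (rpow n U d r *\<^sub>v x) (rpow n U d r *\<^sub>v x)) = rform (rpow n U d (2 * r)) x"
proof -
  interpret sq_mat n .
  have "ip (rpow n U d r *\<^sub>v x) (rpow n U d r *\<^sub>v x) = ip (rpow n U d r *\<^sub>v (rpow n U d r *\<^sub>v x)) x"
    by (rule ip_hermitian[where n = n, symmetric]) (use assms hermitian_spec[OF assms(1)] in auto)
  then show ?thesis by (simp add: rpow_add[OF assms])
qed

lemma eigenvalue_le_of_form:
  assumes U: "unitary n U" and i: "i < n"
    and k: "\<And>x. x \<in> carrier_vec n \<Longrightarrow> rform (rspec n U d) x \<le> k * Re (ip x x)"
  shows "d i \<le> k"
proof -
  obtain y where y: "y \<in> carrier_vec n" "y \<noteq> 0\<^sub>v n" "\<And>d. spec n U d *\<^sub>v y = d i \<cdot>\<^sub>v y"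
    using spec_eigenvector[OF U i] by blast
  from k[OF y(1)] have "d i * Re (ip y y) \<le> k * Re (ip y y)"
    unfolding y(3) using y(1) by (simp add: ip_smult_left[of _ n])
  then show ?thesis using ip_self_pos[OF y(1,2)] by simp
qed

locale rpow_pair = sq_mat n for n +
  fixes U V :: "complex mat" and d e :: "nat \<Rightarrow> real"
  assumes U: "unitary n U" "\<And>i. i < n \<Longrightarrow> 0 < d i" and V: "unitary n V" "\<And>i. i < n \<Longrightarrow> 0 < e i"
begin

text \<open>The hypotheses say that \<open>P^s Q^(-s)\<close> and \<open>P^t Q^(-t)\<close> are
  contractions, hence so is \<open>Q^(-s) P^(s+t) Q^(-t)\<close>. That matrix is similar to the
  Hermitian \<open>Q^(-h) P^(s+t) Q^(-h)\<close> with \<open>h = (s + t) / 2\<close>, whose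
  eigenvalues are therefore at most one.\<close>

lemma rpow_midpoint:
  assumes s: "\<And>x. x \<in> carrier_vec n \<Longrightarrow> rform (rpow n U d (2 * s)) x \<le> rform (rpow n V e (2 * s)) x"
    and t: "\<And>x. x \<in> carrier_vec n \<Longrightarrow> rform (rpow n U d (2 * t)) x \<le> rform (rpow n V e (2 * t)) x"
    and x: "x \<in> carrier_vec n"
  shows "rform (rpow n U d (s + t)) x \<le> rform (rpow n V e (s + t)) x"
proof -
  let ?P = "rpow n U d" and ?Q = "rpow n V e" and ?c = "s + t"
  have c [simp]: "?P r \<in> carrier_mat n n" "?Q r \<in> carrier_mat n n" for r using U V by auto
  define h where "h = (s + t) / 2"
  have hh [simp]: "h + h = s + t" "2 * h = s + t" by (simp_all add: h_def)
  have herm: "hermitian_mat (?P r)" "hermitian_mat (?Q r)" for r using hermitian_spec U V by auto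
  note add = rpow_add[OF U(1)] rpow_add[OF V(1)]
  let ?T = "?Q (- h) * (?P ?c * ?Q (- h))"
  have T: "?T \<in> carrier_mat n n" "hermitian_mat ?T"
    by (auto simp: hermitian_mat_iff[of _ n] hermitian_matD[OF herm(1) c(1)] hermitian_matD[OF herm(2) c(2)])
  define z where "z = ?Q h *\<^sub>v x"
  have z: "z \<in> carrier_vec n" using x by (simp add: z_def)
  have "rform ?T z \<le> 1 * Re (ip z z)"
  proof (rule hermitian_form_le_eigenvalue_bound[OF T _ z])
    fix l :: real and y :: "complex vec" assume y: "y \<in> carrier_vec n" "y \<noteq> 0\<^sub>v n" and l: "?T *\<^sub>v y = complex_of_real l \<cdot>\<^sub>v y"
    define w where "w = ?Q (- h) *\<^sub>v y"
    have w: "w \<in> carrier_vec n" using y by (simp add: w_def)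
    \<comment> \<open>The eigenvector of the similar matrix \<open>Q^(-s) P^(s+t) Q^(-t)\<close>
      that corresponds to \<open>y\<close>.\<close>
    define y' where "y' = ?Q t *\<^sub>v w"
    have y': "y' \<in> carrier_vec n" using w by (simp add: y'_def)
    have "?P ?c *\<^sub>v w = ?Q h *\<^sub>v (?Q (- h) *\<^sub>v (?P ?c *\<^sub>v w))"
      using w by (simp add: add rpow_0[OF V])
    also have "?Q (- h) *\<^sub>v (?P ?c *\<^sub>v w) = complex_of_real l \<cdot>\<^sub>v y"
      using l y by (simp add: w_def)
    also have "y = ?Q h *\<^sub>v w" using y by (simp add: w_def add rpow_0[OF V])
    finally have Pw: "?P ?c *\<^sub>v w = complex_of_real l \<cdot>\<^sub>v (?Q ?c *\<^sub>v w)" using w by (simp add: add)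
    have "l * Re (ip y' y') = Re (ip (?P t *\<^sub>v w) (?P s *\<^sub>v (?Q (- s) *\<^sub>v y')))"
    proof -
      have "complex_of_real l \<cdot>\<^sub>v y' = ?Q (- s) *\<^sub>v (?P s *\<^sub>v (?P t *\<^sub>v w))"
      proof -
        have "?Q (- s) *\<^sub>v (?P s *\<^sub>v (?P t *\<^sub>v w)) = ?Q (- s) *\<^sub>v (complex_of_real l \<cdot>\<^sub>v (?Q ?c *\<^sub>v w))"
          using w by (simp add: add Pw)
        then show ?thesis using w by (simp add: add y'_def)
      qed
      then have "complex_of_real l * ip y' y' = ip (?Q (- s) *\<^sub>v (?P s *\<^sub>v (?P t *\<^sub>v w))) y'"
        using y' by (metis ip_smult_left)
      also have "\<dots> = ip (?P s *\<^sub>v (?P t *\<^sub>v w)) (?Q (- s) *\<^sub>v y')"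
        by (rule ip_hermitian[where n = n]) (use herm w y' in auto)
      also have "\<dots> = ip (?P t *\<^sub>v w) (?P s *\<^sub>v (?Q (- s) *\<^sub>v y'))"
        by (rule ip_hermitian[where n = n]) (use herm w y' in auto)
      finally show ?thesis by (metis Re_complex_of_real times_complex.simps(1) Im_complex_of_real mult_zero_left diff_zero)
    qed
    also have "\<dots> \<le> Re (ip y' y')"
    proof -
      let ?a = "?P t *\<^sub>v w" and ?b = "?P s *\<^sub>v (?Q (- s) *\<^sub>v y')"
      have ab: "?a \<in> carrier_vec n" "?b \<in> carrier_vec n" using w y' by auto
      have "0 \<le> Re (ip (?a - ?b) (?a - ?b))" by simp
      also have "\<dots> = Re (ip ?a ?a) + Re (ip ?b ?b) - 2 * Re (ip ?a ?b)"
        using ab Re_ip_sym[OF ab] by (simp add: ip_sq)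
      finally have "2 * Re (ip ?a ?b) \<le> Re (ip ?a ?a) + Re (ip ?b ?b)" by simp
      also have "Re (ip ?a ?a) \<le> Re (ip y' y')"
        unfolding y'_def using t[OF w] by (simp add: rpow_norm[OF U(1) w] rpow_norm[OF V(1) w])
      also have "Re (ip ?b ?b) \<le> Re (ip y' y')"
      proof -
        let ?q = "?Q (- s) *\<^sub>v y'"
        have q: "?q \<in> carrier_vec n" using y' by simp
        have "Re (ip ?b ?b) \<le> Re (ip (?Q s *\<^sub>v ?q) (?Q s *\<^sub>v ?q))"
          using s[OF q] by (simp only: rpow_norm[OF U(1) q] rpow_norm[OF V(1) q])
        also have "?Q s *\<^sub>v ?q = y'" using y' by (simp add: add rpow_0[OF V])
        finally show ?thesis .
      qed
      finally show ?thesis by simp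
    qed
    finally have "l * Re (ip y' y') \<le> 1 * Re (ip y' y')" by simp
    moreover have "y' \<noteq> 0\<^sub>v n"
    proof
      assume 0: "y' = 0\<^sub>v n"
      have "y = ?Q (h - t) *\<^sub>v y'" using y w by (simp add: y'_def add w_def rpow_0[OF V])
      also have "\<dots> = 0\<^sub>v n" unfolding 0 by (rule mult_mat_zero_vec[OF c(2)])
      finally show False using y by simp
    qed
    ultimately show "l \<le> 1" using ip_self_pos[OF y'] by (simp add: mult_le_cancel_right)
  qed
  moreover have "rform ?T z = rform (?P ?c) x"
  proof -
    have Qz: "?Q (- h) *\<^sub>v z = x" using x by (simp add: z_def add rpow_0[OF V])
    have "ip (?T *\<^sub>v z) z = ip (?Q (- h) *\<^sub>v (?P ?c *\<^sub>v (?Q (- h) *\<^sub>v z))) z" using z by simp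
    also have "\<dots> = ip (?P ?c *\<^sub>v (?Q (- h) *\<^sub>v z)) (?Q (- h) *\<^sub>v z)"
      by (rule ip_hermitian[where n = n]) (use herm z in auto)
    finally show ?thesis unfolding Qz by simp
  qed
  moreover have "Re (ip z z) = rform (?Q ?c) x"
    unfolding z_def by (simp add: rpow_norm[OF V(1) x])
  ultimately show ?thesis by simp
qed

text \<open>The exponents for which the inequality holds form a closed set that is closed under midpoints.\<close>
theorem loewner_heinz:
  assumes le: "\<And>x. x \<in> carrier_vec n \<Longrightarrow> rform (rpow n U d 2) x \<le> rform (rpow n V e 2) x"
    and r: "0 \<le> r" "r \<le> 2" and x: "x \<in> carrier_vec n"
  shows "rform (rpow n U d r) x \<le> rform (rpow n V e r) x"
proof -
  define G where "G x r = rform (rpow n V e r) x - rform (rpow n U d r) x" for x r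
  define S where "S = {r \<in> {0..2}. \<forall>x\<in>carrier_vec n. 0 \<le> G x r}"
  have contG: "continuous_on {0..2} (G x)" if "x \<in> carrier_vec n" for x
  proof -
    have "0 \<noteq> d i" "0 \<noteq> e i" if "i < n" for i using U(2) V(2) that by force+
    then show ?thesis
      unfolding G_def qform_spec[OF V(1) that] qform_spec[OF U(1) that] by (intro continuous_intros) auto
  qed
  have mid: "(a + b) / 2 \<in> S" if "a \<in> S" "b \<in> S" for a b
  proof -
    have "0 \<le> G x ((a + b) / 2)" if x: "x \<in> carrier_vec n" for x
      using rpow_midpoint[where s = "a / 2" and t = "b / 2" and x = x] \<open>a \<in> S\<close> \<open>b \<in> S\<close> x
      by (simp add: S_def G_def add_divide_distrib)
    then show ?thesis using that by (auto simp: S_def)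
  qed
  have "S = (\<Inter>x\<in>carrier_vec n. {r \<in> {0..2}. 0 \<le> G x r}) \<inter> {0..2}" by (auto simp: S_def)
  moreover have "closed {r \<in> {0..2}. 0 \<le> G x r}" if "x \<in> carrier_vec n" for x
    using continuous_closed_preimage[OF contG[OF that], of "{0..}"] by (simp add: vimage_def Int_def)
  ultimately have closed: "closed S" by (auto intro!: closed_Int closed_INT)
  have ends: "0 \<in> S" "2 \<in> S"
    using le by (auto simp: S_def G_def rpow_0[OF U] rpow_0[OF V])
  have "r \<in> S"
  proof (rule ccontr)
    assume rS: "r \<notin> S"
    \<comment> \<open>The end points of the gap of \<open>S\<close> around \<open>r\<close>; their
      midpoint would lie in \<open>S\<close> and strictly inside the gap.\<close>
    define a b where "a = Sup (S \<inter> {0..r})" and "b = Inf (S \<inter> {r..2})"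
    have "a \<in> S \<inter> {0..r}" unfolding a_def
      by (rule closed_contains_Sup) (use closed ends r in \<open>auto intro: closed_Int\<close>)
    moreover have "b \<in> S \<inter> {r..2}" unfolding b_def
      by (rule closed_contains_Inf) (use closed ends r in \<open>auto intro: closed_Int\<close>)
    ultimately have ab: "a \<in> S" "b \<in> S" "0 \<le> a" "a < r" "r < b" "b \<le> 2" using rS by (auto simp: less_eq_real_def)
    have m: "(a + b) / 2 \<in> S" by (rule mid[OF ab(1,2)])
    show False
    proof (cases "(a + b) / 2 \<le> r")
      case True
      then have "(a + b) / 2 \<le> a" unfolding a_def
        by (intro cSup_upper) (use m ab in \<open>auto simp flip: a_def\<close>)
      then show False using ab by simp
    next
      case False
      then have "b \<le> (a + b) / 2" unfolding b_def
        by (intro cInf_lower) (use m ab in \<open>auto simp flip: b_def\<close>)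
      then show False using ab by simp
    qed
  qed
  then show ?thesis using x by (auto simp: S_def G_def)
qed

text \<open>Divided by \<open>N\<close>, both summands lie between \<open>0\<close> and \<open>I\<close>, so raising them to the power \<open>r \<ge> 1\<close> decreases them.\<close>
lemma power_le_of_sum_le:
  assumes N: "0 < N" and c: "0 < c"
    and le: "\<And>x. x \<in> carrier_vec n \<Longrightarrow> rform (rpow n U d 1) x + c * rform (rpow n V e (- 1)) x \<le> N * Re (ip x x)"
    and r: "1 \<le> r" and x: "x \<in> carrier_vec n"
  shows "rform (rpow n U d (2 * r)) x \<le> (N powr (2 * r) / (4 * c powr r))\<^sup>2 * rform (rpow n V e (2 * r)) x"
proof -
  have pe: "0 \<le> rform (rpow n W h q) x" if "unitary n W" "x \<in> carrier_vec n" for W h q x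
    unfolding qform_spec[OF that] by (intro sum_nonneg) auto
  have dN: "d i \<le> N" if "i < n" for i
  proof (rule eigenvalue_le_of_form[OF U(1) that])
    fix x :: "complex vec" assume x: "x \<in> carrier_vec n"
    have "rpow n U d 1 = rspec n U d" using U(2) by (intro spec_cong) (simp add: less_imp_le)
    then show "rform (rspec n U d) x \<le> N * Re (ip x x)"
      using le[OF x] pe[OF V(1) x, of e "- 1"] c by (simp add: add_increasing2 mult_nonneg_nonneg) (smt (verit) mult_nonneg_nonneg)
  qed
  have eN: "c / e i \<le> N" if "i < n" for i
  proof (rule eigenvalue_le_of_form[OF V(1) that])
    fix x :: "complex vec" assume x: "x \<in> carrier_vec n"
    have "spec n V (\<lambda>i. complex_of_real (c / e i)) = spec n V (\<lambda>i. complex_of_real c * complex_of_real (e i powr (- 1)))"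
      using V(2) by (intro spec_cong) (simp add: powr_minus_divide less_imp_le)
    also have "\<dots> = complex_of_real c \<cdot>\<^sub>m rpow n V e (- 1)" by (rule spec_smult[OF V(1)])
    finally have "rform (spec n V (\<lambda>i. complex_of_real (c / e i))) x = c * rform (rpow n V e (- 1)) x"
      using x V(1) by (simp add: ip_sq)
    then show "rform (spec n V (\<lambda>i. complex_of_real (c / e i))) x \<le> N * Re (ip x x)"
      using le[OF x] pe[OF U(1) x, of d 1] by simp
  qed
  have pw: "a powr r \<le> N powr r / N * a" if "0 < a" "a \<le> N" for a
  proof -
    have "(a / N) powr r \<le> (a / N) powr 1" using that N r by (intro powr_mono') auto
    then have "a powr r / N powr r \<le> a / N" using that N by (simp add: powr_divide)
    then show ?thesis using N by (simp add: field_simps)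
  qed
  let ?A = "rpow n U d r" and ?B = "spec n V (\<lambda>i. complex_of_real ((c / e i) powr r))"
  have cB: "c / e i > 0" if "i < n" for i using V(2)[OF that] c by simp
  have nn: "0 \<le> N powr r / N" using N by simp
  have sum: "rform ?A x + rform ?B x \<le> N powr r * Re (ip x x)" if x: "x \<in> carrier_vec n" for x
  proof -
    have "rform ?A x \<le> N powr r / N * rform (rpow n U d 1) x"
      unfolding qform_spec[OF U(1) x] sum_distrib_left mult.assoc[symmetric]
      using pw dN U(2) by (intro sum_mono mult_right_mono) (auto simp: less_imp_le)
    moreover have "rform ?B x \<le> N powr r / N * (c * rform (rpow n V e (- 1)) x)"
      unfolding qform_spec[OF V(1) x] sum_distrib_left mult.assoc[symmetric]
    proof (intro sum_mono mult_right_mono)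
      fix i assume "i \<in> {..<n}"
      then have i: "i < n" by simp
      have "(c / e i) powr r \<le> N powr r / N * (c / e i)" using pw[OF cB[OF i] eN[OF i]] .
      moreover have "e i powr (- 1) = 1 / e i" using V(2)[OF i] by (simp add: powr_minus_divide)
      ultimately show "(c / e i) powr r \<le> N powr r / N * c * e i powr - 1" by simp
    qed simp
    ultimately have "rform ?A x + rform ?B x
      \<le> N powr r / N * (rform (rpow n U d 1) x + c * rform (rpow n V e (- 1)) x)"
      by (simp add: distrib_left)
    also have "\<dots> \<le> N powr r / N * (N * Re (ip x x))" using le[OF x] nn by (rule mult_left_mono)
    finally show ?thesis using N by simp
  qed
  have psdA: "0 \<le> rform ?A x" if "x \<in> carrier_vec n" for x by (rule pe[OF U(1) that])
  have psdB: "0 \<le> rform ?B x" if "x \<in> carrier_vec n" for x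
    unfolding qform_spec[OF V(1) that] by (intro sum_nonneg) auto
  \<comment> \<open>The preimage of \<open>x\<close> under \<open>?B\<close>, which is
    \<open>c^r\<close> times the power \<open>-r\<close> of the second matrix. The norm bound for
    \<open>?A ?B\<close> at \<open>y\<close> thus compares \<open>?A x\<close> with the
    \<open>r\<close>-th power of that matrix at \<open>x\<close>.\<close>
  define y where "y = complex_of_real (c powr (- r)) \<cdot>\<^sub>v (rpow n V e r *\<^sub>v x)"
  have y: "y \<in> carrier_vec n" using V(1) x by (simp add: y_def)
  have By: "?B *\<^sub>v y = x"
  proof -
    have "?B = spec n V (\<lambda>i. complex_of_real (c powr r) * complex_of_real (e i powr (- r)))"
      using V(2) c by (intro spec_cong) (simp add: powr_divide powr_minus_divide less_imp_le)
    also have "\<dots> = complex_of_real (c powr r) \<cdot>\<^sub>m rpow n V e (- r)" by (rule spec_smult[OF V(1)])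
    finally have "?B *\<^sub>v y = complex_of_real (c powr r * c powr (- r)) \<cdot>\<^sub>v (rpow n V e (- r) *\<^sub>v (rpow n V e r *\<^sub>v x))"
      unfolding y_def using V(1) x by (simp add: smult_smult_assoc mult.commute)
    also have "c powr r * c powr (- r) = 1" using c by (simp add: powr_add[symmetric])
    finally show ?thesis using x by (simp add: rpow_add[OF V(1)] rpow_0[OF V])
  qed
  have "Re (ip (?A *\<^sub>v (?B *\<^sub>v y)) (?A *\<^sub>v (?B *\<^sub>v y))) \<le> ((N powr r)\<^sup>2 / 4)\<^sup>2 * Re (ip y y)"
  proof -
    interpret psd_pair n ?A ?B "N powr r"
      by unfold_locales (use U(1) V(1) N hermitian_spec psdA psdB sum in auto)
    show ?thesis by (rule product_norm[OF y])
  qed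
  also have "?A *\<^sub>v (?B *\<^sub>v y) = ?A *\<^sub>v x" unfolding By ..
  also have "Re (ip y y) = (c powr (- r))\<^sup>2 * rform (rpow n V e (2 * r)) x"
    unfolding rpow_norm[OF V(1) x, symmetric] y_def using V(1) x by (simp add: ip_sq power2_eq_square)
  also have "((N powr r)\<^sup>2 / 4)\<^sup>2 * ((c powr (- r))\<^sup>2 * rform (rpow n V e (2 * r)) x)
    = ((N powr r)\<^sup>2 / 4 * c powr (- r))\<^sup>2 * rform (rpow n V e (2 * r)) x"
    unfolding power_mult_distrib by (simp only: mult.assoc)
  also have "(N powr r)\<^sup>2 / 4 * c powr (- r) = N powr (2 * r) / (4 * c powr r)"
    using N by (simp add: powr_minus_divide power2_eq_square powr_add[symmetric])
  finally show ?thesis unfolding rpow_norm[OF U(1) x] .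
qed

text \<open>For \<open>p \<ge> 2\<close> the exponent \<open>r = p / 2\<close> gives the constant
  \<open>N^(2 p) / (16 c^p) = (4^(1 - 2/p) K)^p\<close>. For \<open>p < 2\<close> the case
  \<open>r = 1\<close>, which reads \<open>X^2 \<le> (K Y)^2\<close>, is carried down by
  Loewner-Heinz. Both constants agree at \<open>p = 2\<close>.\<close>

theorem power_comparison:
  assumes N: "0 < N" and c: "0 < c"
    and le: "\<And>x. x \<in> carrier_vec n \<Longrightarrow> rform (rpow n U d 1) x + c * rform (rpow n V e (- 1)) x \<le> N * Re (ip x x)"
    and p: "0 < p" and K: "K = N\<^sup>2 / (4 * c)" and \<alpha>: "\<alpha> = max K (4 powr (1 - 2 / p) * K)"
    and x: "x \<in> carrier_vec n"
  shows "rform (rpow n U d p) x \<le> \<alpha> powr p * rform (rpow n V e p) x"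
proof -
  have K0: "K > 0" using N c by (simp add: K)
  have pos: "0 \<le> rform (rpow n V e p) x"
    unfolding qform_spec[OF V(1) x] by (intro sum_nonneg) auto
  show ?thesis
  proof (cases "p \<ge> 2")
    case True
    have "(N powr (2 * (p / 2)) / (4 * c powr (p / 2)))\<^sup>2 = N powr (2 * p) / (16 * c powr p)"
    proof -
      have "(N powr p)\<^sup>2 = N powr (2 * p)" using N by (simp add: power2_eq_square powr_add[symmetric])
      moreover have "(c powr (p / 2))\<^sup>2 = c powr p" using c by (simp add: power2_eq_square powr_add[symmetric])
      ultimately show ?thesis by (simp add: power_divide power_mult_distrib)
    qed
    also have "\<dots> = (4 powr (1 - 2 / p) * K) powr p"
    proof -
      have "(4 powr (1 - 2 / p) * K) powr p = 4 powr ((1 - 2 / p) * p) * K powr p"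
        using K0 by (simp add: powr_mult powr_powr)
      also have "(1 - 2 / p) * p = p - 2" using p by (simp add: left_diff_distrib)
      also have "4 powr (p - 2) = 4 powr p / (16 :: real)" by (simp add: powr_diff)
      also have "K powr p = N powr (2 * p) / (4 powr p * c powr p)"
        unfolding K using N c by (simp add: powr_divide powr_mult powr_powr flip: powr_numeral)
      finally show ?thesis by simp
    qed
    also have "\<dots> \<le> \<alpha> powr p" unfolding \<alpha> using K0 p by (intro powr_mono2) auto
    finally have "(N powr (2 * (p / 2)) / (4 * c powr (p / 2)))\<^sup>2 * rform (rpow n V e p) x
       \<le> \<alpha> powr p * rform (rpow n V e p) x" using pos by (intro mult_right_mono)
    with power_le_of_sum_le[OF N c le _ x, of "p / 2"] True show ?thesis by simp
  next
    case False
    \<comment> \<open>With \<open>K\<close> absorbed into the eigenvalues, the case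
      \<open>r = 1\<close> is a plain inequality between squares, as \<open>loewner_heinz\<close>
      expects.\<close>
    define e' where "e' i = K * e i" for i
    have e': "e' i powr s = K powr s * e i powr s" "0 < e' i" if "i < n" for i s
      using V(2)[OF that] K0 by (auto simp: e'_def powr_mult)
    have rp: "rpow n V e' s = complex_of_real (K powr s) \<cdot>\<^sub>m rpow n V e s" for s
    proof -
      have "rpow n V e' s = spec n V (\<lambda>i. complex_of_real (K powr s) * complex_of_real (e i powr s))"
        by (intro spec_cong) (simp add: e')
      then show ?thesis by (simp add: spec_smult[OF V(1)])
    qed
    have form: "rform (rpow n V e' s) x = K powr s * rform (rpow n V e s) x"
      if "x \<in> carrier_vec n" for x s unfolding rp using that V(1) by (simp add: ip_sq)
    have "rform (rpow n U d p) x \<le> rform (rpow n V e' p) x"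
    proof (rule rpow_pair.loewner_heinz[of n U V d e', OF _ _ _ _ x])
      show "rpow_pair n U V d e'" by unfold_locales (use U V e'(2) in auto)
      fix x :: "complex vec" assume x: "x \<in> carrier_vec n"
      have "(N powr (2 * 1) / (4 * c powr 1))\<^sup>2 = K powr 2"
        unfolding K using N c by simp
      then show "rform (rpow n U d 2) x \<le> rform (rpow n V e' 2) x"
        using power_le_of_sum_le[OF N c le order_refl x] form[OF x, of 2] by simp
    qed (use False p in auto)
    also have "\<dots> = K powr p * rform (rpow n V e p) x" by (rule form[OF x])
    also have "\<dots> \<le> \<alpha> powr p * rform (rpow n V e p) x"
      using pos K0 p by (intro mult_right_mono powr_mono2) (auto simp: \<alpha>)
    finally show ?thesis .
  qed
qed

end

section \<open>Means of accretive matrices and positive maps\<close>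

lemma re_mat_carrier [simp]: "A \<in> carrier_mat n n \<Longrightarrow> re_mat A \<in> carrier_mat n n"
  unfolding re_mat_def by auto

lemma hermitian_re_mat: "A \<in> carrier_mat n n \<Longrightarrow> hermitian_mat (re_mat A)"
proof -
  assume A: "A \<in> carrier_mat n n"
  have "mat_adjoint (re_mat A) = re_mat A"
    unfolding re_mat_def using A by (intro eq_matI) (auto simp: add.commute)
  then show ?thesis using hermitian_mat_iff[OF re_mat_carrier[OF A]] by simp
qed

lemma re_mat_form:
  assumes A: "A \<in> carrier_mat n n" and x: "x \<in> carrier_vec n"
  shows "rform (re_mat A) x = rform A x"
proof -
  interpret sq_mat n .
  have A': "mat_adjoint A \<in> carrier_mat n n" using A by simp
  have "ip (mat_adjoint A *\<^sub>v x) x = ip x (A *\<^sub>v x)" using ip_adjoint[OF A' x x] by simp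
  then have "rform (mat_adjoint A) x = rform A x"
    using Re_ip_sym[of x n "A *\<^sub>v x"] A x by simp
  then show ?thesis unfolding re_mat_def using A A' x by (simp add: sq_distrib ip_sq)
qed

lemma re_mat_hermitian_parts:
  assumes A: "A \<in> carrier_mat n n"
  shows "A = re_mat A + \<i> \<cdot>\<^sub>m re_mat (- \<i> \<cdot>\<^sub>m A)"
  unfolding re_mat_def using A by (intro eq_matI) (auto simp: algebra_simps)

lemma loewner_bounds_form:
  assumes P: "P \<in> carrier_mat n n" and x: "x \<in> carrier_vec n"
  shows "loewner_le (complex_of_real m \<cdot>\<^sub>m 1\<^sub>m n) P \<Longrightarrow> m * Re (ip x x) \<le> rform P x"
    and "loewner_le P (complex_of_real m \<cdot>\<^sub>m 1\<^sub>m n) \<Longrightarrow> rform P x \<le> m * Re (ip x x)"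
proof -
  interpret sq_mat n .
  have c: "complex_of_real m \<cdot>\<^sub>m 1\<^sub>m n \<in> carrier_mat n n" by simp
  have "rform (complex_of_real m \<cdot>\<^sub>m 1\<^sub>m n) x = m * Re (ip x x)" using x by (simp add: ip_sq)
  then show "loewner_le (complex_of_real m \<cdot>\<^sub>m 1\<^sub>m n) P \<Longrightarrow> m * Re (ip x x) \<le> rform P x"
    and "loewner_le P (complex_of_real m \<cdot>\<^sub>m 1\<^sub>m n) \<Longrightarrow> rform P x \<le> m * Re (ip x x)"
    using x loewner_le_iff[OF c P] loewner_le_iff[OF P c] by auto
qed

lemma eigenvalue_ge_of_form:
  assumes U: "unitary n U" and i: "i < n"
    and k: "\<And>x. x \<in> carrier_vec n \<Longrightarrow> k * Re (ip x x) \<le> rform (rspec n U d) x"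
  shows "k \<le> d i"
proof -
  have "- d i \<le> - k"
  proof (rule eigenvalue_le_of_form[OF U i])
    fix x :: "complex vec" assume x: "x \<in> carrier_vec n"
    show "rform (spec n U (\<lambda>i. complex_of_real (- d i))) x \<le> - k * Re (ip x x)"
      using k[OF x] unfolding qform_spec[OF U x] by (simp add: sum_negf)
  qed
  then show ?thesis by simp
qed

text \<open>A division-free form of \<open>P\<inverse> \<le> ((M + m) I - P) / (m M)\<close>, written out with
  \<open>P\<inverse> \<ge> 2 Re \<langle>s, \<cdot>\<rangle> - P\<close>.\<close>
lemma kantorovich_form:
  assumes P: "P \<in> carrier_mat n n" "hermitian_mat P" and m: "0 < m" "m \<le> M"
    and lb: "\<And>x. x \<in> carrier_vec n \<Longrightarrow> m * Re (ip x x) \<le> rform P x"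
    and ub: "\<And>x. x \<in> carrier_vec n \<Longrightarrow> rform P x \<le> M * Re (ip x x)"
    and s: "s \<in> carrier_vec n" and u: "u \<in> carrier_vec n"
  shows "2 * Re (ip s u) - ((M + m) * Re (ip s s) - rform P s) / (m * M) \<le> rform P u"
proof -
  obtain U d where U: "unitary n U" and Pd: "P = rspec n U d"
    using hermitian_spectral[OF P] .
  have d: "m \<le> d i" "d i \<le> M" if "i < n" for i
    using eigenvalue_ge_of_form[OF U that lb[unfolded Pd]] eigenvalue_le_of_form[OF U that ub[unfolded Pd]] by auto
  let ?s = "\<lambda>i. (mat_adjoint U *\<^sub>v s) $ i" and ?u = "\<lambda>i. (mat_adjoint U *\<^sub>v u) $ i"
  have M: "0 < m * M" using m by simp
  have "2 * Re (ip s u) - ((M + m) * Re (ip s s) - rform P s) / (m * M)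
     = (\<Sum>i<n. 2 * Re (?s i * cnj (?u i)) - ((M + m) * (cmod (?s i))\<^sup>2 - d i * (cmod (?s i))\<^sup>2) / (m * M))"
    unfolding ip_unitary[OF U s u] norm_unitary[OF U s] Pd qform_spec[OF U s] Re_sum
    by (simp only: sum_subtractf sum_distrib_left sum_divide_distrib[symmetric])
  also have "\<dots> \<le> (\<Sum>i<n. d i * (cmod (?u i))\<^sup>2)"
  proof (rule sum_mono)
    fix i assume "i \<in> {..<n}"
    then have i: "i < n" by simp
    have di: "0 < d i" using d(1)[OF i] m by simp
    \<comment> \<open>On the interval from \<open>m\<close> to \<open>M\<close> the function
      \<open>1 / d\<close> lies below its chord; this is the source of \<open>m * M\<close> and
      \<open>M + m\<close>.\<close>
    have "0 \<le> (d i - m) * (M - d i)" using d[OF i] by simp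
    then have "m * M \<le> d i * (M + m - d i)" by (simp add: algebra_simps)
    then have q: "1 / d i \<le> (M + m - d i) / (m * M)" using di M by (simp add: divide_le_eq le_divide_eq mult.commute)
    have "2 * Re (?s i * cnj (?u i)) \<le> 2 * (cmod (?s i) * cmod (?u i))"
      using complex_Re_le_cmod[of "?s i * cnj (?u i)"] by (simp add: norm_mult)
    also have "\<dots> \<le> (1 / d i) * (cmod (?s i))\<^sup>2 + d i * (cmod (?u i))\<^sup>2"
    proof -
      have "0 \<le> d i * (cmod (?u i) - cmod (?s i) / d i)\<^sup>2" using di by simp
      also have "\<dots> = d i * (cmod (?u i))\<^sup>2 - 2 * (cmod (?s i) * cmod (?u i)) + (1 / d i) * (cmod (?s i))\<^sup>2"
        using di by (simp add: power2_eq_square field_simps)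
      finally show ?thesis by simp
    qed
    also have "(1 / d i) * (cmod (?s i))\<^sup>2 \<le> (M + m - d i) / (m * M) * (cmod (?s i))\<^sup>2"
      by (rule mult_right_mono[OF q]) simp
    finally show "2 * Re (?s i * cnj (?u i)) - ((M + m) * (cmod (?s i))\<^sup>2 - d i * (cmod (?s i))\<^sup>2) / (m * M) \<le> d i * (cmod (?u i))\<^sup>2"
      by (simp add: left_diff_distrib[symmetric])
  qed
  also have "\<dots> = rform P u" unfolding Pd qform_spec[OF U u] ..
  finally show ?thesis .
qed

lemma accretive_eigenvalue:
  assumes A: "A \<in> carrier_mat n n" and acc: "\<And>x. x \<in> carrier_vec n \<Longrightarrow> x \<noteq> 0\<^sub>v n \<Longrightarrow> 0 < rform A x"
    and k: "eigenvalue A k"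
  shows "k \<in> slit_plane"
proof -
  obtain x where x: "x \<in> carrier_vec n" "x \<noteq> 0\<^sub>v n" "A *\<^sub>v x = k \<cdot>\<^sub>v x"
    using k A unfolding eigenvalue_def eigenvector_def by auto
  have "ip (A *\<^sub>v x) x = k * ip x x" using x by (simp add: ip_smult_left[of _ n])
  then have "rform A x = Re k * Re (ip x x)" by simp
  then have "0 < Re k" using acc[OF x(1,2)] ip_self_pos[OF x(1,2)] by (simp add: zero_less_mult_iff)
  then show ?thesis by (auto simp: slit_plane_eq complex_nonpos_Reals_iff)
qed

lemma slit_plane_nonzero: "z \<in> slit_plane \<Longrightarrow> z \<noteq> 0"
  by (auto simp: slit_plane_eq)

lemma holo_calc_csqrt:
  fixes A :: "complex mat"
  assumes A: "A \<in> carrier_mat n n" and ev: "\<And>z. eigenvalue A z \<Longrightarrow> z \<in> slit_plane"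
  defines "S \<equiv> holo_calc csqrt A" and "T \<equiv> holo_calc (\<lambda>z. inverse (csqrt z)) A"
  shows "S * S = A" "S * T = 1\<^sub>m n" "T * S = 1\<^sub>m n"
proof -
  have h1: "csqrt holomorphic_on slit_plane" unfolding slit_plane_eq by (intro holomorphic_intros)
  have h2: "(\<lambda>z. inverse (csqrt z)) holomorphic_on slit_plane"
    by (intro holomorphic_intros h1) (auto dest: slit_plane_nonzero)
  note mult = holo_calc_mult[OF A open_slit_plane ev]
  have "S * S = holo_calc (\<lambda>z. csqrt z * csqrt z) A" unfolding S_def by (rule mult[OF _ h1 h1, symmetric])
  also have "\<dots> = holo_calc (poly [:0, 1:]) A"
    by (rule holo_calc_cong[OF A open_slit_plane ev]) (auto intro!: holomorphic_intros h1 simp: power2_eq_square[symmetric])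
  also have "\<dots> = A" by (simp only: holo_calc_poly[OF A] mat_poly_X[OF A])
  finally show "S * S = A" .
  have "S * T = holo_calc (\<lambda>z. csqrt z * inverse (csqrt z)) A" unfolding S_def T_def by (rule mult[OF _ h1 h2, symmetric])
  also have "\<dots> = holo_calc (poly [:1:]) A"
    by (rule holo_calc_cong[OF A open_slit_plane ev]) (auto intro!: holomorphic_intros h1 h2 dest: slit_plane_nonzero)
  also have "\<dots> = 1\<^sub>m n" by (simp only: holo_calc_poly[OF A] mat_poly_1[OF A]) (auto intro!: eq_matI)
  finally show st: "S * T = 1\<^sub>m n" .
  show "T * S = 1\<^sub>m n"
    using mat_mult_left_right_inverse[OF _ _ st] A by (simp add: S_def T_def)
qed

section \<open>Quadratic forms of means of an accretive pair\<close>

locale accretive_pair = sq_mat n for n +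
  fixes A B :: "complex mat" and m M :: real
  assumes A: "A \<in> carrier_mat n n" and B: "B \<in> carrier_mat n n" and m: "0 < m" "m \<le> M"
    and lbA: "\<And>x. x \<in> carrier_vec n \<Longrightarrow> m * Re (ip x x) \<le> rform A x"
    and ubA: "\<And>x. x \<in> carrier_vec n \<Longrightarrow> rform A x \<le> M * Re (ip x x)"
    and lbB: "\<And>x. x \<in> carrier_vec n \<Longrightarrow> m * Re (ip x x) \<le> rform B x"
    and ubB: "\<And>x. x \<in> carrier_vec n \<Longrightarrow> rform B x \<le> M * Re (ip x x)"
begin

definition "S = holo_calc csqrt A"
definition "T = holo_calc (\<lambda>z. inverse (csqrt z)) A"
definition "C = T * B * T"

lemma posA: "x \<in> carrier_vec n \<Longrightarrow> x \<noteq> 0\<^sub>v n \<Longrightarrow> 0 < rform A x"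
  using lbA[of x] mult_pos_pos[OF m(1) ip_self_pos[of x n]] by linarith
lemma posB: "x \<in> carrier_vec n \<Longrightarrow> x \<noteq> 0\<^sub>v n \<Longrightarrow> 0 < rform B x"
  using lbB[of x] mult_pos_pos[OF m(1) ip_self_pos[of x n]] by linarith

lemma carriers [simp]: "S \<in> carrier_mat n n" "T \<in> carrier_mat n n" "C \<in> carrier_mat n n"
  "A \<in> carrier_mat n n" "B \<in> carrier_mat n n"
  using A B by (auto simp: S_def T_def C_def)

lemma evA: "eigenvalue A z \<Longrightarrow> z \<in> slit_plane"
  by (rule accretive_eigenvalue[OF A posA])

lemma SS: "S * S = A" and ST: "S * T = 1\<^sub>m n" and TS: "T * S = 1\<^sub>m n"
  using holo_calc_csqrt[OF A evA] by (simp_all add: S_def T_def)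

lemma SSv: "x \<in> carrier_vec n \<Longrightarrow> S *\<^sub>v (S *\<^sub>v x) = A *\<^sub>v x"
  using sq_assoc(2)[of S S x] by (simp add: SS)
lemma STv: "x \<in> carrier_vec n \<Longrightarrow> S *\<^sub>v (T *\<^sub>v x) = x"
  using sq_assoc(2)[of S T x] by (simp add: ST)
lemma TSv: "x \<in> carrier_vec n \<Longrightarrow> T *\<^sub>v (S *\<^sub>v x) = x"
  using sq_assoc(2)[of T S x] by (simp add: TS)

text \<open>\<open>C\<close> itself need not be accretive, but with \<open>e = T x\<close> the
  equation \<open>C x = k x\<close> becomes \<open>B e = k A e\<close>, and a real
  \<open>k \<le> 0\<close> would make \<open>rform B e\<close> non-positive.\<close>

lemma evC: 
  assumes k: "eigenvalue C k"
  shows "k \<in> slit_plane"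
proof (rule ccontr)
  assume "k \<notin> slit_plane"
  then have k': "Im k = 0" "Re k \<le> 0" by (auto simp: slit_plane_eq complex_nonpos_Reals_iff)
  obtain x where x: "x \<in> carrier_vec n" "x \<noteq> 0\<^sub>v n" "C *\<^sub>v x = k \<cdot>\<^sub>v x"
    using k carriers(3) unfolding eigenvalue_def eigenvector_def by auto
  define e where "e = T *\<^sub>v x"
  have e: "e \<in> carrier_vec n" using x by (simp add: e_def)
  have e0: "e \<noteq> 0\<^sub>v n"
  proof
    assume "e = 0\<^sub>v n"
    then have "x = S *\<^sub>v 0\<^sub>v n" using STv[OF x(1)] by (simp add: e_def)
    with x(2) mult_mat_zero_vec[OF carriers(1)] show False by simp
  qed
  have "T *\<^sub>v (B *\<^sub>v e) = k \<cdot>\<^sub>v x" using x by (simp add: C_def e_def)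
  then have "S *\<^sub>v (T *\<^sub>v (B *\<^sub>v e)) = k \<cdot>\<^sub>v (S *\<^sub>v x)" using x by simp
  moreover have "S *\<^sub>v x = A *\<^sub>v e" using SSv[OF e] STv[OF x(1)] by (simp add: e_def)
  ultimately have "B *\<^sub>v e = k \<cdot>\<^sub>v (A *\<^sub>v e)" using e by (simp add: STv)
  then have "rform B e = Re k * rform A e" using e k' by (simp add: ip_sq)
  also have "\<dots> \<le> 0" using posA[OF e e0] k' by (simp add: mult_nonpos_nonneg)
  finally show False using posB[OF e e0] by simp
qed

definition mean_form :: "(complex \<Rightarrow> complex) \<Rightarrow> complex vec \<Rightarrow> real" where
  "mean_form F y = rform (S * holo_calc F C * S) y"

text \<open>The form of the matrix \<open>W_x\<close> of the overview: the average, with weights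
  \<open>x\<close> and \<open>1 - x\<close>, of the bounds that \<open>kantorovich_form\<close>
  gives for the inverses of the real parts of \<open>A\<close> and \<open>B\<close>.\<close>

definition defect :: "real \<Rightarrow> complex vec \<Rightarrow> real" where
  "defect x s = (x * ((M + m) * Re (ip s s) - rform A s)
    + (1 - x) * ((M + m) * Re (ip s s) - rform B s)) / (m * M)"

lemma kantorovich_A:
  assumes "s \<in> carrier_vec n" "u \<in> carrier_vec n"
  shows "2 * Re (ip s u) - ((M + m) * Re (ip s s) - rform A s) / (m * M) \<le> rform A u"
  using kantorovich_form[OF re_mat_carrier[OF A] hermitian_re_mat[OF A] m _ _ assms] lbA ubA assms
  by (simp add: re_mat_form[OF A])

lemma kantorovich_B:
  assumes "s \<in> carrier_vec n" "u \<in> carrier_vec n"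
  shows "2 * Re (ip s u) - ((M + m) * Re (ip s s) - rform B s) / (m * M) \<le> rform B u"
  using kantorovich_form[OF re_mat_carrier[OF B] hermitian_re_mat[OF B] m _ _ assms] lbB ubB assms
  by (simp add: re_mat_form[OF B])

text \<open>For \<open>z = (A !\<^sub>x B) y\<close> one has \<open>y = x u + (1 - x) w\<close> with \<open>u = A\<inverse> z\<close> and \<open>w = B\<inverse> z\<close>; the resulting
  lower bound is affine in \<open>x\<close>, so it survives averaging over \<open>x\<close>.\<close>
lemma hmean_form_bound:
  assumes x: "0 \<le> x" "x \<le> 1" and s: "s \<in> carrier_vec n" and y: "y \<in> carrier_vec n"
  shows "2 * Re (ip s y) - defect x s \<le> mean_form (hmean x) y"
proof -
  \<comment> \<open>\<open>R\<close> is the inverse of \<open>x C + (1 - x)\<close>, so the harmonic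
    mean of \<open>C\<close> is \<open>C R\<close>.\<close>
  define R where "R = holo_calc (\<lambda>z. inverse (of_real x * z + of_real (1 - x))) C"
  have R [simp]: "R \<in> carrier_mat n n" by (simp add: R_def)
  let ?L = "[:of_real (1 - x), of_real x:] :: complex poly"
  have hR: "(\<lambda>z. inverse (of_real x * z + of_real (1 - x))) holomorphic_on slit_plane"
    by (intro holomorphic_intros hmean_denominator_nonzero x)
  have hp: "poly p holomorphic_on slit_plane" for p by (intro holomorphic_intros)
  note mult = holo_calc_mult[OF carriers(3) open_slit_plane evC]
  have "mat_poly [:0, 1:] C * R = holo_calc (\<lambda>z. poly [:0, 1:] z * inverse (of_real x * z + of_real (1 - x))) C"
    unfolding R_def using mult[OF _ hp hR] by (simp only: holo_calc_poly[OF carriers(3)])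
  also have "\<dots> = holo_calc (hmean x) C"
    by (rule holo_calc_cong[OF carriers(3) open_slit_plane evC holomorphic_on_mult[OF hp hR]])
      (auto simp: hmean_def divide_inverse)
  finally have G: "holo_calc (hmean x) C = C * R" by (simp only: mat_poly_X[OF carriers(3)])
  have "mat_poly ?L C * R = holo_calc (\<lambda>z. poly ?L z * inverse (of_real x * z + of_real (1 - x))) C"
    unfolding R_def using mult[OF _ hp hR] by (simp only: holo_calc_poly[OF carriers(3)])
  also have "\<dots> = holo_calc (poly [:1:]) C"
  proof (rule holo_calc_cong[OF carriers(3) open_slit_plane evC])
    show "(\<lambda>z. poly ?L z * inverse (of_real x * z + of_real (1 - x))) holomorphic_on slit_plane"
      by (intro holomorphic_intros hR)
    fix z assume z: "z \<in> slit_plane"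
    have L: "poly ?L z = of_real x * z + of_real (1 - x)" by (simp add: algebra_simps)
    show "poly ?L z * inverse (of_real x * z + of_real (1 - x)) = poly [:1:] z"
      unfolding L right_inverse[OF hmean_denominator_nonzero[OF z x]] by simp
  qed
  also have "\<dots> = 1\<^sub>m n" by (simp only: holo_calc_poly[OF carriers(3)] mat_poly_1[OF carriers(3)]) (auto intro!: eq_matI)
  finally have LR: "mat_poly ?L C * R = 1\<^sub>m n" .
  define k where "k = R *\<^sub>v (S *\<^sub>v y)"
  have k: "k \<in> carrier_vec n" using y by (simp add: k_def)
  have "mat_poly ?L C *\<^sub>v k = mat_poly ?L C * R *\<^sub>v (S *\<^sub>v y)"
    unfolding k_def by (rule sq_assoc(2)[symmetric]) (use y in auto)
  also have "\<dots> = S *\<^sub>v y" unfolding LR using y by simp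
  finally have "S *\<^sub>v y = of_real (1 - x) \<cdot>\<^sub>v k + of_real x \<cdot>\<^sub>v (C *\<^sub>v k)"
    using k by (simp only: mat_poly_linear[OF carriers(3)]) (simp add: sq_distrib)
  note Sy = this
  \<comment> \<open>Chosen so that \<open>A u = z\<close> and \<open>B w = z\<close>: the preimages
    of \<open>z\<close> under \<open>A\<close> and \<open>B\<close> come out of \<open>k\<close>
    without inverting either matrix.\<close>
  define u w z where "u = T *\<^sub>v (C *\<^sub>v k)" and "w = T *\<^sub>v k" and "z = S *\<^sub>v (C *\<^sub>v k)"
  have c: "u \<in> carrier_vec n" "w \<in> carrier_vec n" "z \<in> carrier_vec n" using k by (auto simp: u_def w_def z_def)
  have yuw: "y = of_real (1 - x) \<cdot>\<^sub>v w + of_real x \<cdot>\<^sub>v u"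
  proof -
    have "y = T *\<^sub>v (S *\<^sub>v y)" by (rule TSv[OF y, symmetric])
    also have "\<dots> = of_real (1 - x) \<cdot>\<^sub>v w + of_real x \<cdot>\<^sub>v u"
      unfolding Sy u_def w_def using k by (simp add: sq_distrib del: of_real_diff)
    finally show ?thesis .
  qed
  have Au: "A *\<^sub>v u = z"
    using SSv[OF c(1)] STv[of "C *\<^sub>v k"] k by (simp add: u_def z_def)
  have Bw: "B *\<^sub>v w = z"
    using k STv[of "B *\<^sub>v (T *\<^sub>v k)"] by (simp add: w_def z_def C_def)
  have "(S * holo_calc (hmean x) C * S) *\<^sub>v y = z"
    unfolding G using y by (simp add: z_def k_def)
  then have "mean_form (hmean x) y = Re (ip z y)" by (simp add: mean_form_def)
  \<comment> \<open>\<open>z\<close> is paired with \<open>y = (1 - x) w + x u\<close>, reading it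
    as \<open>B w\<close> in the first summand and as \<open>A u\<close> in the second.\<close>
  also have "\<dots> = (1 - x) * rform B w + x * rform A u"
    unfolding Au Bw using c by (subst yuw) (simp add: ip_sq del: of_real_diff)
  finally have eq: "mean_form (hmean x) y = (1 - x) * rform B w + x * rform A u" .
  let ?a = "((M + m) * Re (ip s s) - rform A s) / (m * M)"
    and ?b = "((M + m) * Re (ip s s) - rform B s) / (m * M)"
  have "2 * Re (ip s y) - defect x s = (1 - x) * (2 * Re (ip s w) - ?b) + x * (2 * Re (ip s u) - ?a)"
  proof -
    have "Re (ip s y) = (1 - x) * Re (ip s w) + x * Re (ip s u)"
      using c s by (subst yuw) (simp add: ip_sq del: of_real_diff)
    moreover have "defect x s = x * ?a + (1 - x) * ?b" by (simp add: defect_def add_divide_distrib)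
    ultimately show ?thesis by (simp only: right_diff_distrib) (simp add: algebra_simps)
  qed
  also have "\<dots> \<le> mean_form (hmean x) y"
    unfolding eq using kantorovich_A[OF s c(1)] kantorovich_B[OF s c(2)] x
    by (intro add_mono mult_left_mono) auto
  finally show ?thesis .
qed

lemma mean_form_expansion:
  assumes "y \<in> carrier_vec n"
  obtains Z \<kappa> where "finite Z" "\<And>z. z \<in> Z \<Longrightarrow> z \<in> slit_plane"
    "\<And>F. mean_form F y = Re (\<Sum>z\<in>Z. \<Sum>j<amult C z. (deriv ^^ j) F z * \<kappa> z j)"
proof -
  from holo_calc_form_expansion[OF carriers(3,1) assms] obtain Z \<kappa> where Z: "finite Z" "\<forall>z\<in>Z. eigenvalue C z"
    "\<forall>F. ip ((S * holo_calc F C * S) *\<^sub>v y) y = (\<Sum>z\<in>Z. \<Sum>j<amult C z. (deriv ^^ j) F z * \<kappa> z j)"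
    by (elim exE conjE)
  show ?thesis
    by (rule that[of Z \<kappa>]) (use Z evC in \<open>auto simp only: mean_form_def\<close>)
qed

text \<open>By \<open>mean_form_expansion\<close> the form is linear in the function, and
  \<open>defect\<close> is affine in the parameter, so the bound is stable under convex
  combinations.\<close>

lemma mixture_form_bound:
  assumes "mixture g x" and s: "s \<in> carrier_vec n" and y: "y \<in> carrier_vec n"
  shows "2 * Re (ip s y) - defect x s \<le> mean_form g y"
  using assms(1)
proof (induction rule: mixture.induct)
  case (hmean x)
  then show ?case using hmean_form_bound s y by blast
next
  case (convex g p h q l)
  obtain Z \<kappa> where Z: "finite Z" "\<And>z. z \<in> Z \<Longrightarrow> z \<in> slit_plane"
    "\<And>F. mean_form F y = Re (\<Sum>z\<in>Z. \<Sum>j<amult C z. (deriv ^^ j) F z * \<kappa> z j)"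
    using mean_form_expansion[OF y] by blast
  note hol = mixture_holomorphic[OF convex.hyps(1)] mixture_holomorphic[OF convex.hyps(2)]
  have d: "(deriv ^^ j) (\<lambda>z. of_real l * g z + of_real (1 - l) * h z) z = of_real l * (deriv ^^ j) g z + of_real (1 - l) * (deriv ^^ j) h z"
    if "z \<in> slit_plane" for z j
    using that hol open_slit_plane
    by (subst higher_deriv_add[of _ slit_plane]) (auto intro!: holomorphic_intros simp: higher_deriv_cmult[of _ slit_plane] simp del: of_real_diff)
  have "(\<Sum>z\<in>Z. \<Sum>j<amult C z. (deriv ^^ j) (\<lambda>z. of_real l * g z + of_real (1 - l) * h z) z * \<kappa> z j)
    = of_real l * (\<Sum>z\<in>Z. \<Sum>j<amult C z. (deriv ^^ j) g z * \<kappa> z j)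
      + of_real (1 - l) * (\<Sum>z\<in>Z. \<Sum>j<amult C z. (deriv ^^ j) h z * \<kappa> z j)"
    unfolding sum_distrib_left sum.distrib[symmetric] using Z(2)
    by (intro sum.cong refl) (simp add: d distrib_right mult.assoc del: of_real_diff)
  then have "mean_form (\<lambda>z. of_real l * g z + of_real (1 - l) * h z) y = l * mean_form g y + (1 - l) * mean_form h y"
    unfolding Z(3) by (simp del: of_real_diff)
  moreover have "l * (2 * Re (ip s y) - defect p s) + (1 - l) * (2 * Re (ip s y) - defect q s)
      \<le> l * mean_form g y + (1 - l) * mean_form h y"
    using convex by (intro add_mono mult_left_mono) auto
  moreover have "defect (l * p + (1 - l) * q) s = l * defect p s + (1 - l) * defect q s"
    unfolding defect_def by (simp only: times_divide_eq_right add_divide_distrib[symmetric]) (simp add: algebra_simps)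
  then have "2 * Re (ip s y) - defect (l * p + (1 - l) * q) s
      = l * (2 * Re (ip s y) - defect p s) + (1 - l) * (2 * Re (ip s y) - defect q s)"
    by (simp only: right_diff_distrib) (simp add: algebra_simps)
  ultimately show ?case by simp
qed

text \<open>The form involves finitely many derivatives, all of which converge along the mixtures,
  while their means tend to \<open>v\<close> inside \<open>defect\<close>.\<close>

theorem mean_form_bound:
  assumes f: "operator_monotone f" "\<And>s. 0 < s \<Longrightarrow> 0 < f s" "f 1 = 1"
    and v: "0 \<le> v" "v \<le> 1" and fle: "\<And>s. 0 < s \<Longrightarrow> f s \<le> v + (1 - v) * s"
    and F: "F holomorphic_on slit_plane" "\<And>s. 0 < s \<Longrightarrow> F (of_real s) = of_real (f s)"
    and s: "s \<in> carrier_vec n" and y: "y \<in> carrier_vec n"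
  shows "2 * Re (ip s y) - defect v s \<le> rform (mean_acc F A B) y"
proof -
  obtain g p where g: "\<And>k. mixture (g k) (p k)" "p \<longlonglongrightarrow> v"
    "\<And>z j. z \<in> slit_plane \<Longrightarrow> (\<lambda>k::nat. (deriv ^^ j) (g k) z) \<longlonglongrightarrow> (deriv ^^ j) F z"
    using mixture_limit[OF f v fle F] by blast
  obtain Z \<kappa> where Z: "finite Z" "\<And>z. z \<in> Z \<Longrightarrow> z \<in> slit_plane"
    "\<And>F. mean_form F y = Re (\<Sum>z\<in>Z. \<Sum>j<amult C z. (deriv ^^ j) F z * \<kappa> z j)"
    using mean_form_expansion[OF y] by blast
  have l1: "(\<lambda>k. mean_form (g k) y) \<longlonglongrightarrow> mean_form F y"
    unfolding Z(3) by (intro tendsto_Re tendsto_sum tendsto_mult tendsto_const g(3) Z(2))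
  have l2: "(\<lambda>k. 2 * Re (ip s y) - defect (p k) s) \<longlonglongrightarrow> 2 * Re (ip s y) - defect v s"
    unfolding defect_def using m by (intro tendsto_intros g(2)) auto
  have "2 * Re (ip s y) - defect v s \<le> mean_form F y"
    by (rule LIMSEQ_le[OF l2 l1]) (use mixture_form_bound[OF g(1) s y] in blast)
  then show ?thesis by (simp add: mean_form_def mean_acc_def Let_def S_def T_def C_def)
qed

end

section \<open>Positive unital maps and Choi's inequality\<close>

locale positive_map = sq_mat n for n +
  fixes \<Phi> :: "complex mat \<Rightarrow> complex mat"
  assumes \<Phi>: "positive_unital_linear n \<Phi>"
begin

lemma \<Phi>_carrier [simp]: "X \<in> carrier_mat n n \<Longrightarrow> \<Phi> X \<in> carrier_mat n n"
  using \<Phi> by (auto simp: positive_unital_linear_def)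
lemma \<Phi>_add: "X \<in> carrier_mat n n \<Longrightarrow> Y \<in> carrier_mat n n \<Longrightarrow> \<Phi> (X + Y) = \<Phi> X + \<Phi> Y"
  using \<Phi> by (auto simp: positive_unital_linear_def)
lemma \<Phi>_smult: "X \<in> carrier_mat n n \<Longrightarrow> \<Phi> (c \<cdot>\<^sub>m X) = c \<cdot>\<^sub>m \<Phi> X"
  using \<Phi> by (auto simp: positive_unital_linear_def)
lemma \<Phi>_one: "\<Phi> (1\<^sub>m n) = 1\<^sub>m n"
  using \<Phi> by (auto simp: positive_unital_linear_def)
lemma \<Phi>_psd: "X \<in> carrier_mat n n \<Longrightarrow> psd_mat X \<Longrightarrow> psd_mat (\<Phi> X)"
  using \<Phi> by (auto simp: positive_unital_linear_def)

lemma psd_spec: "unitary n U \<Longrightarrow> (\<And>i. i < n \<Longrightarrow> 0 \<le> d i) \<Longrightarrow> psd_mat (rspec n U d)"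
  unfolding psd_mat_iff[OF spec_carrier] by (auto simp: hermitian_spec qform_spec intro!: sum_nonneg)

text \<open>Positivity speaks about positive semidefinite matrices only. Adding \<open>t\<close>
  times the identity makes \<open>X\<close> one of them, and unitality lets this term be removed
  again from the image.\<close>

lemma \<Phi>_hermitian:
  assumes X: "X \<in> carrier_mat n n" "hermitian_mat X"
  shows "hermitian_mat (\<Phi> X)"
proof -
  obtain U d where U: "unitary n U" and Xd: "X = rspec n U d"
    using hermitian_spectral[OF X] .
  define t where "t = (\<Sum>i<n. \<bar>d i\<bar>)"
  have t: "0 \<le> d i + t" if "i < n" for i
    using member_le_sum[of i "{..<n}" "\<lambda>i. \<bar>d i\<bar>"] that by (simp add: t_def)
  have eq: "spec n U (\<lambda>i. complex_of_real (d i + t)) = X + complex_of_real t \<cdot>\<^sub>m 1\<^sub>m n"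
    using spec_add[OF U, of "\<lambda>i. complex_of_real (d i)" "\<lambda>_. complex_of_real t"] by (simp add: Xd spec_const[OF U])
  have "psd_mat (spec n U (\<lambda>i. complex_of_real (d i + t)))" by (rule psd_spec[OF U t])
  then have "psd_mat (\<Phi> (X + complex_of_real t \<cdot>\<^sub>m 1\<^sub>m n))"
    unfolding eq by (rule \<Phi>_psd[rotated]) (use X in simp)
  then have "hermitian_mat (\<Phi> X + complex_of_real t \<cdot>\<^sub>m 1\<^sub>m n)"
    using X by (simp add: \<Phi>_add \<Phi>_smult \<Phi>_one psd_mat_def)
  then have h: "mat_adjoint (\<Phi> X + complex_of_real t \<cdot>\<^sub>m 1\<^sub>m n) = \<Phi> X + complex_of_real t \<cdot>\<^sub>m 1\<^sub>m n"
    by (simp add: hermitian_mat_def)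
  have "mat_adjoint (\<Phi> X) = \<Phi> X"
  proof (rule eq_matI)
    have c: "\<Phi> X \<in> carrier_mat n n" using X by simp
    fix i j assume "i < dim_row (\<Phi> X)" "j < dim_col (\<Phi> X)"
    then have ij: "i < n" "j < n" using c by auto
    have "mat_adjoint (\<Phi> X + complex_of_real t \<cdot>\<^sub>m 1\<^sub>m n) $$ (i, j) = (\<Phi> X + complex_of_real t \<cdot>\<^sub>m 1\<^sub>m n) $$ (i, j)"
      unfolding h ..
    then show "mat_adjoint (\<Phi> X) $$ (i, j) = \<Phi> X $$ (i, j)"
      using ij c by (auto split: if_splits)
  qed (use \<Phi>_carrier[OF X(1)] in auto)
  then show ?thesis using hermitian_mat_iff[OF \<Phi>_carrier[OF X(1)]] by simp
qed

text \<open>Complex linearity together with \<open>\<Phi>_hermitian\<close> carries the Cartesian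
  decomposition of \<open>X\<close> to that of its image.\<close>

lemma \<Phi>_re_mat:
  assumes X: "X \<in> carrier_mat n n"
  shows "re_mat (\<Phi> X) = \<Phi> (re_mat X)"
proof -
  let ?H = "re_mat X" and ?K = "re_mat (- \<i> \<cdot>\<^sub>m X)"
  have c: "?H \<in> carrier_mat n n" "?K \<in> carrier_mat n n" using X by auto
  have herm: "hermitian_mat (\<Phi> ?H)" "hermitian_mat (\<Phi> ?K)"
    by (intro \<Phi>_hermitian c hermitian_re_mat[of _ n]; use X in simp)+
  have sum: "\<Phi> X = \<Phi> ?H + \<i> \<cdot>\<^sub>m \<Phi> ?K"
    using re_mat_hermitian_parts[OF X] c by (metis \<Phi>_add \<Phi>_smult smult_carrier_mat)
  have adj: "mat_adjoint (\<Phi> ?H + \<i> \<cdot>\<^sub>m \<Phi> ?K) = \<Phi> ?H + (- \<i>) \<cdot>\<^sub>m \<Phi> ?K"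
    using c herm by (simp add: mat_adjoint_add[of _ n n] mat_adjoint_smult hermitian_matD[of _ n n])
  have half: "(1/2 :: complex) \<cdot>\<^sub>m (P + \<i> \<cdot>\<^sub>m Q + (P + (- \<i>) \<cdot>\<^sub>m Q)) = P"
    if "P \<in> carrier_mat n n" "Q \<in> carrier_mat n n" for P Q :: "complex mat"
    using that by (intro eq_matI) (auto simp: algebra_simps)
  show ?thesis unfolding re_mat_def[of "\<Phi> X"] unfolding sum adj
    by (rule half[OF \<Phi>_carrier[OF c(1)] \<Phi>_carrier[OF c(2)]])
qed

lemma \<Phi>_form_mono:
  assumes X: "X \<in> carrier_mat n n" "hermitian_mat X" and Y: "Y \<in> carrier_mat n n" "hermitian_mat Y"
    and le: "\<And>x. x \<in> carrier_vec n \<Longrightarrow> rform X x \<le> rform Y x"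
    and x: "x \<in> carrier_vec n"
  shows "rform (\<Phi> X) x \<le> rform (\<Phi> Y) x"
proof -
  have "psd_mat (Y - X)"
    using le X Y by (auto simp: psd_mat_iff[of _ n] hermitian_minus[of X n Y] sq_distrib ip_sq)
  then have "psd_mat (\<Phi> (Y - X))" using X Y by (intro \<Phi>_psd) auto
  moreover have "Y - X = Y + (-1) \<cdot>\<^sub>m X" using X Y by (intro eq_matI) auto
  ultimately have "psd_mat (\<Phi> Y + (-1) \<cdot>\<^sub>m \<Phi> X)" using X Y by (simp add: \<Phi>_add \<Phi>_smult)
  then have "0 \<le> rform (\<Phi> Y + (-1) \<cdot>\<^sub>m \<Phi> X) x"
    using x X Y psd_mat_iff[of "\<Phi> Y + (-1) \<cdot>\<^sub>m \<Phi> X" n] by auto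
  then show ?thesis using X Y x by (simp add: sq_distrib ip_sq)
qed

text \<open>Spectral resolution of the argument. It reduces statements about images under
  \<open>\<Phi>\<close> to the images of the spectral projections, which are positive semidefinite
  and add up to the identity.\<close>

lemma \<Phi>_spec_expand:
  assumes U: "unitary n U" and s: "s \<in> carrier_vec n" and y: "y \<in> carrier_vec n"
  shows "ip (\<Phi> (spec n U d) *\<^sub>v s) y = (\<Sum>i<n. d i * ip (\<Phi> (spec n U (\<lambda>j. if j = i then 1 else 0)) *\<^sub>v s) y)"
proof -
  have "ip (\<Phi> (spec n U (\<lambda>i. if i < k then d i else 0)) *\<^sub>v s) y
    = (\<Sum>i<k. d i * ip (\<Phi> (spec n U (\<lambda>j. if j = i then 1 else 0)) *\<^sub>v s) y)" for k
  proof (induction k)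
    case 0
    have "spec n U (\<lambda>i. if i < 0 then d i else 0) = 0 \<cdot>\<^sub>m 1\<^sub>m n" using spec_const[OF U, of 0] by simp
    then show ?case using s y by (simp add: \<Phi>_smult ip_sq)
  next
    case (Suc k)
    have "spec n U (\<lambda>i. if i < Suc k then d i else 0)
      = spec n U (\<lambda>i. (if i < k then d i else 0) + d k * (if i = k then 1 else 0))"
      by (intro spec_cong) (auto simp: less_Suc_eq)
    also have "\<dots> = spec n U (\<lambda>i. if i < k then d i else 0) + d k \<cdot>\<^sub>m spec n U (\<lambda>i. if i = k then 1 else 0)"
      by (simp only: spec_add[OF U] spec_smult[OF U])
    finally show ?case using Suc U s y by (simp add: \<Phi>_add \<Phi>_smult sq_distrib ip_sq)
  qed
  from this[of n] have "ip (\<Phi> (spec n U (\<lambda>i. if i < n then d i else 0)) *\<^sub>v s) y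
    = (\<Sum>i<n. d i * ip (\<Phi> (spec n U (\<lambda>j. if j = i then 1 else 0)) *\<^sub>v s) y)" .
  moreover have "spec n U (\<lambda>i. if i < n then d i else 0) = spec n U d" by (intro spec_cong) auto
  ultimately show ?thesis by simp
qed

text \<open>Choi's inequality \<open>\<Phi>(W)\<inverse> \<le> \<Phi>(W\<inverse>)\<close>, stated without inverting \<open>\<Phi>(W)\<close>.\<close>
lemma choi_inequality:
  assumes U: "unitary n U" and w: "\<And>i. i < n \<Longrightarrow> 0 < w i" and s: "s \<in> carrier_vec n" and y: "y \<in> carrier_vec n"
  shows "2 * Re (ip s y) \<le> rform (\<Phi> (rspec n U w)) s
    + rform (\<Phi> (spec n U (\<lambda>i. complex_of_real (1 / w i)))) y"
proof -
  let ?E = "\<lambda>i. spec n U (\<lambda>j. if j = i then 1 else 0)"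
  have E: "?E i \<in> carrier_mat n n" "psd_mat (\<Phi> (?E i))" for i
  proof -
    show "?E i \<in> carrier_mat n n" using U by simp
    have "?E i = spec n U (\<lambda>j. complex_of_real (if j = i then 1 else 0))" by (intro spec_cong) auto
    then show "psd_mat (\<Phi> (?E i))" using \<Phi>_psd[OF spec_carrier[OF U] psd_spec[OF U, of "\<lambda>j. if j = i then 1 else 0"]] by simp
  qed
  have one: "spec n U (\<lambda>_. 1) = 1\<^sub>m n" by (simp add: spec_const[OF U]) (auto intro!: eq_matI)
  have "2 * Re (ip s y) = 2 * Re (ip (\<Phi> (spec n U (\<lambda>_. 1)) *\<^sub>v s) y)" unfolding one \<Phi>_one using s by simp
  also have "\<dots> = (\<Sum>i<n. 2 * Re (ip (\<Phi> (?E i) *\<^sub>v s) y))"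
    unfolding \<Phi>_spec_expand[OF U s y, of "\<lambda>_. 1"] by (simp add: sum_distrib_left)
  also have "\<dots> \<le> (\<Sum>i<n. w i * rform (\<Phi> (?E i)) s + 1 / w i * rform (\<Phi> (?E i)) y)"
  proof (rule sum_mono)
    fix i assume "i \<in> {..<n}"
    then have wi: "0 < w i" using w by simp
    have h: "\<Phi> (?E i) \<in> carrier_mat n n" "hermitian_mat (\<Phi> (?E i))" using E[of i] by (auto simp: psd_mat_def)
    \<comment> \<open>Completing the square for each projection separately, with the weight
      \<open>w i\<close>; after summation over \<open>i\<close> no inverse of an image under
      \<open>\<Phi>\<close> is required.\<close>
    have "0 \<le> w i * rform (\<Phi> (?E i)) (s + complex_of_real (- (1 / w i)) \<cdot>\<^sub>v y)"
      using wi E(2)[of i] s y psd_mat_iff[OF h(1)] by (intro mult_nonneg_nonneg) auto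
    also have "\<dots> = w i * rform (\<Phi> (?E i)) s + 1 / w i * rform (\<Phi> (?E i)) y - 2 * Re (ip (\<Phi> (?E i) *\<^sub>v s) y)"
      unfolding quadratic_expand[OF h s y] using wi by (simp add: field_simps power2_eq_square)
    finally show "2 * Re (ip (\<Phi> (?E i) *\<^sub>v s) y) \<le> w i * rform (\<Phi> (?E i)) s + 1 / w i * rform (\<Phi> (?E i)) y" by simp
  qed
  also have "\<dots> = rform (\<Phi> (rspec n U w)) s
    + rform (\<Phi> (spec n U (\<lambda>i. complex_of_real (1 / w i)))) y"
    unfolding \<Phi>_spec_expand[OF U s s, of "\<lambda>i. complex_of_real (w i)"]
      \<Phi>_spec_expand[OF U y y, of "\<lambda>i. complex_of_real (1 / w i)"] Re_sum
    by (simp add: sum.distrib flip: of_real_divide)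
  finally show ?thesis .
qed

end

theorem theorem2p7:
  fixes n :: nat and \<theta> m M v p :: real and A B :: "complex mat"
    and \<Phi> :: "complex mat \<Rightarrow> complex mat"
    and f :: "real \<Rightarrow> real" and F :: "complex \<Rightarrow> complex"
  assumes "0 \<le> \<theta>" and "\<theta> < pi / 2"
    and "A \<in> sector_class n \<theta>" and "B \<in> sector_class n \<theta>"
    and "0 < m" and "m \<le> M"
    and "loewner_le (complex_of_real m \<cdot>\<^sub>m 1\<^sub>m n) (re_mat A)"
    and "loewner_le (re_mat A) (complex_of_real M \<cdot>\<^sub>m 1\<^sub>m n)"
    and "loewner_le (complex_of_real m \<cdot>\<^sub>m 1\<^sub>m n) (re_mat B)"
    and "loewner_le (re_mat B) (complex_of_real M \<cdot>\<^sub>m 1\<^sub>m n)"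
    and "positive_unital_linear n \<Phi>"
    and "0 \<le> v" and "v \<le> 1"
    and "representing_function f"
    and "F holomorphic_on slit_plane"
    and "\<forall>t>0. F (complex_of_real t) = complex_of_real (f t)"
    and "\<forall>t>0. inverse (v + (1 - v) / t) \<le> f t"
    and "\<forall>t>0. f t \<le> v + (1 - v) * t"
    and "0 < p"
  shows "let K = (M + m)\<^sup>2 / (4 * m * M); \<alpha> = max K (4 powr (1 - 2 / p) * K) in
         loewner_le (herm_calc (\<lambda>t. t powr p) (re_mat (\<Phi> (arith_mean v A B))))
           (complex_of_real (\<alpha> powr p) \<cdot>\<^sub>m
              herm_calc (\<lambda>t. t powr p) (re_mat (\<Phi> (mean_acc F A B))))"
proof -
  have A: "A \<in> carrier_mat n n" and B: "B \<in> carrier_mat n n"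
    using assms(3,4) by (auto simp: sector_class_def)
  interpret accretive_pair n A B m M
    using loewner_bounds_form[OF re_mat_carrier[OF A]] loewner_bounds_form[OF re_mat_carrier[OF B]] assms(5-10) A B
    by unfold_locales (simp_all add: re_mat_form[OF A] re_mat_form[OF B])
  interpret positive_map n \<Phi> by unfold_locales (rule assms(11))
  let ?N = "M + m" and ?c = "m * M"
  have N: "0 < ?N" and c: "0 < ?c" and M: "0 < M" using m by auto
  define D where "D = re_mat (arith_mean v A B)"
  define G where "G = mean_acc F A B"
  define Z where "Z = re_mat G"
  have carith: "arith_mean v A B \<in> carrier_mat n n" by (simp add: arith_mean_def)
  have cG: "G \<in> carrier_mat n n" unfolding G_def mean_acc_def Let_def by simp
  have D: "D \<in> carrier_mat n n" "hermitian_mat D" and Z: "Z \<in> carrier_mat n n" "hermitian_mat Z"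
    using carith cG hermitian_re_mat by (auto simp: D_def Z_def)
  have Dform: "rform D x = v * rform A x + (1 - v) * rform B x" if "x \<in> carrier_vec n" for x
    unfolding D_def re_mat_form[OF carith that] unfolding arith_mean_def using that by (simp add: sq_distrib ip_sq del: of_real_diff)
  have Dlb: "m * Re (ip x x) \<le> rform D x" and Dub: "rform D x \<le> M * Re (ip x x)"
    if x: "x \<in> carrier_vec n" for x
  proof -
    have "v * (m * Re (ip x x)) + (1 - v) * (m * Re (ip x x)) \<le> v * rform A x + (1 - v) * rform B x"
      using assms(12,13) lbA[OF x] lbB[OF x] by (intro add_mono mult_left_mono) auto
    then show "m * Re (ip x x) \<le> rform D x" unfolding Dform[OF x] by (simp add: algebra_simps)
    have "v * rform A x + (1 - v) * rform B x \<le> v * (M * Re (ip x x)) + (1 - v) * (M * Re (ip x x))"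
      using assms(12,13) ubA[OF x] ubB[OF x] by (intro add_mono mult_left_mono) auto
    then show "rform D x \<le> M * Re (ip x x)" unfolding Dform[OF x] by (simp add: algebra_simps)
  qed
  obtain U d where U: "unitary n U" and Dd: "D = rspec n U d"
    using hermitian_spectral[OF D] .
  \<comment> \<open>The eigenvalues of \<open>W = (N - D) / c\<close>, positive because
    \<open>d i \<le> M < M + m\<close>.\<close>
  define w where "w i = (?N - d i) / ?c" for i
  have dM: "d i \<le> M" if "i < n" for i
    by (rule eigenvalue_le_of_form[OF U that]) (use Dub Dd in auto)
  have w: "0 < w i" if "i < n" for i using dM[OF that] m c by (simp add: w_def)
  let ?W = "rspec n U w" and ?W' = "spec n U (\<lambda>i. complex_of_real (1 / w i))"
  have cW: "?W \<in> carrier_mat n n" "?W' \<in> carrier_mat n n" using U by auto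
  have Weq: "?W = complex_of_real (?N / ?c) \<cdot>\<^sub>m 1\<^sub>m n + complex_of_real (- 1 / ?c) \<cdot>\<^sub>m D"
  proof -
    have "?W = spec n U (\<lambda>i. complex_of_real (?N / ?c) + complex_of_real (- 1 / ?c) * complex_of_real (d i))"
      by (intro spec_cong) (simp add: w_def diff_divide_distrib del: of_real_add of_real_mult flip: of_real_mult of_real_add)
    then show ?thesis by (simp only: spec_add[OF U] spec_smult[OF U] spec_const[OF U] Dd)
  qed
  have f: "operator_monotone f" "\<And>s. 0 < s \<Longrightarrow> 0 < f s" "f 1 = 1"
    using assms(14) by (auto simp: representing_function_def)
  have Zge: "2 * Re (ip s y) - rform ?W s \<le> rform Z y"
    if s: "s \<in> carrier_vec n" and y: "y \<in> carrier_vec n" for s y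
  proof -
    have "rform ?W s = ?N / ?c * Re (ip s s) - 1 / ?c * rform D s"
      unfolding Weq using D s by (simp add: sq_distrib ip_sq del: of_real_add of_real_mult of_real_divide)
    also have "\<dots> = defect v s"
      unfolding defect_def Dform[OF s] by (simp add: add_divide_distrib diff_divide_distrib algebra_simps)
    finally show ?thesis
      using mean_form_bound[OF f assms(12,13) _ assms(15) _ s y] assms(16,18) re_mat_form[OF cG y]
      by (simp add: Z_def G_def)
  qed
  have W'Z: "rform ?W' y \<le> rform Z y" if y: "y \<in> carrier_vec n" for y
  proof -
    \<comment> \<open>\<open>s = W^(-1) y\<close> maximizes \<open>2 Re <s, y> - <W s, s>\<close>,
      so \<open>Zge\<close> at this vector is \<open>Z \<ge> W^(-1)\<close>.\<close>
    let ?s = "?W' *\<^sub>v y"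
    have s: "?s \<in> carrier_vec n" using cW y by simp
    have "?W *\<^sub>v ?s = y" by (rule spec_inverse[OF U _ y]) (use w in \<open>force simp flip: of_real_mult\<close>)
    then have "rform ?W ?s = Re (ip ?s y)" using Re_ip_sym[OF s y] by simp
    with Zge[OF s y] show ?thesis by simp
  qed
  define X where "X = re_mat (\<Phi> (arith_mean v A B))"
  define Y where "Y = re_mat (\<Phi> G)"
  have X\<Phi>: "X = \<Phi> D" unfolding X_def D_def by (rule \<Phi>_re_mat[OF carith])
  have Y\<Phi>: "Y = \<Phi> Z" unfolding Y_def Z_def by (rule \<Phi>_re_mat[OF cG])
  have X: "X \<in> carrier_mat n n" "hermitian_mat X" unfolding X\<Phi> using D \<Phi>_hermitian by auto
  have Y: "Y \<in> carrier_mat n n" "hermitian_mat Y" unfolding Y\<Phi> using Z \<Phi>_hermitian by auto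
  \<comment> \<open>This is \<open>Y \<ge> c (N - X)^(-1)\<close> with the inverse replaced by the
    free vector \<open>s\<close>: Choi's inequality for \<open>W\<close>, followed by monotonicity
    of \<open>\<Phi>\<close>.\<close>
  have main: "2 * Re (ip s y) \<le> (?N * Re (ip s s) - rform X s) / ?c + rform Y y"
    if s: "s \<in> carrier_vec n" and y: "y \<in> carrier_vec n" for s y
  proof -
    have "2 * Re (ip s y) \<le> rform (\<Phi> ?W) s + rform (\<Phi> ?W') y"
      using choi_inequality[where w = w, OF U w s y] by simp
    also have "rform (\<Phi> ?W') y \<le> rform Y y"
      unfolding Y\<Phi> by (rule \<Phi>_form_mono[OF cW(2) hermitian_spec[OF U] Z W'Z y])
    also have "rform (\<Phi> ?W) s = (?N * Re (ip s s) - rform X s) / ?c"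
      unfolding Weq X\<Phi> using D s
      by (simp add: \<Phi>_add \<Phi>_smult \<Phi>_one sq_distrib ip_sq diff_divide_distrib del: of_real_add of_real_mult of_real_divide)
    finally show ?thesis by simp
  qed
  have Xlb: "m * Re (ip x x) \<le> rform X x" if x: "x \<in> carrier_vec n" for x
  proof -
    have "rform (\<Phi> (complex_of_real m \<cdot>\<^sub>m 1\<^sub>m n)) x \<le> rform (\<Phi> D) x"
    proof (rule \<Phi>_form_mono[OF _ _ D _ x])
      show "hermitian_mat (complex_of_real m \<cdot>\<^sub>m 1\<^sub>m n)" by (simp add: hermitian_mat_def mat_adjoint_smult)
      show "rform (complex_of_real m \<cdot>\<^sub>m 1\<^sub>m n) x \<le> rform D x" if "x \<in> carrier_vec n" for x
        using Dlb[OF that] that by (simp add: ip_sq)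
    qed simp
    then show ?thesis unfolding X\<Phi> using x by (simp add: \<Phi>_smult \<Phi>_one ip_sq)
  qed
  obtain UX dX where UX: "unitary n UX" and XdX: "X = rspec n UX dX"
    using hermitian_spectral[OF X] .
  obtain UY dY where UY: "unitary n UY" and YdY: "Y = rspec n UY dY"
    using hermitian_spectral[OF Y] .
  have dX: "0 < dX i" if "i < n" for i
    using eigenvalue_ge_of_form[OF UX that, of m dX] Xlb m by (simp add: XdX)
  have dY: "0 < dY i" if "i < n" for i
  proof -
    have "m \<le> dY i"
    proof (rule eigenvalue_ge_of_form[OF UY that])
      fix y :: "complex vec" assume y: "y \<in> carrier_vec n"
      \<comment> \<open>With \<open>s = m y\<close> and \<open>X \<ge> m\<close>,
        \<open>main\<close> turns into \<open>Y \<ge> m\<close>, since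
        \<open>(N - m) m^2 / c = m\<close>.\<close>
      let ?s = "complex_of_real m \<cdot>\<^sub>v y"
      have s: "?s \<in> carrier_vec n" using y by simp
      have ss: "Re (ip ?s ?s) = m * m * Re (ip y y)" "Re (ip ?s y) = m * Re (ip y y)" using y by (simp_all add: ip_sq)
      have "(?N * Re (ip ?s ?s) - rform X ?s) / ?c \<le> (?N * Re (ip ?s ?s) - m * Re (ip ?s ?s)) / ?c"
        using Xlb[OF s] c by (intro divide_right_mono) auto
      also have "\<dots> = m * Re (ip y y)" unfolding ss using m M by (simp add: field_simps)
      finally show "m * Re (ip y y) \<le> rform (rspec n UY dY) y"
        using main[OF s y] unfolding ss YdY by linarith
    qed
    then show ?thesis using m by simp
  qed
  have le: "rform (rpow n UX dX 1) s + ?c * rform (rpow n UY dY (- 1)) s \<le> ?N * Re (ip s s)"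
    if s: "s \<in> carrier_vec n" for s
  proof -
    \<comment> \<open>Choosing \<open>y = Y^(-1) s\<close> in \<open>main\<close> gives
      \<open>c Y^(-1) \<le> N - X\<close>.\<close>
    let ?y = "rpow n UY dY (- 1) *\<^sub>v s"
    have y: "?y \<in> carrier_vec n" using UY s by simp
    have X1: "rpow n UX dX 1 = X" unfolding XdX using dX by (intro spec_cong) (simp add: less_imp_le)
    have Y1: "rpow n UY dY 1 = Y" unfolding YdY using dY by (intro spec_cong) (simp add: less_imp_le)
    have "Y *\<^sub>v ?y = s"
      unfolding Y1[symmetric] rpow_add[OF UY s] using rpow_0(1)[OF UY dY s] by simp
    with main[OF s y] have "2 * Re (ip s ?y) \<le> (?N * Re (ip s s) - rform X s) / ?c + Re (ip s ?y)" by simp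
    then have "Re (ip s ?y) \<le> (?N * Re (ip s s) - rform X s) / ?c" by simp
    then have "?c * Re (ip s ?y) \<le> ?N * Re (ip s s) - rform X s"
      using c by (simp add: le_divide_eq mult.commute)
    moreover have "Re (ip s ?y) = Re (ip ?y s)" by (rule Re_ip_sym[OF s y])
    ultimately show ?thesis unfolding X1 by simp
  qed
  define K where "K = ?N\<^sup>2 / (4 * m * M)"
  define \<alpha> where "\<alpha> = max K (4 powr (1 - 2 / p) * K)"
  have K': "K = ?N\<^sup>2 / (4 * ?c)" by (simp add: K_def mult.assoc)
  have hX: "herm_calc (\<lambda>t. t powr p) X = rpow n UX dX p" unfolding XdX by (rule herm_calc_spec[OF UX])
  have hY: "herm_calc (\<lambda>t. t powr p) Y = rpow n UY dY p" unfolding YdY by (rule herm_calc_spec[OF UY])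
  have aY: "complex_of_real (\<alpha> powr p) \<cdot>\<^sub>m rpow n UY dY p = spec n UY (\<lambda>i. complex_of_real (\<alpha> powr p * dY i powr p))"
    unfolding spec_smult[OF UY, symmetric] by simp
  have "loewner_le (rpow n UX dX p) (complex_of_real (\<alpha> powr p) \<cdot>\<^sub>m rpow n UY dY p)"
    unfolding loewner_le_iff[OF spec_carrier[OF UX] smult_carrier_mat[OF spec_carrier[OF UY]]]
  proof (intro conjI ballI)
    show "hermitian_mat (rpow n UX dX p)" by (rule hermitian_spec[OF UX])
    show "hermitian_mat (complex_of_real (\<alpha> powr p) \<cdot>\<^sub>m rpow n UY dY p)" unfolding aY by (rule hermitian_spec[OF UY])
    fix x :: "complex vec" assume x: "x \<in> carrier_vec n"
    have "rform (rpow n UX dX p) x \<le> \<alpha> powr p * rform (rpow n UY dY p) x"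
      proof -
      interpret rpow_pair n UX UY dX dY by unfold_locales (use UX UY dX dY in auto)
      show ?thesis by (rule power_comparison[OF N c le assms(19) K' \<alpha>_def x])
    qed
    then show "rform (rpow n UX dX p) x \<le> rform (complex_of_real (\<alpha> powr p) \<cdot>\<^sub>m rpow n UY dY p) x"
      using UY x by (simp add: ip_sq)
  qed
  then show ?thesis
    unfolding Let_def hX[symmetric] hY[symmetric] X_def Y_def G_def \<alpha>_def K_def .
qed

end
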